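(* Let $d_1\ge1$ be fixed, and suppose $d_2,p\to\infty$ with $p/d_2\to c\,d_1$, where $0<c<\infty$. Let $w=\frac1{d_1}(w_{ij})_{i,j=1}^{d_1}$ be the limit (in the sense described in the context) of the Wishart matrices $W=\frac{1}{d_1d_2}(G_iG_j^* )_{i,j=1}^{d_1}$, and let $Y_0,Y_1,\dots,Y_{d_1-1}$ be the diagonal decomposition of $d_1w^t=(w_{ji})_{ij}$. Then: (1) if $d_1$ is even, $Y_0,Y_1,\dots,Y_{d_1/2}$ are $*$-free; if $d_1$ is odd, $Y_0,Y_1,\dots,Y_{(d_1-1)/2}$ are $*$-free (with respect to $\varphi$); (2) $Y_0$ has the Marchenko–Pastur distribution with parameter $c\,d_1$; (3) $Y_{d_1-i}=Y_i^*$ for $1\le i\le d_1-1$, and for $1\le i\le d_1-1$ with $i\neq d_1/2$, $Y_i$ is an $R$-diagonal operator with $\kappa_{2n}(Y_i,Y_i^*,\dots,Y_i,Y_i^* )=c\,d_1$ for all $n\ge1$; (4) if $d_1$ is even, $Y_{d_1/2}$ is even with $\kappa_{2n}(Y_{d_1/2},Y_{d_1/2}^*,\dots,Y_{d_1/2},Y_{d_1/2}^* )=c\,d_1$ for all $n\ge1$.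
   Context: $G_1,\dots,G_{d_1}$ are independent $d_2\times p$ random matrices whose entries are all independent complex Gaussian $\mathcal N(0,1)$ variables, and $W=\frac1{d_1d_2}(G_iG_j^* )_{ij}\in M_{d_1}(\mathbb C)\otimes M_{d_2}(\mathbb C)$. The limit $w$: there are a $*$-probability space $(\mathcal A,\tau)$ and a self-adjoint $w=\frac1{d_1}(w_{ij})_{ij}\in M_{d_1}(\mathcal A)$, where $M_{d_1}(\mathcal A)$ carries the state $\varphi=\mathrm{tr}\otimes\tau$, i.e. $\varphi((x_{ij}))=\frac1{d_1}\sum_i\tau(x_{ii})$, such that the expected normalized-trace mixed moments of $W$ and the matrix units $e_{ij}\otimes 1_{d_2}$ converge to the corresponding $\varphi$-mixed moments of $w$ and the matrix units $e_{ij}\in M_{d_1}(\mathbb C)$; the element $w$ has the Marchenko–Pastur distribution with parameter $c$ and is $\varphi$-free from $M_{d_1}(\mathbb C)$. Then $d_1w^t=(w_{ji})_{ij}$ is the limit of $d_1$ times the partial transpose $\frac1{d_1d_2}(G_jG_i^* )_{ij}$. The Marchenko–Pastur law with parameter $c>0$ has density $\frac{\sqrt{(b-t)(t-a)}}{2\pi t}$ on $[a,b]$, $a=(1-\sqrt c)^2$, $b=(1+\sqrt c)^2$, plus an atom of mass $1-c$ at $0$ if $c<1$; all its free cumulants equal $c$. Diagonal decomposition: for $A=(a_{ij})\in M_{d_1}(\mathcal A)$, $A=A_0+\cdots+A_{d_1-1}$ with $(A_k)_{ij}=a_{ij}$ if $j\equiv i+k\pmod{d_1}$ and $0$ otherwise.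 $\kappa_n$ are the scalar free cumulants with respect to $\varphi$. An element $a$ is $R$-diagonal if, writing $a^{(1)}=a$, $a^{(-1)}=a^*$, $\kappa_n(a^{(\epsilon_1)},\dots,a^{(\epsilon_n)})=0$ unless $n$ is even and $\epsilon_i=-\epsilon_{i+1}$ for $1\le i\le n-1$. A self-adjoint element is even if all its odd moments vanish. Elements are $*$-free if the unital $*$-algebras they generate are free with respect to $\varphi$. *)

theory Defs
  imports
    "HOL-Probability.Probability"
    "Jordan_Normal_Form.Matrix"
begin

class complex_star_algebra = ring_1 +
  fixes scaleC :: "complex \<Rightarrow> 'a \<Rightarrow> 'a"
    and star :: "'a \<Rightarrow> 'a"
  assumes scaleC_add_right: "scaleC z (x + y) = scaleC z x + scaleC z y"
    and scaleC_add_left: "scaleC (z + z') x = scaleC z x + scaleC z' x"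
    and scaleC_scaleC: "scaleC z (scaleC z' x) = scaleC (z * z') x"
    and scaleC_one: "scaleC 1 x = x"
    and mult_scaleC_left: "scaleC z x * y = scaleC z (x * y)"
    and mult_scaleC_right: "x * scaleC z y = scaleC z (x * y)"
    and star_star: "star (star x) = x"
    and star_add: "star (x + y) = star x + star y"
    and star_mult: "star (x * y) = star y * star x"
    and star_scaleC: "star (scaleC z x) = scaleC (cnj z) (star x)"

instantiation complex :: complex_star_algebra
begin

definition scaleC_complex :: "complex \<Rightarrow> complex \<Rightarrow> complex"
  where "scaleC_complex z x = z * x"

definition star_complex :: "complex \<Rightarrow> complex"
  where "star_complex = cnj"

instance
  by standard (simp_all add: scaleC_complex_def star_complex_def algebra_simps)

end

definition star_probability_space :: "('a::complex_star_algebra \<Rightarrow> complex) \<Rightarrow> bool" where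
  "star_probability_space \<tau> \<longleftrightarrow>
     (\<forall>x y. \<tau> (x + y) = \<tau> x + \<tau> y) \<and>
     (\<forall>z x. \<tau> (scaleC z x) = z * \<tau> x) \<and>
     \<tau> 1 = 1 \<and>
     (\<forall>x. \<tau> (star x * x) \<in> \<real>\<^sub>\<ge>\<^sub>0)"

definition mat_star :: "'a::complex_star_algebra mat \<Rightarrow> 'a mat" where
  "mat_star A = map_mat star (transpose_mat A)"

definition mat_scaleC :: "complex \<Rightarrow> 'a::complex_star_algebra mat \<Rightarrow> 'a mat" where
  "mat_scaleC z A = map_mat (scaleC z) A"

definition mat_state :: "nat \<Rightarrow> ('a::complex_star_algebra \<Rightarrow> complex) \<Rightarrow> 'a mat \<Rightarrow> complex" where
  "mat_state d \<tau> A = (1 / of_nat d) * (\<Sum>i<d. \<tau> (A $$ (i, i)))"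

text \<open>
  The joint moments \<open>[A\<^sub>1, \<dots>, A\<^sub>n] \<mapsto> \<phi> (A\<^sub>1 \<cdots> A\<^sub>n)\<close> for the state \<open>\<phi> = tr \<otimes> \<tau>\<close>. The notions of free
  probability below refer to a noncommutative probability space only through such a
  functional on lists, since the algebra of \<open>d \<times> d\<close> matrices is a carrier set rather than a type.
\<close>

definition mat_moment :: "nat \<Rightarrow> ('a::complex_star_algebra \<Rightarrow> complex) \<Rightarrow> 'a mat list \<Rightarrow> complex" where
  "mat_moment d \<tau> As = mat_state d \<tau> (foldr (*) As (1\<^sub>m d))"

definition mat_unit :: "nat \<Rightarrow> nat \<Rightarrow> nat \<Rightarrow> 'a::complex_star_algebra mat" where
  "mat_unit d i j = Matrix.mat d d (\<lambda>(a, b). if a = i \<and> b = j then 1 else 0)"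

text \<open>The image of \<open>M\<^sub>d(\<complex>)\<close> in the \<open>d \<times> d\<close> matrices over the algebra.\<close>

definition scalar_matrices :: "nat \<Rightarrow> 'a::complex_star_algebra mat set" where
  "scalar_matrices d = (map_mat (\<lambda>z. scaleC z 1)) ` carrier_mat d d"

inductive_set generated_star_algebra :: "nat \<Rightarrow> 'a::complex_star_algebra mat set \<Rightarrow> 'a mat set"
  for d S where
  base: "A \<in> S \<Longrightarrow> A \<in> generated_star_algebra d S"
| one: "1\<^sub>m d \<in> generated_star_algebra d S"
| add: "A \<in> generated_star_algebra d S \<Longrightarrow> B \<in> generated_star_algebra d S
    \<Longrightarrow> A + B \<in> generated_star_algebra d S"
| mult: "A \<in> generated_star_algebra d S \<Longrightarrow> B \<in> generated_star_algebra d S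
    \<Longrightarrow> A * B \<in> generated_star_algebra d S"
| scale: "A \<in> generated_star_algebra d S \<Longrightarrow> mat_scaleC z A \<in> generated_star_algebra d S"
| star: "A \<in> generated_star_algebra d S \<Longrightarrow> mat_star A \<in> generated_star_algebra d S"

text \<open>The diagonals \<open>A\<^sub>k\<close> of the decomposition \<open>A = A\<^sub>0 + \<cdots> + A\<^bsub>d-1\<^esub>\<close>.\<close>

definition diagonal_part :: "nat \<Rightarrow> 'a::complex_star_algebra mat \<Rightarrow> nat \<Rightarrow> 'a mat" where
  "diagonal_part d A k =
     Matrix.mat d d (\<lambda>(i, j). if j mod d = (i + k) mod d then A $$ (i, j) else 0)"

text \<open>The sets \<open>S i\<close> are meant to be unital subalgebras.\<close>

definition free_family :: "('x list \<Rightarrow> complex) \<Rightarrow> 'i set \<Rightarrow> ('i \<Rightarrow> 'x set) \<Rightarrow> bool" where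
  "free_family M I S \<longleftrightarrow>
     (\<forall>xs :: ('i \<times> 'x) list.
        xs \<noteq> [] \<and> distinct_adj (map fst xs) \<and>
        (\<forall>(i, x) \<in> set xs. i \<in> I \<and> x \<in> S i \<and> M [x] = 0) \<longrightarrow>
        M (map snd xs) = 0)"

definition noncrossing_partition :: "nat \<Rightarrow> nat set set \<Rightarrow> bool" where
  "noncrossing_partition n \<pi> \<longleftrightarrow>
     partition_on {..<n} \<pi> \<and>
     (\<forall>U\<in>\<pi>. \<forall>V\<in>\<pi>. \<forall>a b c d. a < b \<and> b < c \<and> c < d \<and> a \<in> U \<and> c \<in> U \<and> b \<in> V \<and> d \<in> V \<longrightarrow> U = V)"

lemma nths_proper_block_less:
  assumes "noncrossing_partition (length xs) \<pi>" "\<pi> \<noteq> {{..<length xs}}" "V \<in> \<pi>"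
  shows "length (nths xs V) < length xs"
proof -
  have P: "partition_on {..<length xs} \<pi>"
    using assms(1) by (simp add: noncrossing_partition_def)
  have sub: "V \<subseteq> {..<length xs}"
    using P assms(3) by (auto simp: partition_on_def)
  have "V \<noteq> {..<length xs}"
  proof
    assume V: "V = {..<length xs}"
    have "U = V" if "U \<in> \<pi>" for U
    proof (rule ccontr)
      assume "U \<noteq> V"
      hence "U \<inter> V = {}" using P that assms(3) by (auto simp: partition_on_def disjoint_def)
      moreover have "U \<subseteq> V" using P that V by (auto simp: partition_on_def)
      ultimately have "U = {}" by blast
      thus False using P that by (auto simp: partition_on_def)
    qed
    hence "\<pi> = {V}" using assms(3) by blast
    thus False using assms(2) V by simp
  qed
  hence "V \<subset> {..<length xs}" using sub by blast
  moreover have "{i. i < length xs \<and> i \<in> V} = V" using sub by auto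
  ultimately show ?thesis
    using psubset_card_mono[of "{..<length xs}" V] by (simp add: length_nths)
qed

text \<open>
  The moment-cumulant formula \<open>M xs = (\<Sum>\<pi>\<in>NC(n). \<Prod>V\<in>\<pi>. \<kappa> (xs restricted to V))\<close>, solved for the
  summand of the one-block partition; see \<open>moment_cumulant\<close>.
\<close>

function free_cumulant :: "('x list \<Rightarrow> complex) \<Rightarrow> 'x list \<Rightarrow> complex" where
  "free_cumulant M xs =
     M xs - (\<Sum>\<pi> | noncrossing_partition (length xs) \<pi> \<and> \<pi> \<noteq> {{..<length xs}}.
               \<Prod>V\<in>\<pi>. free_cumulant M (nths xs V))"
  by pat_completeness auto
termination
  by (relation "Wellfounded.measure (\<lambda>(M, xs). length xs)") (auto intro: nths_proper_block_less)

declare free_cumulant.simps [simp del]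

lemma finite_noncrossing_partitions: "finite {\<pi>. noncrossing_partition n \<pi>}"
  by (rule finite_subset[of _ "Pow (Pow {..<n})"])
    (auto simp: noncrossing_partition_def partition_on_def)

lemma moment_cumulant:
  assumes "xs \<noteq> []"
  shows "M xs = (\<Sum>\<pi> | noncrossing_partition (length xs) \<pi>. \<Prod>V\<in>\<pi>. free_cumulant M (nths xs V))"
proof -
  let ?n = "length xs" and ?f = "\<lambda>\<pi>. \<Prod>V\<in>\<pi>. free_cumulant M (nths xs V)"
  let ?N = "{\<pi>. noncrossing_partition ?n \<pi>}"
  have "{{..<?n}} \<in> ?N"
    using assms by (auto simp: noncrossing_partition_def intro!: partition_on_space)
  hence "sum ?f ?N = ?f {{..<?n}} + sum ?f (?N - {{{..<?n}}})"
    by (rule sum.remove[OF finite_noncrossing_partitions])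
  moreover have "?N - {{{..<?n}}} = {\<pi>. noncrossing_partition ?n \<pi> \<and> \<pi> \<noteq> {{..<?n}}}"
    by auto
  moreover have "nths xs {..<?n} = xs"
    by (simp add: nths_upt_eq_take)
  ultimately show ?thesis
    using free_cumulant.simps[of M xs] by simp
qed

text \<open>
  In the following, \<open>s\<close> is the involution of the algebra on which \<open>M\<close> gives the joint moments.
\<close>

definition R_diagonal :: "('x list \<Rightarrow> complex) \<Rightarrow> ('x \<Rightarrow> 'x) \<Rightarrow> 'x \<Rightarrow> bool" where
  "R_diagonal M s a \<longleftrightarrow>
     (\<forall>\<epsilon>s :: bool list. \<epsilon>s \<noteq> [] \<and> \<not> (even (length \<epsilon>s) \<and> distinct_adj \<epsilon>s) \<longrightarrow>
        free_cumulant M (map (\<lambda>\<epsilon>. if \<epsilon> then a else s a) \<epsilon>s) = 0)"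

definition even_element :: "('x list \<Rightarrow> complex) \<Rightarrow> ('x \<Rightarrow> 'x) \<Rightarrow> 'x \<Rightarrow> bool" where
  "even_element M s a \<longleftrightarrow> s a = a \<and> (\<forall>n. odd n \<longrightarrow> M (replicate n a) = 0)"

definition has_law :: "('x list \<Rightarrow> complex) \<Rightarrow> ('x \<Rightarrow> 'x) \<Rightarrow> 'x \<Rightarrow> real measure \<Rightarrow> bool" where
  "has_law M s a \<mu> \<longleftrightarrow> s a = a \<and>
     (\<forall>n. integrable \<mu> (\<lambda>t. t ^ n) \<and> M (replicate n a) = of_real (\<integral>t. t ^ n \<partial>\<mu>))"

definition marchenko_pastur_density :: "real \<Rightarrow> real \<Rightarrow> real" where
  "marchenko_pastur_density c t =
     (let a = (1 - sqrt c)\<^sup>2; b = (1 + sqrt c)\<^sup>2 in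
      if a \<le> t \<and> t \<le> b then sqrt ((b - t) * (t - a)) / (2 * pi * t) else 0)"

text \<open>Since \<open>ennreal\<close> truncates at \<open>0\<close>, the atom is present only for \<open>c < 1\<close>.\<close>

definition marchenko_pastur :: "real \<Rightarrow> real measure" where
  "marchenko_pastur c = measure_of UNIV (sets borel)
     (\<lambda>B. emeasure (density lborel (\<lambda>t. ennreal (marchenko_pastur_density c t))) B
          + ennreal (1 - c) * indicator B 0)"

lemma sets_marchenko_pastur [measurable_cong, simp]: "sets (marchenko_pastur c) = sets borel"
  using sets.sigma_sets_eq[of "borel :: real measure"]
  by (simp add: marchenko_pastur_def)

lemma emeasure_marchenko_pastur:
  assumes "B \<in> sets borel"
  shows "emeasure (marchenko_pastur c) B =
           emeasure (density lborel (\<lambda>t. ennreal (marchenko_pastur_density c t))) B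
           + ennreal (1 - c) * indicator B 0"
proof (rule emeasure_measure_of[OF marchenko_pastur_def])
  let ?D = "density lborel (\<lambda>t. ennreal (marchenko_pastur_density c t))"
  let ?\<mu> = "\<lambda>B. emeasure ?D B + ennreal (1 - c) * indicator B 0"
  show "positive (sets (marchenko_pastur c)) ?\<mu>"
    by (simp add: positive_def)
  show "countably_additive (sets (marchenko_pastur c)) ?\<mu>"
  proof (rule countably_additiveI)
    fix A :: "nat \<Rightarrow> real set"
    assume A: "range A \<subseteq> sets (marchenko_pastur c)" "disjoint_family A"
    have "(\<Sum>i. ?\<mu> (A i)) = (\<Sum>i. emeasure ?D (A i)) + (\<Sum>i. ennreal (1 - c) * indicator (A i) 0)"
      by (rule suminf_add[symmetric]) simp_all
    also have "(\<Sum>i. emeasure ?D (A i)) = emeasure ?D (\<Union>i. A i)"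
      using A by (intro suminf_emeasure) simp_all
    also have "(\<Sum>i. ennreal (1 - c) * indicator (A i) 0) = ennreal (1 - c) * indicator (\<Union>i. A i) 0"
      using A(2) by (simp add: suminf_indicator)
    finally show "(\<Sum>i. ?\<mu> (A i)) = ?\<mu> (\<Union>i. A i)" .
  qed
qed (use assms in auto)

text \<open>The standard complex Gaussian, normalized by \<open>E \<bar>Z\<bar>\<^sup>2 = 1\<close>.\<close>

definition complex_gaussian :: "'w measure \<Rightarrow> ('w \<Rightarrow> complex) \<Rightarrow> bool" where
  "complex_gaussian P Z \<longleftrightarrow> distributed P lborel Z (\<lambda>z. ennreal (exp (- (cmod z)\<^sup>2) / pi))"

definition iid_gaussian_matrices ::
    "'w measure \<Rightarrow> nat \<Rightarrow> nat \<Rightarrow> nat \<Rightarrow> (nat \<Rightarrow> 'w \<Rightarrow> complex mat) \<Rightarrow> bool" where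
  "iid_gaussian_matrices P d1 d2 p G \<longleftrightarrow>
     prob_space P \<and>
     (\<forall>i<d1. \<forall>\<omega>. G i \<omega> \<in> carrier_mat d2 p) \<and>
     (\<forall>i<d1. \<forall>a<d2. \<forall>k<p. complex_gaussian P (\<lambda>\<omega>. G i \<omega> $$ (a, k))) \<and>
     prob_space.indep_vars P (\<lambda>_. borel) (\<lambda>(i, a, k) \<omega>. G i \<omega> $$ (a, k))
       ({..<d1} \<times> {..<d2} \<times> {..<p})"

text \<open>\<open>M\<^bsub>d1\<^esub>(\<complex>) \<otimes> M\<^bsub>d2\<^esub>(\<complex>)\<close> is identified with \<open>M\<^bsub>d1 d2\<^esub>(\<complex>)\<close> by means of \<open>d2 \<times> d2\<close> blocks.\<close>

definition block_matrix :: "nat \<Rightarrow> nat \<Rightarrow> (nat \<Rightarrow> nat \<Rightarrow> complex mat) \<Rightarrow> complex mat" where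
  "block_matrix d1 d2 B =
     Matrix.mat (d1 * d2) (d1 * d2) (\<lambda>(x, y). B (x div d2) (y div d2) $$ (x mod d2, y mod d2))"

definition wishart :: "nat \<Rightarrow> nat \<Rightarrow> (nat \<Rightarrow> complex mat) \<Rightarrow> complex mat" where
  "wishart d1 d2 G = mat_scaleC (1 / of_nat (d1 * d2)) (block_matrix d1 d2 (\<lambda>i j. G i * mat_star (G j)))"

text \<open>The matrix \<open>e\<^sub>i\<^sub>j \<otimes> 1\<close>.\<close>

definition block_unit :: "nat \<Rightarrow> nat \<Rightarrow> nat \<Rightarrow> nat \<Rightarrow> complex mat" where
  "block_unit d1 d2 i j =
     block_matrix d1 d2 (\<lambda>a b. if a = i \<and> b = j then 1\<^sub>m d2 else 0\<^sub>m d2 d2)"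

text \<open>
  Mixed moments are indexed by words in a letter for the Wishart matrix or its limit and letters
  for the matrix units.
\<close>

datatype letter = X | E nat nat

primrec eval_letter :: "'x \<Rightarrow> (nat \<Rightarrow> nat \<Rightarrow> 'x) \<Rightarrow> letter \<Rightarrow> 'x" where
  "eval_letter x e X = x"
| "eval_letter x e (E i j) = e i j"

text \<open>
  On the left, \<open>mat_moment\<close> is taken over the algebra \<open>\<complex>\<close> with the identity as state, so it is the
  normalized trace of the product.
\<close>

definition wishart_converges ::
    "(nat \<Rightarrow> 'w measure) \<Rightarrow> nat \<Rightarrow> (nat \<Rightarrow> nat) \<Rightarrow> (nat \<Rightarrow> nat \<Rightarrow> 'w \<Rightarrow> complex mat) \<Rightarrow>
     ('a::complex_star_algebra \<Rightarrow> complex) \<Rightarrow> 'a mat \<Rightarrow> bool" where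
  "wishart_converges P d1 d2 G \<tau> w \<longleftrightarrow>
     (\<forall>ls :: letter list. set ls \<subseteq> insert X {E i j | i j. i < d1 \<and> j < d1} \<longrightarrow>
        (\<lambda>n. \<integral>\<omega>. mat_moment (d1 * d2 n) (\<lambda>z. z)
                 (map (eval_letter (wishart d1 (d2 n) (\<lambda>i. G n i \<omega>)) (block_unit d1 (d2 n))) ls) \<partial>P n)
        \<longlonglongrightarrow> mat_moment d1 \<tau> (map (eval_letter w (mat_unit d1)) ls))"

end

theory Submission
  imports Defs
begin

text \<open>
  Freeness of \<open>w\<close> from the scalar matrices determines the joint moments of the entries:
  \<open>\<tau> (u\<^bsub>i1 j1\<^esub> \<cdots> u\<^bsub>in jn\<^esub>)\<close> is \<open>d ^ (n + 1)\<close> times the trace of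
  \<open>w e\<^bsub>j1 i2\<^esub> w e\<^bsub>j2 i3\<^esub> \<cdots> w e\<^bsub>jn i1\<^esub>\<close>, and since mixed cumulants of \<open>w\<close> and the matrix
  units vanish while all cumulants of \<open>w\<close> are \<open>c\<close>, the family \<open>u\<close> has the cumulants \<open>c d\<close> on cyclic
  words with \<open>j\<^sub>k = i\<^sub>k\<^sub>+\<^sub>1\<close> and \<open>0\<close> on all others. For the diagonals of the transpose, these index
  conditions along a walk mean that consecutive steps in a block cancel, so that the joint
  cumulant of \<open>Y\<^bsub>k1\<^esub>, \<dots>, Y\<^bsub>kr\<^esub>\<close> is \<open>c d\<close> if \<open>k\<^sub>m + k\<^sub>m\<^sub>+\<^sub>1\<close> is divisible by \<open>d\<close> for all \<open>m\<close> and
  either \<open>r\<close> is even or the steps are \<open>0\<close>, and \<open>0\<close> otherwise. All claims can be read off from this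
  formula, since a family whose mixed cumulants vanish is free.
\<close>

subsection \<open>Sums over noncrossing partitions\<close>

text \<open>Every identity between sums over noncrossing partitions is reduced to one recursion
  along the block of the first letter: \<open>noncrossing_sum_from\<close> prescribes the beginning
  of that block, and enlarging it by one letter cuts off an enclosed word that is summed
  independently. Both kinds of sums are then treated together, by induction on the length of the
  remaining word. That mixed cumulants of free elements vanish follows from uniqueness: the moments
  are determined by those of words in one colour and by the vanishing of alternating centred
  products, and the functional with the mixed cumulants deleted shares both data. The obstacle for
  the diagonals is that the walk attaches to each step a position depending on all earlier steps,
  whereas a cumulant sees only the steps of its block. An enclosed word whose steps do not sum to a
  multiple of \<open>d\<close> contributes 0, and after any other one the walk is back where the
  block left it; hence the walk restricted to a block is again a walk. That all cumulants of
  \<open>w\<close> are \<open>c\<close> is derived from the density itself, by way of a quadratic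
  equation for the generating function of the moments.\<close>

definition noncrossing_on :: "nat set \<Rightarrow> nat set set set" where
  "noncrossing_on S = {\<pi>. partition_on S \<pi> \<and>
     (\<forall>U\<in>\<pi>. \<forall>V\<in>\<pi>. \<forall>a b c d. a < b \<and> b < c \<and> c < d \<and> a \<in> U \<and> c \<in> U \<and> b \<in> V \<and> d \<in> V \<longrightarrow> U = V)}"

lemma noncrossing_on_lessThan: "noncrossing_on {..<n} = {\<pi>. noncrossing_partition n \<pi>}"
  by (simp add: noncrossing_on_def noncrossing_partition_def)

lemma finite_noncrossing_on: "finite S \<Longrightarrow> finite (noncrossing_on S)"
  by (rule finite_subset[of _ "Pow (Pow S)"]) (auto simp: noncrossing_on_def partition_on_def)

lemma noncrossing_onD:
  assumes "\<pi> \<in> noncrossing_on S"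
  shows "\<Union>\<pi> = S" "{} \<notin> \<pi>" "\<And>U V. U \<in> \<pi> \<Longrightarrow> V \<in> \<pi> \<Longrightarrow> U \<inter> V \<noteq> {} \<Longrightarrow> U = V"
    "\<And>U. U \<in> \<pi> \<Longrightarrow> U \<subseteq> S"
    "\<And>U V a b c d. U \<in> \<pi> \<Longrightarrow> V \<in> \<pi> \<Longrightarrow> a < b \<Longrightarrow> b < c \<Longrightarrow> c < d \<Longrightarrow> a \<in> U \<Longrightarrow> c \<in> U \<Longrightarrow> b \<in> V \<Longrightarrow> d \<in> V \<Longrightarrow> U = V"
proof -
  have P: "partition_on S \<pi>" and N: "\<And>U V a b c d. U \<in> \<pi> \<Longrightarrow> V \<in> \<pi> \<Longrightarrow>
    a < b \<and> b < c \<and> c < d \<and> a \<in> U \<and> c \<in> U \<and> b \<in> V \<and> d \<in> V \<Longrightarrow> U = V"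
    using assms unfolding noncrossing_on_def by blast+
  show "\<Union>\<pi> = S" "{} \<notin> \<pi>" "\<And>U V. U \<in> \<pi> \<Longrightarrow> V \<in> \<pi> \<Longrightarrow> U \<inter> V \<noteq> {} \<Longrightarrow> U = V"
    "\<And>U. U \<in> \<pi> \<Longrightarrow> U \<subseteq> S"
    using P by (auto simp: partition_on_def disjoint_def)
  fix U V a b c d assume "U \<in> \<pi>" "V \<in> \<pi>" "a < b" "b < c" "c < d" "a \<in> U" "c \<in> U" "b \<in> V" "d \<in> V"
  thus "U = V" using N[of U V a b c d] by simp
qed

lemma noncrossing_onI:
  assumes "\<Union>\<pi> = S" "{} \<notin> \<pi>" "\<And>U V. U \<in> \<pi> \<Longrightarrow> V \<in> \<pi> \<Longrightarrow> U \<inter> V \<noteq> {} \<Longrightarrow> U = V"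
    "\<And>U V a b c d. U \<in> \<pi> \<Longrightarrow> V \<in> \<pi> \<Longrightarrow> a < b \<Longrightarrow> b < c \<Longrightarrow> c < d \<Longrightarrow> a \<in> U \<Longrightarrow> c \<in> U \<Longrightarrow> b \<in> V \<Longrightarrow> d \<in> V \<Longrightarrow> U = V"
  shows "\<pi> \<in> noncrossing_on S"
  unfolding noncrossing_on_def partition_on_def disjoint_def
proof (intro CollectI conjI ballI allI impI)
  fix U V a b c d assume "U \<in> \<pi>" "V \<in> \<pi>"
    "a < b \<and> b < c \<and> c < d \<and> a \<in> U \<and> c \<in> U \<and> b \<in> V \<and> d \<in> V"
  then show "U = V" using assms(4)[of U V a b c d] by simp
qed (use assms in auto)

lemma noncrossing_on_empty: "noncrossing_on {} = {{}}"
  by (auto simp: noncrossing_on_def partition_on_def)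

lemma noncrossing_on_image:
  fixes h :: "nat \<Rightarrow> nat"
  assumes h: "strict_mono_on S h" and \<pi>: "\<pi> \<in> noncrossing_on S"
  shows "(`) h ` \<pi> \<in> noncrossing_on (h ` S)"
proof (rule noncrossing_onI)
  note D = noncrossing_onD[OF \<pi>]
  have inj: "inj_on h S" using h by (rule strict_mono_on_imp_inj_on)
  have less: "x < y" if "h x < h y" "x \<in> S" "y \<in> S" for x y
    using that h by (metis strict_mono_on_less)
  show "\<Union> ((`) h ` \<pi>) = h ` S" using D(1) by auto
  show "{} \<notin> (`) h ` \<pi>" using D(2) by auto
  fix U V assume U: "U \<in> (`) h ` \<pi>" and V: "V \<in> (`) h ` \<pi>"
  then obtain U' V' where UV: "U = h ` U'" "V = h ` V'" "U' \<in> \<pi>" "V' \<in> \<pi>" by auto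
  have sub: "U' \<subseteq> S" "V' \<subseteq> S" using D(4) UV by auto
  { assume "U \<inter> V \<noteq> {}"
    then obtain x y where "x \<in> U'" "y \<in> V'" "h x = h y" using UV by auto
    hence "x = y" using inj sub by (auto simp: inj_on_def)
    hence "U' = V'" using D(3)[OF UV(3,4)] \<open>x \<in> U'\<close> \<open>y \<in> V'\<close> by auto
    thus "U = V" using UV by simp }
  fix a b c d assume *: "a < b" "b < c" "c < d" "a \<in> U" "c \<in> U" "b \<in> V" "d \<in> V"
  then obtain a' b' c' d' where "a = h a'" "b = h b'" "c = h c'" "d = h d'"
    "a' \<in> U'" "c' \<in> U'" "b' \<in> V'" "d' \<in> V'" using UV by auto
  moreover from this have "a' < b'" "b' < c'" "c' < d'"
    using * sub by (auto intro!: less)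
  ultimately have "U' = V'" using D(5)[OF UV(3,4)] by blast
  thus "U = V" using UV by simp
qed

text \<open>Noncrossing depends only on the order, so sums can be transported along order
  embeddings. This turns the sets of positions that arise in the recursion into the positions of
  shorter words.\<close>

lemma sum_noncrossing_on_image:
  fixes h :: "nat \<Rightarrow> nat" and F :: "nat set set \<Rightarrow> complex"
  assumes h: "strict_mono_on S h"
  shows "(\<Sum>\<pi>\<in>noncrossing_on (h ` S). F \<pi>) = (\<Sum>\<pi>\<in>noncrossing_on S. F ((`) h ` \<pi>))"
proof (rule sum.reindex_bij_witness[where i = "\<lambda>\<pi>. (`) h ` \<pi>" and j = "\<lambda>\<pi>. (`) (the_inv_into S h) ` \<pi>"])
  let ?k = "the_inv_into S h"
  have inj: "inj_on h S" using h by (rule strict_mono_on_imp_inj_on)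
  have k: "?k (h x) = x" if "x \<in> S" for x using inj that by (rule the_inv_into_f_f)
  have kmono: "strict_mono_on (h ` S) ?k"
    using h k by (fastforce simp: strict_mono_on_less intro!: strict_mono_onI)
  have kh: "?k ` h ` A = A" if "A \<subseteq> S" for A
    using that k by (force simp: image_image)
  have hk: "h ` ?k ` A = A" if "A \<subseteq> h ` S" for A
    using that kh by (metis subset_imageE)
  show "(`) ?k ` \<pi> \<in> noncrossing_on S" if "\<pi> \<in> noncrossing_on (h ` S)" for \<pi>
    using noncrossing_on_image[OF kmono that] kh[of S] by simp
  show "(`) h ` \<pi> \<in> noncrossing_on (h ` S)" if "\<pi> \<in> noncrossing_on S" for \<pi>
    using noncrossing_on_image[OF h that] .
  show "(`) ?k ` (`) h ` \<pi> = \<pi>" if "\<pi> \<in> noncrossing_on S" for \<pi>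
  proof -
    have "(`) ?k ` (`) h ` \<pi> = id ` \<pi>"
      unfolding image_image by (intro image_cong refl)
          (simp add: kh[unfolded image_image] image_image noncrossing_onD(4)[OF that])
    thus ?thesis by simp
  qed
  show *: "(`) h ` (`) ?k ` \<pi> = \<pi>" if "\<pi> \<in> noncrossing_on (h ` S)" for \<pi>
  proof -
    have "(`) h ` (`) ?k ` \<pi> = id ` \<pi>"
      unfolding image_image by (intro image_cong refl)
          (simp add: hk[unfolded image_image] image_image noncrossing_onD(4)[OF that])
    thus ?thesis by simp
  qed
  show "F ((`) h ` (`) ?k ` \<pi>) = F \<pi>" if "\<pi> \<in> noncrossing_on (h ` S)" for \<pi>
    using *[OF that] by simp
qed

definition nc_total :: "(nat set \<Rightarrow> complex) \<Rightarrow> nat set \<Rightarrow> complex" where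
  "nc_total g S = (\<Sum>\<pi>\<in>noncrossing_on S. \<Prod>V\<in>\<pi>. g V)"

text \<open>The block containing \<open>T\<close> may be larger than \<open>T\<close>. This freedom
  allows the block of the first element to be built up one element at a time.\<close>

definition nc_joined :: "(nat set \<Rightarrow> complex) \<Rightarrow> nat set \<Rightarrow> nat set \<Rightarrow> complex" where
  "nc_joined g T S = (\<Sum>\<pi> | \<pi> \<in> noncrossing_on (T \<union> S) \<and> (\<exists>V\<in>\<pi>. T \<subseteq> V). \<Prod>V\<in>\<pi>. g V)"

lemma prod_image_blocks:
  fixes h :: "nat \<Rightarrow> nat"
  assumes "strict_mono_on S h" "\<pi> \<in> noncrossing_on S"
  shows "(\<Prod>V\<in>(`) h ` \<pi>. g V) = (\<Prod>V\<in>\<pi>. g (h ` V))"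
proof (rule prod.reindex_cong[of "(`) h"])
  have "inj_on h S" using assms(1) by (rule strict_mono_on_imp_inj_on)
  thus "inj_on ((`) h) \<pi>"
    using noncrossing_onD(1)[OF assms(2)] by (intro inj_on_image) simp
qed auto

lemma nc_total_image:
  assumes "strict_mono_on S h"
  shows "nc_total g (h ` S) = nc_total (\<lambda>V. g (h ` V)) S"
  unfolding nc_total_def sum_noncrossing_on_image[OF assms]
  by (intro sum.cong refl prod_image_blocks[OF assms])

lemma nc_joined_image:
  assumes h: "strict_mono_on (T \<union> S) h" and fin: "finite T" "finite S"
  shows "nc_joined g (h ` T) (h ` S) = nc_joined (\<lambda>V. g (h ` V)) T S"
proof -
  have inj: "inj_on h (T \<union> S)" using h by (rule strict_mono_on_imp_inj_on)
  have eq: "(\<exists>V\<in>(`) h ` \<pi>. h ` T \<subseteq> V) \<longleftrightarrow> (\<exists>V\<in>\<pi>. T \<subseteq> V)" if "\<pi> \<in> noncrossing_on (T \<union> S)" for \<pi>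
    using inj_on_image_subset_iff[OF inj] noncrossing_onD(4)[OF that] by auto
  have "nc_joined g (h ` T) (h ` S) =
    (\<Sum>\<pi>\<in>noncrossing_on (h ` (T \<union> S)). if \<exists>V\<in>\<pi>. h ` T \<subseteq> V then \<Prod>V\<in>\<pi>. g V else 0)"
    unfolding nc_joined_def image_Un[symmetric]
    using fin by (subst sum.inter_filter[symmetric]) (auto simp: finite_noncrossing_on)
  also have "\<dots> = (\<Sum>\<pi>\<in>noncrossing_on (T \<union> S). if \<exists>V\<in>\<pi>. T \<subseteq> V then \<Prod>V\<in>\<pi>. g (h ` V) else 0)"
    unfolding sum_noncrossing_on_image[OF h]
    by (intro sum.cong refl) (simp only: eq prod_image_blocks[OF h])
  also have "\<dots> = nc_joined (\<lambda>V. g (h ` V)) T S"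
    unfolding nc_joined_def
    using fin by (subst sum.inter_filter[symmetric]) (auto simp: finite_noncrossing_on)
  finally show ?thesis .
qed

lemma nc_total_cong:
  assumes "\<And>V. V \<subseteq> S \<Longrightarrow> V \<noteq> {} \<Longrightarrow> g V = g' V"
  shows "nc_total g S = nc_total g' S"
  unfolding nc_total_def
  by (intro sum.cong prod.cong refl assms) (auto dest: noncrossing_onD)

lemma nc_joined_cong:
  assumes "\<And>V. V \<subseteq> T \<union> S \<Longrightarrow> V \<noteq> {} \<Longrightarrow> g V = g' V"
  shows "nc_joined g T S = nc_joined g' T S"
  unfolding nc_joined_def
  by (intro sum.cong prod.cong refl assms) (auto dest: noncrossing_onD)

text \<open>
  Here \<open>m\<close> is the next element after \<open>T\<close> of the block containing \<open>T\<close>: noncrossing partitions cannot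
  connect the elements below \<open>m\<close> with those above it.
\<close>

lemma nc_joined_rec:
  assumes fin: "finite T" "finite S" and T: "T \<noteq> {}" and less: "\<And>t s. t \<in> T \<Longrightarrow> s \<in> S \<Longrightarrow> t < s"
  shows "nc_joined g T S = g T * nc_total g S +
    (\<Sum>m\<in>S. nc_total g {x\<in>S. x < m} * nc_joined g (insert m T) {x\<in>S. m < x})"
proof -
  let ?P = "\<lambda>\<pi>. \<Prod>V\<in>\<pi>. g V"
  define L R where "L m = {x\<in>S. x < m}" and "R m = {x\<in>S. m < x}" for m
  define A where "A = {\<pi> \<in> noncrossing_on (T \<union> S). T \<in> \<pi>}"
  define J where "J m = {\<pi> \<in> noncrossing_on (insert m T \<union> R m). \<exists>V\<in>\<pi>. insert m T \<subseteq> V}" for m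
  define B where "B m = (\<lambda>(\<rho>,\<sigma>). \<rho> \<union> \<sigma>) ` (noncrossing_on (L m) \<times> J m)" for m
  have TS: "T \<inter> S = {}" using less by fastforce
  have LR: "L m \<union> (insert m T \<union> R m) = T \<union> S" "L m \<inter> (insert m T \<union> R m) = {}" if "m \<in> S" for m
    using that TS by (auto simp: L_def R_def)
  have split: "{\<pi> \<in> noncrossing_on (T \<union> S). \<exists>V\<in>\<pi>. T \<subseteq> V} = A \<union> (\<Union>m\<in>S. B m)" (is "?X = ?Y")
  proof (intro equalityI subsetI)
    fix \<pi> assume "\<pi> \<in> ?X"
    then obtain V where \<pi>: "\<pi> \<in> noncrossing_on (T \<union> S)" and V: "V \<in> \<pi>" "T \<subseteq> V" by auto
    note D = noncrossing_onD[OF \<pi>]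
    show "\<pi> \<in> ?Y"
    proof (cases "V = T")
      case True thus ?thesis using \<pi> V by (auto simp: A_def)
    next
      case False
      have VS: "V \<subseteq> T \<union> S" using D(4)[OF V(1)] .
      define m where "m = Min (V - T)"
      have finV: "finite (V - T)" "V - T \<noteq> {}"
        using VS fin False V finite_subset by (auto intro: finite_subset[of _ S])
      have m: "m \<in> V" "m \<notin> T" and mle: "\<And>x. x \<in> V - T \<Longrightarrow> m \<le> x"
        using Min_in[OF finV] Min_le[OF finV(1)] by (auto simp: m_def)
      have mS: "m \<in> S" using m VS by auto
      obtain t where t: "t \<in> T" using T by auto
      define \<rho> where "\<rho> = {U\<in>\<pi>. U \<inter> L m \<noteq> {}}"
      \<comment> \<open>A block with a point \<open>x\<close> before \<open>m\<close> and a point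
        \<open>y\<close> after it would cross \<open>V\<close>, because \<open>t < x < m < y\<close>
        with \<open>t\<close> and \<open>m\<close> in \<open>V\<close>. So the elements between
        \<open>T\<close> and \<open>m\<close> are partitioned among themselves.\<close>
      have UL: "U \<subseteq> L m" if U: "U \<in> \<pi>" "x \<in> U" "x \<in> L m" for U x
      proof
        fix y assume y: "y \<in> U"
        have xS: "x \<in> S" "x < m" using that by (auto simp: L_def)
        have "x \<notin> V" using mle[of x] xS TS by auto
        hence ne: "U \<noteq> V" using U by auto
        hence dis: "U \<inter> V = {}" using D(3)[OF U(1) V(1)] by auto
        hence "y \<noteq> m" "y \<notin> T" using y m V by auto
        moreover have "\<not> m < y"
        proof
          assume "m < y"
          moreover have "t < x" using less t xS by auto
          ultimately have "V = U" using D(5)[OF V(1) U(1), of t x m y] V(2) t m xS U y by auto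
          thus False using ne by simp
        qed
        ultimately show "y \<in> L m" using y D(4)[OF U(1)] by (auto simp: L_def)
      qed
      have "\<rho> \<in> noncrossing_on (L m)"
      proof (rule noncrossing_onI)
        show "\<Union>\<rho> = L m"
        proof
          show "\<Union>\<rho> \<subseteq> L m" using UL by (force simp: \<rho>_def)
          show "L m \<subseteq> \<Union>\<rho>"
          proof
            fix x assume x: "x \<in> L m"
            hence "x \<in> \<Union>\<pi>" unfolding D(1) by (auto simp: L_def)
            thus "x \<in> \<Union>\<rho>" using x by (auto simp: \<rho>_def)
          qed
        qed
      qed (use D in \<open>auto simp: \<rho>_def\<close>)
      moreover have "\<pi> - \<rho> \<in> J m"
      proof -
        have Vr: "V \<in> \<pi> - \<rho>"
          using V mle by (force simp: \<rho>_def L_def TS dest: less)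
        have "\<pi> - \<rho> \<in> noncrossing_on (insert m T \<union> R m)"
        proof (rule noncrossing_onI)
          show "\<Union>(\<pi> - \<rho>) = insert m T \<union> R m"
          proof
            show "\<Union>(\<pi> - \<rho>) \<subseteq> insert m T \<union> R m"
              using D(4) by (fastforce simp: \<rho>_def L_def R_def)
            show "insert m T \<union> R m \<subseteq> \<Union>(\<pi> - \<rho>)"
            proof
              fix x assume x: "x \<in> insert m T \<union> R m"
              hence "x \<in> T \<union> S" using mS by (auto simp: R_def)
              then obtain U where U: "U \<in> \<pi>" "x \<in> U" using D(1) by blast
              have "x \<notin> L m" using x less mS by (fastforce simp: L_def R_def)
              hence "U \<notin> \<rho>" using U UL by (auto simp: \<rho>_def)
              thus "x \<in> \<Union>(\<pi> - \<rho>)" using U by auto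
            qed
          qed
        qed (use D in auto)
        moreover have "insert m T \<subseteq> V" using m V by auto
        ultimately show ?thesis using Vr by (auto simp: J_def)
      qed
      ultimately have "\<rho> \<union> (\<pi> - \<rho>) \<in> B m"
        unfolding B_def by (intro image_eqI[of _ _ "(\<rho>, \<pi> - \<rho>)"]) simp_all
      moreover have "\<rho> \<union> (\<pi> - \<rho>) = \<pi>" by (auto simp: \<rho>_def)
      ultimately show ?thesis using mS by auto
    qed
  next
    fix \<pi> assume "\<pi> \<in> ?Y"
    then consider "\<pi> \<in> A" | m where "m \<in> S" "\<pi> \<in> B m" by auto
    thus "\<pi> \<in> ?X"
    proof cases
      case 1 thus ?thesis by (auto simp: A_def)
    next
      case 2
      then obtain \<rho> \<sigma> where \<rho>: "\<rho> \<in> noncrossing_on (L m)" and \<sigma>: "\<sigma> \<in> noncrossing_on (insert m T \<union> R m)"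
        and V: "\<exists>V\<in>\<sigma>. insert m T \<subseteq> V" and \<pi>: "\<pi> = \<rho> \<union> \<sigma>" by (auto simp: B_def J_def)
      note D1 = noncrossing_onD[OF \<rho>] and D2 = noncrossing_onD[OF \<sigma>]
      \<comment> \<open>\<open>T\<close> lies below \<open>L m\<close>, and \<open>m\<close> and
        \<open>R m\<close> lie above it. So no point of a block of \<sigma> separates two points of
        \<open>L m\<close>, and the two partitions cannot cross each other.\<close>
      have order: "x \<notin> U" if "a < x" "x < b" "a \<in> L m" "b \<in> L m" "U \<in> \<sigma>" for x a b U
      proof
        assume "x \<in> U"
        hence "x \<in> insert m T \<union> R m" using D2(4)[OF that(5)] by auto
        thus False using that less by (fastforce simp: L_def R_def)
      qed
      have "\<pi> \<in> noncrossing_on (T \<union> S)"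
      proof (rule noncrossing_onI)
        show "\<Union>\<pi> = T \<union> S" using D1(1) D2(1) LR(1)[OF 2(1)] \<pi> by auto
        show "{} \<notin> \<pi>" using D1(2) D2(2) \<pi> by auto
        fix U V assume U: "U \<in> \<pi>" and V: "V \<in> \<pi>"
        { assume "U \<inter> V \<noteq> {}"
          thus "U = V" using U V D1(3,4) D2(3,4) LR(2)[OF 2(1)] unfolding \<pi> by blast }
        fix a b c d assume *: "a < b" "b < c" "c < d" "a \<in> U" "c \<in> U" "b \<in> V" "d \<in> V"
        consider "U \<in> \<rho>" "V \<in> \<rho>" | "U \<in> \<sigma>" "V \<in> \<sigma>" | "U \<in> \<rho>" "V \<in> \<sigma>" | "U \<in> \<sigma>" "V \<in> \<rho>"
          using U V \<pi> by auto
        thus "U = V"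
        proof cases
          case 1 thus ?thesis using D1(5)[OF 1] * by blast
        next
          case 2 thus ?thesis using D2(5)[OF 2] * by blast
        next
          case 3 thus ?thesis using order[of a b c V] * D1(4) by blast
        next
          case 4 thus ?thesis using order[of b c d U] * D1(4) by blast
        qed
      qed
      thus ?thesis using V \<pi> by auto
    qed
  qed
  have finA: "finite A" using fin by (auto simp: A_def finite_noncrossing_on)
  have finB: "finite (B m)" if "m \<in> S" for m
  proof -
    have "finite (L m)" "finite (insert m T \<union> R m)" using fin by (auto simp: L_def R_def)
    thus ?thesis by (auto simp: B_def J_def finite_noncrossing_on)
  qed
  \<comment> \<open>The partition determines \<open>m\<close> as the first element after
    \<open>T\<close> in the block of \<open>T\<close>. Hence the sets \<open>B m\<close> are
    disjoint from each other and from \<open>A\<close>.\<close>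
  have next_elt: "\<exists>V\<in>\<pi>. insert m T \<subseteq> V \<and> V \<inter> L m = {}"
    if "m \<in> S" "\<pi> \<in> B m" for m \<pi>
  proof -
    from that obtain \<rho> \<sigma> V where *: "\<sigma> \<in> noncrossing_on (insert m T \<union> R m)" "V \<in> \<sigma>"
        "insert m T \<subseteq> V" "\<pi> = \<rho> \<union> \<sigma>"
      by (auto simp: B_def J_def)
    have "V \<subseteq> insert m T \<union> R m" using noncrossing_onD(4)[OF *(1,2)] .
    thus ?thesis using * LR(2)[OF \<open>m \<in> S\<close>] by (intro bexI[of _ V]) blast+
  qed
  have B_nc: "\<pi> \<in> noncrossing_on (T \<union> S)" if "m \<in> S" "\<pi> \<in> B m" for m \<pi>
    using split that by auto
  have dAB: "A \<inter> (\<Union>m\<in>S. B m) = {}"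
  proof (rule ccontr)
    assume "A \<inter> (\<Union>m\<in>S. B m) \<noteq> {}"
    then obtain m \<pi> where m: "m \<in> S" "\<pi> \<in> B m" "\<pi> \<in> A" by auto
    obtain V where V: "V \<in> \<pi>" "insert m T \<subseteq> V" using next_elt[OF m(1,2)] by auto
    have "T \<in> \<pi>" using m by (auto simp: A_def)
    hence "T = V" using noncrossing_onD(3)[OF B_nc[OF m(1,2)], of T V] V T by auto
    thus False using V m TS by auto
  qed
  have dB: "B m \<inter> B m' = {}" if "m \<in> S" "m' \<in> S" "m < m'" for m m'
  proof (rule ccontr)
    note mm = that
    assume "B m \<inter> B m' \<noteq> {}"
    then obtain \<pi> where \<pi>: "\<pi> \<in> B m" "\<pi> \<in> B m'" by auto
    obtain V where V: "V \<in> \<pi>" "insert m T \<subseteq> V" using next_elt[OF mm(1) \<pi>(1)] by auto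
    obtain V' where V': "V' \<in> \<pi>" "insert m' T \<subseteq> V'" "V' \<inter> L m' = {}" using next_elt[OF mm(2) \<pi>(2)]
        by auto
    have "V = V'" using noncrossing_onD(3)[OF B_nc[OF mm(1) \<pi>(1)], of V V'] V V' T by auto
    thus False using V V' mm by (auto simp: L_def)
  qed
  have dB': "\<forall>i\<in>S. \<forall>j\<in>S. i \<noteq> j \<longrightarrow> B i \<inter> B j = {}"
    using dB by (metis inf_commute linorder_neqE_nat)
  have sumA: "sum ?P A = g T * nc_total g S"
  proof -
    have "sum ?P A = (\<Sum>\<pi>\<in>noncrossing_on S. g T * ?P \<pi>)"
    proof (rule sum.reindex_bij_witness[where i = "insert T" and j = "\<lambda>\<pi>. \<pi> - {T}"])
      fix \<pi> assume "\<pi> \<in> A"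
      hence \<pi>: "\<pi> \<in> noncrossing_on (T \<union> S)" "T \<in> \<pi>" by (auto simp: A_def)
      note D = noncrossing_onD[OF \<pi>(1)]
      show "insert T (\<pi> - {T}) = \<pi>" using \<pi> by auto
      show "\<pi> - {T} \<in> noncrossing_on S"
      proof (rule noncrossing_onI)
        show "\<Union> (\<pi> - {T}) = S"
        proof
          show "\<Union> (\<pi> - {T}) \<subseteq> S" using D(3)[OF _ \<pi>(2)] D(4) by fastforce
          show "S \<subseteq> \<Union> (\<pi> - {T})" using D(1) TS by blast
        qed
      qed (use D in auto)
      have "finite \<pi>" using D(1) fin by (metis finite_UnI finite_UnionD)
      thus "g T * ?P (\<pi> - {T}) = ?P \<pi>" using \<pi> by (simp add: prod.remove)
    next
      fix \<pi> assume \<pi>: "\<pi> \<in> noncrossing_on S"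
      note D = noncrossing_onD[OF \<pi>]
      have TU: "T \<inter> U = {}" if "U \<in> \<pi>" for U using D(4)[OF that] TS by auto
      show "insert T \<pi> - {T} = \<pi>" using TU T by auto
      have "insert T \<pi> \<in> noncrossing_on (T \<union> S)"
      proof (rule noncrossing_onI)
        show "\<Union> (insert T \<pi>) = T \<union> S" using D by auto
        show "{} \<notin> insert T \<pi>" using D T by auto
        fix U V assume U: "U \<in> insert T \<pi>" and V: "V \<in> insert T \<pi>"
        { assume "U \<inter> V \<noteq> {}"
          thus "U = V" using U V TU D(3)[of U V] by auto }
        fix a b c d assume *: "a < b" "b < c" "c < d" "a \<in> U" "c \<in> U" "b \<in> V" "d \<in> V"
        \<comment> \<open>\<open>T\<close> is an initial segment of \<open>T \<union> S\<close>, so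
          a crossing with the block \<open>T\<close> would put a point of the other block into
          \<open>T\<close>, against disjointness.\<close>
        have TL: "y \<in> T" if "y < x" "x \<in> T" "y \<in> T \<union> S" for x y using that less by fastforce
        have "U \<subseteq> T \<union> S" "V \<subseteq> T \<union> S" using U V D(4) by auto
        show "U = V"
        proof (cases "U = T \<or> V = T")
          case True
          hence "b \<in> T" "c \<in> T" if "U \<noteq> V"
            using * TL[of b c] TL[of c d] \<open>U \<subseteq> T \<union> S\<close> \<open>V \<subseteq> T \<union> S\<close> TL[of a b] by blast+
          thus ?thesis using True * TU U V by blast
        next
          case False
          thus ?thesis using D(5)[of U V a b c d] U V * by blast
        qed
      qed
      thus "insert T \<pi> \<in> A" by (auto simp: A_def)
    qed
    thus ?thesis by (simp add: nc_total_def sum_distrib_left)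
  qed
  have sumB: "sum ?P (B m) = nc_total g (L m) * nc_joined g (insert m T) (R m)" if m: "m \<in> S" for m
  proof -
    have disj: "U \<noteq> V" if "\<rho> \<in> noncrossing_on (L m)" "\<sigma> \<in> J m" "U \<in> \<rho>" "V \<in> \<sigma>" for \<rho> \<sigma> U V
    proof -
      have "U \<subseteq> L m" "U \<noteq> {}" using noncrossing_onD(2,4)[OF that(1)] that(3) by auto
      moreover have "V \<subseteq> insert m T \<union> R m" using that(2,4) noncrossing_onD(4) unfolding J_def by blast
      ultimately show ?thesis using LR(2)[OF m] by blast
    qed
    have inj: "inj_on (\<lambda>(\<rho>,\<sigma>). \<rho> \<union> \<sigma>) (noncrossing_on (L m) \<times> J m)"
    proof (rule inj_on_inverseI[where g = "\<lambda>\<pi>. ({U\<in>\<pi>. U \<subseteq> L m}, {U\<in>\<pi>. \<not> U \<subseteq> L m})"])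
      fix x assume x: "x \<in> noncrossing_on (L m) \<times> J m"
      obtain \<rho> \<sigma> where \<rho>\<sigma>: "x = (\<rho>, \<sigma>)" by (cases x)
      have *: "\<rho> \<in> noncrossing_on (L m)" "\<sigma> \<in> noncrossing_on (insert m T \<union> R m)"
        using x by (auto simp: \<rho>\<sigma> J_def)
      have "U \<subseteq> L m" if "U \<in> \<rho>" for U using noncrossing_onD(4)[OF *(1) that] .
      moreover have "\<not> U \<subseteq> L m" if "U \<in> \<sigma>" for U
      proof -
        have "U \<noteq> {}" using noncrossing_onD(2)[OF *(2)] that by auto
        thus ?thesis using LR(2)[OF m] noncrossing_onD(4)[OF *(2) that] by blast
      qed
      ultimately have "{U \<in> \<rho> \<union> \<sigma>. U \<subseteq> L m} = \<rho>" "{U \<in> \<rho> \<union> \<sigma>. \<not> U \<subseteq> L m} = \<sigma>" by auto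
      thus "(\<lambda>\<pi>. ({U\<in>\<pi>. U \<subseteq> L m}, {U\<in>\<pi>. \<not> U \<subseteq> L m})) (case x of (\<rho>, \<sigma>) \<Rightarrow> \<rho> \<union> \<sigma>) = x"
        by (simp add: \<rho>\<sigma>)
    qed
    have finb: "finite \<pi>" if "\<pi> \<in> noncrossing_on Z" "finite Z" for \<pi> Z
      using noncrossing_onD(1)[OF that(1)] that(2) by (metis finite_UnionD)
    have "sum ?P (B m) = (\<Sum>(\<rho>,\<sigma>)\<in>noncrossing_on (L m) \<times> J m. ?P (\<rho> \<union> \<sigma>))"
      unfolding B_def by (subst sum.reindex[OF inj]) (simp add: case_prod_beta)
    also have "\<dots> = (\<Sum>(\<rho>,\<sigma>)\<in>noncrossing_on (L m) \<times> J m. ?P \<rho> * ?P \<sigma>)"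
    proof (intro sum.cong refl, clarify)
      fix \<rho> \<sigma> assume *: "\<rho> \<in> noncrossing_on (L m)" "\<sigma> \<in> J m"
      have "finite \<rho>" using finb[OF *(1)] fin by (simp add: L_def)
      moreover have "finite \<sigma>" using finb[of \<sigma> "insert m T \<union> R m"] *(2) fin by (simp add: J_def R_def)
      ultimately show "?P (\<rho> \<union> \<sigma>) = ?P \<rho> * ?P \<sigma>"
        using disj[OF *] by (intro prod.union_disjoint) auto
    qed
    also have "\<dots> = nc_total g (L m) * nc_joined g (insert m T) (R m)"
      by (simp add: nc_total_def nc_joined_def sum_product sum.cartesian_product J_def)
    finally show ?thesis .
  qed
  have "nc_joined g T S = sum ?P (A \<union> (\<Union>m\<in>S. B m))"
    unfolding nc_joined_def using split by simp
  also have "\<dots> = sum ?P A + (\<Sum>m\<in>S. sum ?P (B m))"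
    using fin finA finB dAB dB' by (simp add: sum.union_disjoint sum.UNION_disjoint)
  also have "\<dots> = g T * nc_total g S + (\<Sum>m\<in>S. nc_total g (L m) * nc_joined g (insert m T) (R m))"
    using sumA sumB by simp
  finally show ?thesis unfolding L_def R_def .
qed


section \<open>Noncrossing sums over words instead of index sets\<close>

lemma nths_eq_map_nth:
  assumes "V \<subseteq> {..<length xs}"
  shows "nths xs V = map ((!) xs) (sorted_list_of_set V)"
proof -
  have "nths xs V = map ((!) xs) (filter (\<lambda>i. i \<in> V) [0..<length xs])"
  proof -
    have "zip xs [0..<length xs] = map (\<lambda>i. (xs ! i, i)) [0..<length xs]"
      by (rule nth_equalityI) auto
    thus ?thesis by (simp add: nths_def filter_map comp_def)
  qed
  also have "filter (\<lambda>i. i \<in> V) [0..<length xs] = sorted_list_of_set V"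
  proof -
    have "V = set (filter (\<lambda>i. i \<in> V) [0..<length xs])" using assms by auto
    hence "sorted_list_of_set V = sort (remdups (filter (\<lambda>i. i \<in> V) [0..<length xs]))"
      by (metis sorted_list_of_set_sort_remdups)
    also have "\<dots> = filter (\<lambda>i. i \<in> V) [0..<length xs]"
      by (simp add: distinct_remdups_id sorted_sort_id sorted_wrt_filter)
    finally show ?thesis ..
  qed
  finally show ?thesis .
qed

lemma sorted_list_of_set_strict_mono_image:
  fixes h :: "nat \<Rightarrow> nat"
  assumes h: "strict_mono_on S h" and V: "V \<subseteq> S" "finite V"
  shows "sorted_list_of_set (h ` V) = map h (sorted_list_of_set V)"
proof -
  have "sorted_wrt (<) (map h (sorted_list_of_set V))"
    unfolding sorted_wrt_map
    using strict_sorted_list_of_set[of V] h V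
    by (elim sorted_wrt_mono_rel[rotated]) (auto simp: strict_mono_on_def)
  thus ?thesis
    using V by (subst sorted_list_of_set_unique[symmetric])
      (auto simp: finite_subset card_image strict_mono_on_imp_inj_on[OF h, THEN inj_on_subset])
qed

definition noncrossing_sum :: "('x list \<Rightarrow> complex) \<Rightarrow> 'x list \<Rightarrow> complex" where
  "noncrossing_sum f xs = (\<Sum>\<pi> | noncrossing_partition (length xs) \<pi>. \<Prod>V\<in>\<pi>. f (nths xs V))"

text \<open>The letters of \<open>ys\<close> are the initial part of the block of the first letter.\<close>

definition noncrossing_sum_from :: "('x list \<Rightarrow> complex) \<Rightarrow> 'x list \<Rightarrow> 'x list \<Rightarrow> complex" where
  "noncrossing_sum_from f ys xs =
     (\<Sum>\<pi> | noncrossing_partition (length (ys @ xs)) \<pi> \<and> (\<exists>V\<in>\<pi>. {..<length ys} \<subseteq> V).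
        \<Prod>V\<in>\<pi>. f (nths (ys @ xs) V))"

lemma noncrossing_sum_conv: "noncrossing_sum f xs = nc_total (\<lambda>V. f (nths xs V)) {..<length xs}"
  by (simp add: noncrossing_sum_def nc_total_def noncrossing_on_lessThan)

lemma noncrossing_sum_from_conv:
  "noncrossing_sum_from f ys xs =
     nc_joined (\<lambda>V. f (nths (ys @ xs) V)) {..<length ys} {length ys..<length ys + length xs}"
proof -
  have "{..<length ys} \<union> {length ys..<length ys + length xs} = {..<length (ys @ xs)}" by auto
  thus ?thesis
    by (simp add: noncrossing_sum_from_def nc_joined_def noncrossing_on_lessThan del: length_append)
qed

lemma noncrossing_sum_Nil [simp]: "noncrossing_sum f [] = 1"
  by (simp add: noncrossing_sum_conv nc_total_def noncrossing_on_empty)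

lemma noncrossing_sum_Cons: "noncrossing_sum f (x # xs) = noncrossing_sum_from f [x] xs"
proof -
  have "\<exists>V\<in>\<pi>. {..<Suc 0} \<subseteq> V" if "noncrossing_partition (Suc (length xs)) \<pi>" for \<pi>
    using that by (auto simp: noncrossing_partition_def partition_on_def)
  thus ?thesis
    unfolding noncrossing_sum_def noncrossing_sum_from_def by (intro sum.cong) auto
qed

lemma nths_image_append:
  assumes h: "strict_mono_on S h" and V: "V \<subseteq> S" "S \<subseteq> {..<length xs}" "h ` S \<subseteq> {..<length zs}"
    and nth: "\<And>i. i \<in> S \<Longrightarrow> zs ! h i = xs ! i"
  shows "nths zs (h ` V) = nths xs V"
proof -
  have "finite V" using V finite_subset by (metis finite_lessThan)
  have "nths zs (h ` V) = map ((!) zs) (map h (sorted_list_of_set V))"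
    using V \<open>finite V\<close> by (subst nths_eq_map_nth)
        (auto simp: sorted_list_of_set_strict_mono_image[OF h])
  also have "\<dots> = map ((!) xs) (sorted_list_of_set V)"
    using nth V \<open>finite V\<close> by auto
  also have "\<dots> = nths xs V" using V by (subst nths_eq_map_nth) auto
  finally show ?thesis .
qed

text \<open>The block beginning with \<open>ys\<close> either ends there or takes
  \<open>xs ! m\<close> as its next letter; the letters skipped in between then form a word of their
  own. Together with \<open>noncrossing_sum_Cons\<close> this determines both sums, and it is the
  only way in which noncrossing partitions are used from here on to evaluate them.\<close>

lemma noncrossing_sum_from_rec:
  assumes "ys \<noteq> []"
  shows "noncrossing_sum_from f ys xs = f ys * noncrossing_sum f xs +
    (\<Sum>m<length xs. noncrossing_sum f (take m xs) * noncrossing_sum_from f (ys @ [xs ! m])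
        (drop (Suc m) xs))"
proof -
  let ?k = "length ys" and ?n = "length xs" and ?g = "\<lambda>V. f (nths (ys @ xs) V)"
  have shift: "nc_total ?g {?k..<?k + m} = noncrossing_sum f (take m xs)" if "m \<le> ?n" for m
  proof -
    have eq: "{?k..<?k + m} = (\<lambda>i. i + ?k) ` {..<m}"
      unfolding lessThan_atLeast0 by (simp add: image_add_atLeastLessThan' add.commute)
    have mono: "strict_mono_on {..<m} (\<lambda>i. i + ?k)" by (auto simp: strict_mono_on_def)
    have "nc_total ?g {?k..<?k + m} = nc_total (\<lambda>V. ?g ((\<lambda>i. i + ?k) ` V)) {..<m}"
      unfolding eq by (rule nc_total_image[OF mono])
    also have "\<dots> = nc_total (\<lambda>V. f (nths (take m xs) V)) {..<m}"
      using that by (intro nc_total_cong arg_cong[of _ _ f] nths_image_append[OF mono])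
          (auto simp: nth_append)
    finally show ?thesis using that by (simp add: noncrossing_sum_conv min_def)
  qed
  have joined: "nc_joined ?g (insert (?k + m) {..<?k}) {?k + m<..<?k + ?n} =
      noncrossing_sum_from f (ys @ [xs ! m]) (drop (Suc m) xs)" if m: "m < ?n" for m
  proof -
    \<comment> \<open>The map jumps over the \<open>m\<close> skipped letters: the positions of
      \<open>ys\<close> stay, and the new last position of the block, \<open>?k\<close>, goes to
      \<open>?k + m\<close>.\<close>
    let ?h = "\<lambda>i. if i < ?k then i else i + m" and ?zs = "ys @ [xs ! m] @ drop (Suc m) xs"
    let ?S = "{..<?k + 1} \<union> {?k + 1..<?k + (?n - m)}"
    have mono: "strict_mono_on ?S ?h" by (auto simp: strict_mono_on_def)
    have e1: "insert (?k + m) {..<?k} = ?h ` {..<?k + 1}" by (auto simp: image_iff)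
    have e2: "{?k + m<..<?k + ?n} = ?h ` {?k + 1..<?k + (?n - m)}"
    proof (intro equalityI subsetI)
      fix x assume "x \<in> {?k + m<..<?k + ?n}"
      thus "x \<in> ?h ` {?k + 1..<?k + (?n - m)}" using m by (intro image_eqI[of _ _ "x - m"]) auto
    qed (use m in auto)
    have "nc_joined ?g (insert (?k + m) {..<?k}) {?k + m<..<?k + ?n} =
       nc_joined (\<lambda>V. ?g (?h ` V)) {..<?k + 1} {?k + 1..<?k + (?n - m)}"
      unfolding e1 e2 by (rule nc_joined_image[OF mono]) auto
    also have "\<dots> = nc_joined (\<lambda>V. f (nths ?zs V)) {..<?k + 1} {?k + 1..<?k + (?n - m)}"
    proof (intro nc_joined_cong arg_cong[of _ _ f] nths_image_append[OF mono])
      fix i assume i: "i \<in> ?S"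
      consider "i < ?k" | "i = ?k" | j where "i = ?k + Suc j" "Suc m + j < ?n"
        using i m by (cases "i < ?k"; cases "i = ?k")
            (auto dest!: less_imp_Suc_add simp: linorder_neq_iff)
      thus "(ys @ xs) ! ?h i = ?zs ! i"
        using m by cases (auto simp: nth_append add.commute)
    qed (use m in auto)
    also have "\<dots> = noncrossing_sum_from f (ys @ [xs ! m]) (drop (Suc m) xs)"
      unfolding noncrossing_sum_from_conv using m by (simp add: Suc_diff_Suc)
    finally show ?thesis .
  qed
  have "noncrossing_sum_from f ys xs = ?g {..<?k} * nc_total ?g {?k..<?k + ?n} +
     (\<Sum>m\<in>{?k..<?k + ?n}. nc_total ?g {x\<in>{?k..<?k + ?n}. x < m} *
        nc_joined ?g (insert m {..<?k}) {x\<in>{?k..<?k + ?n}. m < x})"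
    unfolding noncrossing_sum_from_conv using assms by (intro nc_joined_rec) auto
  also have "?g {..<?k} = f ys" by (simp add: nths_append nths_upt_eq_take)
  also have "nc_total ?g {?k..<?k + ?n} = noncrossing_sum f xs" using shift[of ?n] by simp
  also have "(\<Sum>m\<in>{?k..<?k + ?n}. nc_total ?g {x\<in>{?k..<?k + ?n}. x < m} *
        nc_joined ?g (insert m {..<?k}) {x\<in>{?k..<?k + ?n}. m < x}) =
     (\<Sum>m<?n. noncrossing_sum f (take m xs) * noncrossing_sum_from f (ys @ [xs ! m]) (drop (Suc m) xs))"
  proof (rule sum.reindex_bij_witness[where i = "\<lambda>m. ?k + m" and j = "\<lambda>m. m - ?k"])
    fix m assume m: "m \<in> {?k..<?k + ?n}"
    have "{x\<in>{?k..<?k + ?n}. x < m} = {?k..<?k + (m - ?k)}"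
      "{x\<in>{?k..<?k + ?n}. m < x} = {?k + (m - ?k)<..<?k + ?n}" using m by auto
    moreover have "m - ?k < ?n" "?k + (m - ?k) = m" using m by auto
    ultimately show "noncrossing_sum f (take (m - ?k) xs) * noncrossing_sum_from f
        (ys @ [xs ! (m - ?k)]) (drop (Suc (m - ?k)) xs) =
      nc_total ?g {x\<in>{?k..<?k + ?n}. x < m} * nc_joined ?g (insert m {..<?k}) {x\<in>{?k..<?k + ?n}. m < x}"
      using shift[of "m - ?k"] joined[of "m - ?k"] by simp
  qed auto
  finally show ?thesis .
qed

text \<open>In every summand the block of the first letter spells a word that begins with
  \<open>ys\<close>.\<close>

lemma noncrossing_sum_from_prefix_zero:
  assumes "ys \<noteq> []" "\<And>zs. \<kappa> (ys @ zs) = 0"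
  shows "noncrossing_sum_from \<kappa> ys xs = 0"
  using assms
proof (induction xs arbitrary: ys rule: length_induct)
  case (1 xs)
  have "noncrossing_sum_from \<kappa> (ys @ [xs ! m]) (drop (Suc m) xs) = 0" if "m < length xs" for m
    using 1(1) 1(3) that by auto
  thus ?case using noncrossing_sum_from_rec[OF 1(2), of \<kappa> xs] 1(3)[of "[]"] by simp
qed

lemma noncrossing_sum_cong:
  assumes "\<And>zs. set zs \<subseteq> set xs \<Longrightarrow> zs \<noteq> [] \<Longrightarrow> f zs = g zs"
  shows "noncrossing_sum f xs = noncrossing_sum g xs"
proof -
  have "nths xs V \<noteq> []" if "V \<noteq> {}" "V \<subseteq> {..<length xs}" for V
    using that by (subst nths_eq_map_nth) (auto simp: finite_subset)
  thus ?thesis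
    unfolding noncrossing_sum_conv using set_nths_subset[of xs]
    by (intro nc_total_cong assms) auto
qed

text \<open>Inversion of the moment-cumulant formula. Only the one-block partition involves the full
  word, so the formula determines the cumulants recursively. Words over \<open>L\<close> suffice
  because blocks use no new letters.\<close>

lemma free_cumulant_eqI:
  assumes M: "\<And>xs. set xs \<subseteq> L \<Longrightarrow> xs \<noteq> [] \<Longrightarrow> M xs = noncrossing_sum f xs"
    and "set xs \<subseteq> L" "xs \<noteq> []"
  shows "free_cumulant M xs = f xs"
  using assms(2,3)
proof (induction xs rule: length_induct)
  case (1 xs)
  let ?n = "length xs"
  let ?N = "{\<pi>. noncrossing_partition ?n \<pi>}" and ?P = "\<lambda>\<pi>. \<Prod>V\<in>\<pi>. f (nths xs V)"
  have "{{..<?n}} \<in> ?N"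
    using 1(3) by (auto simp: noncrossing_partition_def intro!: partition_on_space)
  hence "sum ?P ?N = ?P {{..<?n}} + sum ?P (?N - {{{..<?n}}})"
    by (rule sum.remove[OF finite_noncrossing_partitions])
  moreover have "?P {{..<?n}} = f xs" by (simp add: nths_upt_eq_take)
  moreover have "?N - {{{..<?n}}} = {\<pi>. noncrossing_partition ?n \<pi> \<and> \<pi> \<noteq> {{..<?n}}}" by auto
  moreover have "M xs = sum ?P ?N" using M[OF 1(2,3)] by (simp add: noncrossing_sum_def)
  moreover have "(\<Sum>\<pi> | noncrossing_partition ?n \<pi> \<and> \<pi> \<noteq> {{..<?n}}. \<Prod>V\<in>\<pi>. free_cumulant M (nths xs V))
     = sum ?P {\<pi>. noncrossing_partition ?n \<pi> \<and> \<pi> \<noteq> {{..<?n}}}"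
  proof (intro sum.cong prod.cong refl, clarify)
    fix \<pi> V assume \<pi>: "noncrossing_partition ?n \<pi>" "\<pi> \<noteq> {{..<?n}}" "V \<in> \<pi>"
    have "V \<noteq> {}" "V \<subseteq> {..<?n}" using \<pi>(1,3) by (auto simp: noncrossing_partition_def partition_on_def)
    hence "nths xs V \<noteq> []" by (subst nths_eq_map_nth) (auto simp: finite_subset)
    moreover have "set (nths xs V) \<subseteq> L" using set_nths_subset[of xs V] 1(2) by auto
    ultimately show "free_cumulant M (nths xs V) = f (nths xs V)"
      using 1(1) nths_proper_block_less[OF \<pi>] by blast
  qed
  ultimately show ?case using free_cumulant.simps[of M xs] by simp
qed

lemma moment_eq_noncrossing_sum:
  assumes "M [] = 1"
  shows "M xs = noncrossing_sum (free_cumulant M) xs"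
  using assms moment_cumulant[of xs M] by (cases "xs = []") (auto simp: noncrossing_sum_def[of _ xs])

subsection \<open>The moments of the Marchenko--Pastur law\<close>

text \<open>
  With \<open>D = 1 + q\<^sup>2 - 2 q cos \<theta>\<close>, \<open>sin\<^sup>2 \<theta>\<close> is a quadratic polynomial in \<open>D\<close>, so the integrand is a
  combination of \<open>D\<close>, \<open>1\<close> and the Poisson kernel \<open>(1 - q\<^sup>2) / D\<close>, which gives the arctangent below.
\<close>

lemma has_integral_poisson_type:
  fixes q :: real
  assumes q: "\<bar>q\<bar> < 1 \<or> q = 1"
  shows "((\<lambda>\<theta>. (sin \<theta>)\<^sup>2 / (1 + q\<^sup>2 - 2 * q * cos \<theta>)) has_integral pi / 2) {0..pi}"
proof -
  have sq: "((\<lambda>\<theta>::real. (1 + cos \<theta>) / 2) has_integral pi / 2) {0..pi}"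
    using fundamental_theorem_of_calculus[of 0 pi "\<lambda>\<theta>. (\<theta> + sin \<theta>) / 2" "\<lambda>\<theta>. (1 + cos \<theta>) / 2"]
    by (force intro!: derivative_eq_intros
        simp: has_real_derivative_iff_has_vector_derivative[symmetric])
  consider "q = 1" | "q = 0" | "q \<noteq> 0" "\<bar>q\<bar> < 1" using q by auto
  thus ?thesis
  proof cases
    case 1
    \<comment> \<open>At \<theta> = 0 the denominator vanishes, so the cancellation is valid only
      away from this point.\<close>
    show ?thesis
    proof (rule has_integral_spike_finite[OF _ _ sq, of "{0}"])
      fix \<theta> :: real assume \<theta>: "\<theta> \<in> {0..pi} - {0}"
      have "cos \<theta> < 1" using cos_monotone_0_pi[of 0 \<theta>] \<theta> by auto
      moreover have "(sin \<theta>)\<^sup>2 = (1 - cos \<theta>) * (1 + cos \<theta>)"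
        by (simp add: sin_squared_eq algebra_simps power2_eq_square)
      ultimately show "(sin \<theta>)\<^sup>2 / (1 + q\<^sup>2 - 2 * q * cos \<theta>) = (1 + cos \<theta>) / 2"
        using 1 by (simp add: divide_simps algebra_simps)
    qed simp
  next
    case 2
    have "((\<lambda>\<theta>::real. (sin \<theta>)\<^sup>2) has_integral
        ((pi - sin pi * cos pi) / 2 - (0 - sin 0 * cos 0) / 2)) {0..pi}"
    proof (rule fundamental_theorem_of_calculus)
      fix x :: real
      have "((\<lambda>\<theta>::real. (\<theta> - sin \<theta> * cos \<theta>) / 2) has_real_derivative
          (1 - (cos x * cos x - sin x * sin x)) / 2) (at x within {0..pi})"
        by (auto intro!: derivative_eq_intros)
      moreover have "(1 - (cos x * cos x - sin x * sin x)) / 2 = (sin x)\<^sup>2"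
        using sin_cos_squared_add[of x] by (simp add: power2_eq_square)
      ultimately show "((\<lambda>\<theta>::real. (\<theta> - sin \<theta> * cos \<theta>) / 2) has_vector_derivative (sin x)\<^sup>2)
          (at x within {0..pi})"
        by (simp add: has_real_derivative_iff_has_vector_derivative)
    qed simp
    thus ?thesis using 2 by simp
  next
    case 3
    define F where "F \<theta> = - (1 - q\<^sup>2) / (4 * q\<^sup>2) * (\<theta> + 2 * arctan (q * sin \<theta> / (1 - q * cos \<theta>)))
      + (1 + q\<^sup>2) * \<theta> / (2 * q\<^sup>2) - ((1 + q\<^sup>2) * \<theta> - 2 * q * sin \<theta>) / (4 * q\<^sup>2)" for \<theta>
    have "((\<lambda>\<theta>. (sin \<theta>)\<^sup>2 / (1 + q\<^sup>2 - 2 * q * cos \<theta>)) has_integral (F pi - F 0)) {0..pi}"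
    proof (rule fundamental_theorem_of_calculus)
      fix x :: real
      define s where "s = sin x" define k where "k = cos x"
      have sk: "s\<^sup>2 = 1 - k\<^sup>2" by (simp add: s_def k_def sin_squared_eq)
      have "\<bar>q * k\<bar> < 1"
        using 3 mult_left_le[OF abs_cos_le_one[of x] abs_ge_zero[of q]]
        unfolding k_def abs_mult by linarith
      hence pos: "1 - q * k > 0" by linarith
      have D: "1 + q\<^sup>2 - 2 * q * k = (1 - q * k)\<^sup>2 + (q * s)\<^sup>2"
        unfolding power_mult_distrib sk by (simp add: algebra_simps power2_eq_square)
      have Dpos: "1 + q\<^sup>2 - 2 * q * k > 0" unfolding D using pos by (simp add: add_pos_nonneg)
      define a where "a = (q * k * (1 - q * k) - q * s * (q * s)) / (1 - q * k)\<^sup>2 /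
          (1 + (q * s / (1 - q * k))\<^sup>2)"
      have a: "a = (q * k - q\<^sup>2) / (1 + q\<^sup>2 - 2 * q * k)"
      proof -
        have "1 + (q * s / (1 - q * k))\<^sup>2 = (1 + q\<^sup>2 - 2 * q * k) / (1 - q * k)\<^sup>2"
          unfolding D using pos by (simp add: field_simps)
        moreover have "q * k * (1 - q * k) - q * s * (q * s) = q * k - q\<^sup>2"
        proof -
          have "q * s * (q * s) = q\<^sup>2 * (1 - k\<^sup>2)" using sk by
              (metis power2_eq_square power_mult_distrib)
          thus ?thesis by (simp add: algebra_simps power2_eq_square)
        qed
        ultimately show ?thesis unfolding a_def using pos by simp
      qed
      have "(F has_real_derivative (- (1 - q\<^sup>2) / (4 * q\<^sup>2) * (1 + 2 * a) + (1 + q\<^sup>2) /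
          (2 * q\<^sup>2) - ((1 + q\<^sup>2) - 2 * q * k) / (4 * q\<^sup>2))) (at x within {0..pi})"
      proof -
        have "((\<lambda>\<theta>. q * sin \<theta> / (1 - q * cos \<theta>)) has_real_derivative
            (q * k * (1 - q * k) - q * s * (q * s)) / (1 - q * k)\<^sup>2) (at x)"
          using pos by (auto intro!: derivative_eq_intros simp: k_def s_def power2_eq_square)
        from DERIV_chain2[OF DERIV_arctan this]
        have arc: "((\<lambda>\<theta>. arctan (q * sin \<theta> / (1 - q * cos \<theta>))) has_real_derivative a) (at x)"
          by (simp add: a_def s_def k_def divide_inverse mult.commute)
        have "(F has_real_derivative (- (1 - q\<^sup>2) / (4 * q\<^sup>2) * (1 + 2 * a) + (1 + q\<^sup>2) * 1 / (2 * q\<^sup>2)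
            - ((1 + q\<^sup>2) * 1 - 2 * q * k) / (4 * q\<^sup>2))) (at x)"
          unfolding F_def k_def
          by (intro DERIV_diff DERIV_add DERIV_cmult DERIV_cdivide DERIV_ident DERIV_sin arc)
        thus ?thesis by (simp add: has_field_derivative_at_within)
      qed
      moreover have "- (1 - q\<^sup>2) / (4 * q\<^sup>2) * (1 + 2 * a) + (1 + q\<^sup>2) / (2 * q\<^sup>2) -
          ((1 + q\<^sup>2) - 2 * q * k) / (4 * q\<^sup>2) = s\<^sup>2 / (1 + q\<^sup>2 - 2 * q * k)"
      proof -
        \<comment> \<open>Eliminating \<open>k\<close> in favour of the denominator \<open>E\<close>
          turns the numerator into a quadratic polynomial in \<open>E\<close>; the three terms of
          the derivative are its parts in \<open>1 / E\<close>, \<open>1\<close> and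
          \<open>E\<close>.\<close>
        define E where "E = 1 + q\<^sup>2 - 2 * q * k"
        have E0: "E \<noteq> 0" using Dpos by (simp add: E_def)
        have k: "k = (1 + q\<^sup>2 - E) / (2 * q)" using 3 by (simp add: E_def)
        have a1: "1 + 2 * a = (1 - q\<^sup>2) / E"
          unfolding a E_def[symmetric] using E0 by (simp add: field_simps E_def) 
        have "s\<^sup>2 = 1 - (1 + q\<^sup>2 - E)\<^sup>2 / (4 * q\<^sup>2)" unfolding sk k by
            (simp add: power_divide power_mult_distrib)
        hence s: "4 * q\<^sup>2 * s\<^sup>2 = 4 * q\<^sup>2 - (1 + q\<^sup>2 - E)\<^sup>2" using 3 by (simp add: field_simps)
        define T where "T = - (1 - q\<^sup>2) / (4 * q\<^sup>2) * ((1 - q\<^sup>2) / E) + (1 + q\<^sup>2) /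
            (2 * q\<^sup>2) - E / (4 * q\<^sup>2)"
        have "4 * q\<^sup>2 * E * (- (1 - q\<^sup>2) / (4 * q\<^sup>2) * ((1 - q\<^sup>2) / E) + (1 + q\<^sup>2) /
            (2 * q\<^sup>2) - E / (4 * q\<^sup>2))
           = - (1 - q\<^sup>2)\<^sup>2 + 2 * (1 + q\<^sup>2) * E - E\<^sup>2"
          using E0 3 by (simp add: field_simps power2_eq_square)
        also have "\<dots> = 4 * q\<^sup>2 * s\<^sup>2" unfolding s by (simp add: algebra_simps power2_eq_square)
        finally have "4 * q\<^sup>2 * (E * T) = 4 * q\<^sup>2 * s\<^sup>2" unfolding T_def[symmetric] by
            (simp only: mult.assoc)
        hence "E * T = s\<^sup>2" using 3 by simp
        hence "T = s\<^sup>2 / E" using E0 by (simp add: nonzero_eq_divide_eq mult.commute)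
        thus ?thesis unfolding a1 unfolding E_def[symmetric] T_def .
      qed
      ultimately show "(F has_vector_derivative (sin x)\<^sup>2 / (1 + q\<^sup>2 - 2 * q * cos x))
          (at x within {0..pi})"
        by (simp add: has_real_derivative_iff_has_vector_derivative s_def k_def)
    qed simp
    moreover have "F pi - F 0 = pi / 2"
      using 3 by (simp add: F_def field_simps)
    ultimately show ?thesis by simp
  qed
qed

text \<open>
  The moment of order \<open>n + 1\<close>, after the substitution \<open>t = 1 + c - 2 \<surd>c cos \<theta>\<close>.
\<close>

definition mp_shift_moment :: "real \<Rightarrow> nat \<Rightarrow> real" where
  "mp_shift_moment c n = integral {0..pi}
      (\<lambda>\<theta>. 2 * c / pi * (sin \<theta>)\<^sup>2 * (1 + c - 2 * sqrt c * cos \<theta>) ^ n)"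

lemma mp_shift_moment_has_integral:
  "((\<lambda>\<theta>. 2 * c / pi * (sin \<theta>)\<^sup>2 * (1 + c - 2 * sqrt c *
      cos \<theta>) ^ n) has_integral mp_shift_moment c n) {0..pi}"
  unfolding mp_shift_moment_def
  by (intro integrable_integral integrable_continuous_interval continuous_intros)

lemma mp_base_bounds:
  assumes "0 < c"
  shows "0 \<le> 1 + c - 2 * sqrt c * cos \<theta>" "1 + c - 2 * sqrt c * cos \<theta> \<le> (1 + sqrt c)\<^sup>2"
proof -
  have c: "(sqrt c)\<^sup>2 = c" "0 \<le> sqrt c" using assms by auto
  have *: "sqrt c * cos \<theta> \<le> sqrt c" "- sqrt c \<le> sqrt c * cos \<theta>"
    using c mult_left_mono[of "cos \<theta>" 1 "sqrt c"] mult_left_mono[of "-1" "cos \<theta>" "sqrt c"] by auto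
  have "0 \<le> (1 - sqrt c)\<^sup>2" by simp
  thus "0 \<le> 1 + c - 2 * sqrt c * cos \<theta>" using * c by (simp add: power2_diff)
  show "1 + c - 2 * sqrt c * cos \<theta> \<le> (1 + sqrt c)\<^sup>2" using * c by (simp add: power2_sum)
qed

lemma mp_gen_sums:
  assumes c: "0 < c" and z: "\<bar>z\<bar> * (1 + sqrt c)\<^sup>2 < 1"
    and I: "((\<lambda>\<theta>. 2 * c / pi * (sin \<theta>)\<^sup>2 /
        (1 - z * (1 + c - 2 * sqrt c * cos \<theta>))) has_integral J) {0..pi}"
  shows "(\<lambda>n. mp_shift_moment c n * z ^ n) sums J"
proof -
  define t where "t \<theta> = 1 + c - 2 * sqrt c * cos \<theta>" for \<theta>
  define f where "f n \<theta> = 2 * c / pi * (sin \<theta>)\<^sup>2 * (t \<theta>) ^ n * z ^ n" for n \<theta>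
  define g where "g \<theta> = 2 * c / pi * (sin \<theta>)\<^sup>2 / (1 - z * t \<theta>)" for \<theta>
  define b where "b = \<bar>z\<bar> * (1 + sqrt c)\<^sup>2"
  have t: "0 \<le> t \<theta>" "t \<theta> \<le> (1 + sqrt c)\<^sup>2" for \<theta>
    using mp_base_bounds[OF c] by (auto simp: t_def)
  have zt: "\<bar>z * t \<theta>\<bar> \<le> b" for \<theta>
    unfolding b_def abs_mult using t[of \<theta>] by (intro mult_left_mono) auto
  have b: "0 \<le> b" "b < 1" using z by (auto simp: b_def)
  have fs: "f n \<theta> = 2 * c / pi * (sin \<theta>)\<^sup>2 * (z * t \<theta>) ^ n" for n \<theta>
    by (simp add: f_def power_mult_distrib mult_ac)
  have lim: "(\<lambda>n. f n \<theta>) sums g \<theta>" for \<theta>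
    using sums_mult[OF geometric_sums[of "z * t \<theta>"], of "2 * c / pi * (sin \<theta>)\<^sup>2"] zt[of \<theta>] b
    by (simp add: fs g_def)
  have "uniform_limit {0..pi} (\<lambda>n \<theta>. \<Sum>i<n. f i \<theta>) (\<lambda>\<theta>. suminf (\<lambda>i. f i \<theta>)) sequentially"
  proof (rule Weierstrass_m_test)
    fix n \<theta>
    have "norm (f n \<theta>) = 2 * c / pi * (sin \<theta>)\<^sup>2 * \<bar>z * t \<theta>\<bar> ^ n"
      using c by (simp add: fs abs_mult power_abs)
    also have "\<dots> \<le> 2 * c / pi * 1 * b ^ n"
      using c zt[of \<theta>] by (intro mult_mono power_mono) (auto simp: abs_square_le_1 power2_eq_1_iff)
    finally show "norm (f n \<theta>) \<le> 2 * c / pi * b ^ n" by simp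
    show "summable (\<lambda>n. 2 * c / pi * b ^ n)" using b by (intro summable_mult summable_geometric) auto
  qed
  moreover have "(\<lambda>\<theta>. suminf (\<lambda>i. f i \<theta>)) = g" using sums_unique[OF lim] by auto
  ultimately have u: "uniform_limit {0..pi} (\<lambda>n \<theta>. \<Sum>i<n. f i \<theta>) g sequentially" by simp
  have cont: "continuous_on {0..pi} (\<lambda>\<theta>. \<Sum>i<n. f i \<theta>)" for n
    unfolding f_def t_def by (intro continuous_intros)
  obtain I' J' where IJ: "\<And>n. ((\<lambda>\<theta>. \<Sum>i<n. f i \<theta>) has_integral I' n) {0..pi}"
      "(g has_integral J') {0..pi}" "I' \<longlonglongrightarrow> J'"
    using uniform_limit_integral[OF u cont] by auto
  have "J' = J" using IJ(2) I has_integral_unique by (auto simp: g_def[abs_def] t_def)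
  moreover have "I' n = (\<Sum>i<n. mp_shift_moment c i * z ^ i)" for n
  proof -
    have "((\<lambda>\<theta>. \<Sum>i<n. f i \<theta>) has_integral (\<Sum>i<n. mp_shift_moment c i * z ^ i)) {0..pi}"
      unfolding f_def t_def
      by (intro has_integral_sum has_integral_mult_left mp_shift_moment_has_integral) auto
    thus ?thesis using IJ(1) has_integral_unique by blast
  qed
  hence "I' = (\<lambda>n. \<Sum>i<n. mp_shift_moment c i * z ^ i)" by auto
  ultimately show ?thesis using IJ(3) by (simp add: sums_def)
qed

text \<open>Division by the lowest power of the variable would leave a series with nonzero constant
  term that vanishes at all small nonzero points, against continuity at 0.\<close>

lemma real_fps_eq_0:
  fixes f :: "real fps"
  assumes r: "fps_conv_radius f > 0" and ev: "eventually (\<lambda>z. eval_fps f z = 0) (at 0)"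
  shows "f = 0"
proof (rule ccontr)
  assume f: "f \<noteq> 0"
  define g where "g = fps_shift (subdegree f) f"
  have rg: "fps_conv_radius g > 0" using r by (simp add: g_def)
  have cont: "isCont (eval_fps g) 0" 
    using continuous_eval_fps[of 0 g] rg by (simp add: zero_ereal_def)
  have e2: "eventually (\<lambda>z::real. z \<in> eball 0 (fps_conv_radius f)) (at 0)"
    using r by (intro eventually_at_in_open') (auto simp: zero_ereal_def)
  have "eventually (\<lambda>z. eval_fps g z = 0) (at 0)"
    using ev e2 eventually_neq_at_within[of 0 0 UNIV]
  proof eventually_elim
    case (elim z)
    thus ?case unfolding g_def by (subst eval_fps_shift) (auto simp: eval_fps_at_0)
  qed
  hence "(eval_fps g \<longlongrightarrow> 0) (at 0)"
    by (rule tendsto_eventually)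
  hence "eval_fps g 0 = 0"
    using cont LIM_unique by (auto simp: isCont_def)
  thus False using f by (simp add: g_def eval_fps_at_0)
qed


text \<open>
  \<open>K\<close> and \<open>q\<close> are chosen such that \<open>1 - z t = K (1 + q\<^sup>2 - 2 q cos \<theta>)\<close>; then \<open>B = c / K\<close>, and the
  quadratic equation for \<open>K\<close> becomes one for \<open>B\<close>.
\<close>

lemma mp_shift_moment_gen:
  assumes c: "0 < c" and z: "\<bar>z\<bar> * (1 + sqrt c)\<^sup>2 < 1 / 4"
  obtains B where "(\<lambda>n. mp_shift_moment c n * z ^ n) sums B" "B = c + z * (1 + c) * B + z\<^sup>2 * B\<^sup>2"
proof -
  define r where "r = sqrt c"
  have r: "r > 0" "r\<^sup>2 = c" using c by (auto simp: r_def)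
  define h where "h = 1 - z * (1 + c)"
  have zb: "\<bar>z\<bar> * (1 + c) + 2 * \<bar>z\<bar> * r < 1 / 4"
    using z r by (simp add: power2_sum r_def algebra_simps)
  have zc: "\<bar>z * (1 + c)\<bar> = \<bar>z\<bar> * (1 + c)" using c by (simp add: abs_mult)
  have zr0: "0 \<le> \<bar>z\<bar> * r" using r by simp
  have zc0: "0 \<le> \<bar>z\<bar> * (1 + c)" using c by simp
  have h: "h > 3 / 4" unfolding h_def using zb zc zr0 by linarith
  have "2 * \<bar>z\<bar> * r < h" using h zb zc0 by linarith
  hence "(2 * \<bar>z\<bar> * r)\<^sup>2 < h\<^sup>2" using zr0 by (intro power_strict_mono) (simp_all add: mult.assoc)
  hence disc: "h\<^sup>2 - 4 * z\<^sup>2 * c > 0" by (simp add: power_mult_distrib r)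
  \<comment> \<open>Comparing coefficients requires \<open>K * (1 + q^2) = h\<close> and
    \<open>K * q = - z * r\<close>; elimination of \<open>q\<close> gives the quadratic equation
    \<open>Keq\<close>. The larger root stays away from 0 for small \<open>z\<close>, and the bound
    1/4 leaves enough room for \<open>K > 3/8\<close>, hence for \<bar>q\<bar> < 1.\<close>
  define K where "K = (h + sqrt (h\<^sup>2 - 4 * z\<^sup>2 * c)) / 2"
  have K: "K > 3 / 8" unfolding K_def using h disc by (simp add: add_pos_pos field_simps)
      (smt (verit) real_sqrt_gt_zero)
  have Keq: "K\<^sup>2 - h * K + z\<^sup>2 * c = 0"
  proof -
    have "2 * K = h + sqrt (h\<^sup>2 - 4 * z\<^sup>2 * c)" unfolding K_def by simp
    hence "(2 * K - h)\<^sup>2 = h\<^sup>2 - 4 * z\<^sup>2 * c" using disc by simp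
    thus ?thesis by (simp add: power2_eq_square algebra_simps)
  qed
  define q where "q = - z * r / K"
  have "\<bar>z\<bar> * r < K" using K zb zc0 zr0 by linarith
  hence q: "\<bar>q\<bar> < 1" using K r by (simp add: q_def abs_mult)
  have Kq: "K * q = - z * r" using K by (simp add: q_def)
  have "K * (1 + q\<^sup>2) = h"
  proof -
    have "K * (K * (1 + q\<^sup>2)) = K\<^sup>2 + (K * q)\<^sup>2" by (simp add: algebra_simps power2_eq_square)
    also have "\<dots> = K * h" unfolding Kq using Keq r by (simp add: algebra_simps power_mult_distrib)
    finally show ?thesis using K by simp
  qed
  hence den: "1 - z * (1 + c - 2 * sqrt c * cos \<theta>) = K * (1 + q\<^sup>2 - 2 * q * cos \<theta>)" for \<theta>
  proof -
    have "K * (1 + q\<^sup>2 - 2 * q * cos \<theta>) = K * (1 + q\<^sup>2) - 2 * (K * q) * cos \<theta>" by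
        (simp add: algebra_simps)
    also have "\<dots> = h + 2 * z * r * cos \<theta>" unfolding Kq using \<open>K * (1 + q\<^sup>2) = h\<close> by simp
    finally show ?thesis by (simp add: h_def r_def algebra_simps)
  qed
  have "((\<lambda>\<theta>. 2 * c / pi / K * ((sin \<theta>)\<^sup>2 / (1 + q\<^sup>2 - 2 * q * cos \<theta>))) has_integral 2 *
      c / pi / K * (pi / 2)) {0..pi}"
    using q by (intro has_integral_mult_right has_integral_poisson_type) simp
  moreover have "2 * c / pi / K * ((sin \<theta>)\<^sup>2 / (1 + q\<^sup>2 - 2 * q * cos \<theta>)) =
      2 * c / pi * (sin \<theta>)\<^sup>2 / (1 - z * (1 + c - 2 * sqrt c * cos \<theta>))" for \<theta>
    unfolding den by simp
  moreover have "2 * c / pi / K * (pi / 2) = c / K" by simp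
  ultimately have "((\<lambda>\<theta>. 2 * c / pi * (sin \<theta>)\<^sup>2 /
      (1 - z * (1 + c - 2 * sqrt c * cos \<theta>))) has_integral c / K) {0..pi}"
    by (simp only:)
  moreover have "\<bar>z\<bar> * (1 + sqrt c)\<^sup>2 < 1" using z by simp
  ultimately have "(\<lambda>n. mp_shift_moment c n * z ^ n) sums (c / K)" by (intro mp_gen_sums[OF c])
  moreover have "c / K = c + z * (1 + c) * (c / K) + z\<^sup>2 * (c / K)\<^sup>2"
  proof -
    have "c * K = c * K\<^sup>2 + z * (1 + c) * c * K + z\<^sup>2 * c\<^sup>2"
      using arg_cong[OF Keq, of "\<lambda>x. c * x"] by (simp add: h_def algebra_simps power2_eq_square)
    thus ?thesis using K by (simp add: field_simps power2_eq_square)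
  qed
  ultimately show thesis using that by blast
qed

text \<open>The equation \<open>B = c + z (1 + c) B + z^2 B^2\<close> is known for the values of the
  generating function near 0. Since the difference of the two sides is a power series vanishing near
  0, the coefficients can be compared.\<close>

lemma mp_shift_moment_rec:
  assumes c: "0 < c"
  shows "mp_shift_moment c 0 = c"
    "mp_shift_moment c (Suc n) = (1 + c) * mp_shift_moment c n +
        (\<Sum>i<n. mp_shift_moment c i * mp_shift_moment c (n - 1 - i))"
proof -
  define B where "B = Abs_fps (mp_shift_moment c)"
  define F where "F = fps_const c + fps_const (1 + c) * (fps_X * B) + fps_X * (fps_X * (B * B)) - B"
  define e where "e = 1 / 4 / (1 + sqrt c)\<^sup>2"
  have "1 + sqrt c > 0" using c by (smt (verit) real_sqrt_gt_zero)
  hence e: "e > 0" "\<bar>z\<bar> * (1 + sqrt c)\<^sup>2 < 1 / 4 \<longleftrightarrow> \<bar>z\<bar> < e" for z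
    by (auto simp: e_def field_simps)
  have summ: "summable (\<lambda>n. fps_nth B n * z ^ n)" if "\<bar>z\<bar> < e" for z
    using mp_shift_moment_gen[OF c, of z] that e by (auto simp: B_def sums_iff)
  have "ereal (norm (e / 2)) \<le> fps_conv_radius B"
    unfolding fps_conv_radius_def using summ[of "e / 2"] e by (intro conv_radius_geI) auto
  hence rB: "fps_conv_radius B \<ge> ereal (e / 2)" using e by simp
  have XB: "fps_conv_radius (fps_X * B) \<ge> ereal (e / 2)"
    using fps_conv_radius_mult[of fps_X B] rB by simp
  have BB: "fps_conv_radius (B * B) \<ge> ereal (e / 2)"
    using fps_conv_radius_mult[of B B] rB by (simp add: order_trans)
  have XBB: "fps_conv_radius (fps_X * (B * B)) \<ge> ereal (e / 2)"
    using fps_conv_radius_mult[of fps_X "B * B"] BB by simp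
  have XXBB: "fps_conv_radius (fps_X * (fps_X * (B * B))) \<ge> ereal (e / 2)"
    using fps_conv_radius_mult[of fps_X "fps_X * (B * B)"] XBB by simp
  have cXB: "fps_conv_radius (fps_const (1 + c) * (fps_X * B)) \<ge> ereal (e / 2)"
    using fps_conv_radius_mult[of "fps_const (1 + c)" "fps_X * B"] XB by simp
  have S1: "fps_conv_radius (fps_const c + fps_const (1 + c) * (fps_X * B)) \<ge> ereal (e / 2)"
    using fps_conv_radius_add[of "fps_const c" "fps_const (1 + c) * (fps_X * B)"] cXB by
        (simp add: order_trans)
  have S2: "fps_conv_radius (fps_const c + fps_const (1 + c) * (fps_X * B) + fps_X *
      (fps_X * (B * B))) \<ge> ereal (e / 2)"
    by (rule order_trans[OF _ fps_conv_radius_add]) (use S1 XXBB in simp)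
  have S3: "fps_conv_radius F \<ge> ereal (e / 2)"
    unfolding F_def by (rule order_trans[OF _ fps_conv_radius_diff]) (use S2 rB in simp)
  have ev: "eval_fps F z = 0" if z: "\<bar>z\<bar> < e / 2" for z
  proof -
    have lt: "ereal (norm z) < fps_conv_radius f" if "fps_conv_radius f \<ge> ereal (e / 2)" for f ::
        "real fps"
      using z that by (metis ereal_less_eq(3) less_ereal.simps(1) order_less_le_trans real_norm_def)
    obtain b where b: "(\<lambda>n. mp_shift_moment c n * z ^ n) sums b" "b = c + z * (1 + c) * b + z\<^sup>2 * b\<^sup>2"
    proof -
      have "\<bar>z\<bar> < e" using z e(1) by linarith
      thus ?thesis using mp_shift_moment_gen[OF c, of z] e(2) that by blast
    qed
    have "eval_fps B z = b" using b(1) by (simp add: eval_fps_def B_def sums_iff)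
    hence "eval_fps F z = c + (1 + c) * (z * b) + z * (z * (b * b)) - b"
      unfolding F_def using lt[OF rB] lt[OF XB] lt[OF BB] lt[OF XBB] lt[OF XXBB] lt[OF cXB] lt[OF S1] lt[OF S2]
      by (simp add: eval_fps_add eval_fps_diff eval_fps_mult)
    thus ?thesis using b(2) by (simp add: power2_eq_square algebra_simps)
  qed
  have "F = 0"
  proof (rule real_fps_eq_0)
    show "fps_conv_radius F > 0" using S3 e by (auto intro: less_le_trans[of 0 "ereal (e / 2)"])
    show "eventually (\<lambda>z. eval_fps F z = 0) (at 0)"
      unfolding eventually_at using ev e by (intro exI[of _ "e / 2"]) (auto simp: dist_real_def)
  qed
  hence B: "B = fps_const c + fps_const (1 + c) * (fps_X * B) + fps_X * (fps_X * (B * B))"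
    by (simp add: F_def)
  have "fps_nth B 0 = c" by (subst B) simp
  thus "mp_shift_moment c 0 = c" by (simp add: B_def)
  have "fps_nth B (Suc n) = (1 + c) * fps_nth B n + (if n = 0 then 0 else fps_nth (B * B) (n - 1))"
    by (subst B) simp
  moreover have "(if n = 0 then 0 else fps_nth (B * B) (n - 1)) =
      (\<Sum>i<n. fps_nth B i * fps_nth B (n - 1 - i))"
    by (cases n) (auto simp: fps_mult_nth lessThan_Suc_atMost atLeast0AtMost)
  ultimately show "mp_shift_moment c (Suc n) = (1 + c) * mp_shift_moment c n +
      (\<Sum>i<n. mp_shift_moment c i * mp_shift_moment c (n - 1 - i))"
    by (simp add: B_def)
qed

section \<open>Moments of the Marchenko-Pastur measure, with the atom included\<close>

definition mp_moment :: "real \<Rightarrow> nat \<Rightarrow> real" where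
  "mp_moment c n = (case n of 0 \<Rightarrow> 1 | Suc m \<Rightarrow> mp_shift_moment c m)"

text \<open>In this form the recursion is that of \<open>noncrossing_sum_from_rec\<close> for the
  constant cumulant \<open>c\<close>: the summand \<open>m = 0\<close> absorbs the 1 of the factor
  \<open>1 + c\<close>.\<close>

lemma mp_moment_rec:
  assumes "0 < c"
  shows "mp_moment c (Suc n) = c * mp_moment c n + (\<Sum>m<n. mp_moment c m * mp_moment c (n - m))"
proof (cases n)
  case 0 thus ?thesis using mp_shift_moment_rec[OF assms] by (simp add: mp_moment_def)
next
  case (Suc k)
  have "(\<Sum>m<n. mp_moment c m * mp_moment c (n - m)) =
    mp_moment c n + (\<Sum>m<k. mp_shift_moment c m * mp_shift_moment c (k - 1 - m))"
    unfolding Suc sum.lessThan_Suc_shift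
    by (auto simp: mp_moment_def intro!: sum.cong split: nat.split)
       (metis Suc_diff_Suc diff_Suc_1 diff_commute)
  thus ?thesis using mp_shift_moment_rec(2)[OF assms, of k] Suc
    by (simp add: mp_moment_def algebra_simps)
qed

text \<open>The mass of the absolutely continuous part, the only moment where the factor
  \<open>1 / t\<close> of the density survives. For \<open>c > 1\<close> the parameter
  \<open>sqrt c\<close> is outside the range of \<open>has_integral_poisson_type\<close>; taking
  \<open>c\<close> out of the denominator replaces it by its inverse.\<close>

lemma mp_total_has_integral:
  assumes c: "0 < c"
  shows "((\<lambda>\<theta>. 2 * c / pi * (sin \<theta>)\<^sup>2 / (1 + c - 2 * sqrt c * cos \<theta>)) has_integral min 1 c) {0..pi}"
proof -
  define r where "r = sqrt c"
  have r: "r > 0" "r\<^sup>2 = c" using c by (auto simp: r_def)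
  show ?thesis
  proof (cases "c \<le> 1")
    case True
    hence "\<bar>r\<bar> < 1 \<or> r = 1" using r by (auto simp: r_def)
    hence "((\<lambda>\<theta>. 2 * c / pi * ((sin \<theta>)\<^sup>2 / (1 + r\<^sup>2 - 2 * r * cos \<theta>))) has_integral 2 * c / pi *
        (pi / 2)) {0..pi}"
      by (intro has_integral_mult_right has_integral_poisson_type)
    thus ?thesis unfolding r(2) unfolding r_def using True by simp
  next
    case False
    define q where "q = 1 / r"
    have "r > 1" using False by (simp add: r_def)
    hence "\<bar>q\<bar> < 1" by (simp add: q_def)
    hence "((\<lambda>\<theta>. 2 / pi * ((sin \<theta>)\<^sup>2 / (1 + q\<^sup>2 - 2 * q * cos \<theta>))) has_integral 2 / pi *
        (pi / 2)) {0..pi}"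
      by (intro has_integral_mult_right has_integral_poisson_type) simp
    moreover have "2 / pi * ((sin \<theta>)\<^sup>2 / (1 + q\<^sup>2 - 2 * q * cos \<theta>)) =
       2 * c / pi * (sin \<theta>)\<^sup>2 / (1 + c - 2 * sqrt c * cos \<theta>)" for \<theta>
    proof -
      have "1 + c - 2 * sqrt c * cos \<theta> = c * (1 + q\<^sup>2 - 2 * q * cos \<theta>)"
        unfolding r_def[symmetric] r(2)[symmetric] q_def using r(1) by
            (simp add: field_simps power2_eq_square)
      thus ?thesis using c by simp
    qed
    ultimately show ?thesis using False by simp
  qed
qed

text \<open>Under the substitution \<open>t = 1 + c - 2 sqrt c cos \<theta>\<close> the root in the
  density becomes \<open>2 sqrt c sin \<theta>\<close>, and so does the derivative of
  \<open>t\<close>; their product gives the squared sine. The absolute value makes the integrand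
  suitable for \<open>ennreal\<close>.\<close>

lemma mp_density_nn_integral:
  assumes c: "0 < c"
  shows "(\<integral>\<^sup>+ t. ennreal (\<bar>t\<bar> ^ n) * ennreal (marchenko_pastur_density c t) \<partial>lborel) =
    ennreal (if n = 0 then min 1 c else mp_moment c n)"
proof -
  define r where "r = sqrt c"
  have r: "r > 0" "r\<^sup>2 = c" using c by (auto simp: r_def)
  define t where "t \<theta> = 1 + c - 2 * r * cos \<theta>" for \<theta>
  have t0: "t 0 = (1 - r)\<^sup>2" and tpi: "t pi = (1 + r)\<^sup>2"
    using r by (simp_all add: t_def power2_eq_square algebra_simps)
  have tpos: "0 \<le> t \<theta>" for \<theta> using mp_base_bounds(1)[OF c] by (simp add: t_def r_def)
  define f where "f x = \<bar>x\<bar> ^ n * marchenko_pastur_density c x" for x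
  have meas: "marchenko_pastur_density c \<in> borel_measurable borel"
    unfolding marchenko_pastur_density_def[abs_def] Let_def by measurable
  have fm: "f \<in> borel_measurable borel" unfolding f_def using meas by measurable
  have "(\<integral>\<^sup>+ t. ennreal (\<bar>t\<bar> ^ n) * ennreal (marchenko_pastur_density c t) \<partial>lborel) =
     (\<integral>\<^sup>+x. f x * indicator {t 0..t pi} x \<partial>lborel)"
    unfolding t0 tpi
    by (intro nn_integral_cong)
      (auto simp: f_def indicator_def marchenko_pastur_density_def r_def Let_def ennreal_mult'[symmetric])
  also have "\<dots> = (\<integral>\<^sup>+x. f (t x) * (2 * r * sin x) * indicator {0..pi} x \<partial>lborel)"
  proof (rule nn_integral_substitution)
    show "set_borel_measurable borel {t 0..t pi} f"
      unfolding set_borel_measurable_def using fm by measurable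
    show "(t has_real_derivative 2 * r * sin x) (at x)" for x
      unfolding t_def by (auto intro!: derivative_eq_intros)
    show "continuous_on {0..pi} (\<lambda>x. 2 * r * sin x)" by (intro continuous_intros)
    show "x \<in> {0..pi} \<Longrightarrow> 2 * r * sin x \<ge> 0" for x using r sin_ge_zero by auto
  qed auto
  also have "\<dots> = (\<integral>\<^sup>+x. ennreal (indicator {0..pi} x *
      (2 * c / pi * (sin x)\<^sup>2 * t x ^ n / t x)) \<partial>lborel)"
  proof (intro nn_integral_cong)
    fix x :: real
    show "ennreal (f (t x) * (2 * r * sin x) * indicator {0..pi} x) =
      ennreal (indicator {0..pi} x * (2 * c / pi * (sin x)\<^sup>2 * t x ^ n / t x))"
    proof (cases "x \<in> {0..pi}")
      case True
      hence s: "sin x \<ge> 0" using sin_ge_zero by auto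
      have "r * cos x \<le> r" "- r \<le> r * cos x"
        using r(1) mult_left_mono[of "cos x" 1 r] mult_left_mono[of "-1" "cos x" r] by auto
      hence bd: "(1 - r)\<^sup>2 \<le> t x" "t x \<le> (1 + r)\<^sup>2"
        using r(2) by (auto simp: t_def power2_sum power2_diff)
      have "((1 + r)\<^sup>2 - t x) * (t x - (1 - r)\<^sup>2) = (2 * r * sin x)\<^sup>2"
        unfolding t_def r(2)[symmetric] power_mult_distrib sin_squared_eq by
            (simp add: power2_eq_square algebra_simps)
      hence "marchenko_pastur_density c (t x) = 2 * r * sin x / (2 * pi * t x)"
        using bd s r(1) by (simp add: marchenko_pastur_density_def Let_def r_def[symmetric])
      hence "f (t x) * (2 * r * sin x) = 2 * c / pi * (sin x)\<^sup>2 * t x ^ n / t x"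
        using tpos[of x] by (simp add: f_def r(2)[symmetric] power2_eq_square)
      thus ?thesis using True by simp
    qed simp
  qed
  also have "\<dots> = ennreal (if n = 0 then min 1 c else mp_moment c n)"
  proof (rule nn_integral_has_integral_lebesgue)
    show "0 \<le> 2 * c / pi * (sin x)\<^sup>2 * t x ^ n / t x" for x
      using c tpos[of x] by simp
    show "((\<lambda>x. 2 * c / pi * (sin x)\<^sup>2 * t x ^ n / t x) has_integral
        (if n = 0 then min 1 c else mp_moment c n)) {0..pi}"
    proof (cases n)
      case 0
      thus ?thesis using mp_total_has_integral[OF c] by (simp add: t_def r_def)
    next
      case (Suc m)
      \<comment> \<open>One factor \<open>t x\<close> is cancelled here. It is 0 at
        \<open>x = 0\<close> if \<open>c = 1\<close>, so this point is left out.\<close>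
      have "((\<lambda>x. 2 * c / pi * (sin x)\<^sup>2 * t x ^ n / t x) has_integral mp_shift_moment c m) {0..pi}"
      proof (rule has_integral_spike_finite[OF _ _ mp_shift_moment_has_integral])
        fix x assume x: "x \<in> {0..pi} - {0}"
        have "cos x < 1" using cos_monotone_0_pi[of 0 x] x by auto
        hence "r * cos x < r" using r(1) by simp
        hence "t x > (1 - r)\<^sup>2" using r(2) by (auto simp: t_def power2_diff)
        hence "t x \<noteq> 0" by (smt (verit) zero_le_power2)
        thus "2 * c / pi * (sin x)\<^sup>2 * t x ^ n / t x = 2 * c / pi * (sin x)\<^sup>2 *
            (1 + c - 2 * sqrt c * cos x) ^ m"
          by (simp add: Suc t_def r_def)
      qed simp
      thus ?thesis using Suc by (simp add: mp_moment_def)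
    qed
  qed
  finally show ?thesis .
qed

lemma mp_moment_nonneg: "0 < c \<Longrightarrow> 0 \<le> mp_moment c n"
  unfolding mp_moment_def mp_shift_moment_def
  by (cases n) (auto simp del: integral_divide
      intro!: integral_nonneg integrable_continuous_interval continuous_intros
      mult_nonneg_nonneg divide_nonneg_nonneg zero_le_power[OF mp_base_bounds(1)])

text \<open>The measure is given only by its values on sets. Away from 0 it coincides with the
  density part, which has no mass at 0, so the integral splits into the density part and the value
  at the atom.\<close>

lemma nn_integral_marchenko_pastur:
  assumes f[measurable]: "f \<in> borel_measurable borel"
  shows "(\<integral>\<^sup>+ t. f t \<partial>marchenko_pastur c) =
    (\<integral>\<^sup>+ t. f t * ennreal (marchenko_pastur_density c t) \<partial>lborel) + ennreal (1 - c) * f 0"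
proof -
  let ?\<mu> = "marchenko_pastur c"
  have dm[measurable]: "marchenko_pastur_density c \<in> borel_measurable borel"
    unfolding marchenko_pastur_density_def[abs_def] Let_def by measurable
  let ?D = "density lborel (\<lambda>t. ennreal (marchenko_pastur_density c t))"
  have D0: "emeasure ?D {0} = 0"
  proof -
    have "(\<lambda>t. ennreal (marchenko_pastur_density c t)) \<in> borel_measurable lborel" by measurable
    moreover have "AE t in lborel. t \<in> {0} \<longrightarrow> ennreal (marchenko_pastur_density c t) = 0"
      using AE_lborel_singleton[of "0::real"] by eventually_elim simp
    ultimately have "{0} \<in> null_sets ?D" by (subst null_sets_density_iff) auto
    thus ?thesis by auto
  qed
  have eq: "density ?\<mu> (indicator (- {0})) = ?D"
  proof (rule measure_eqI)
    fix A assume "A \<in> sets (density ?\<mu> (indicator (- {0})))"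
    hence A[measurable]: "A \<in> sets borel" by simp
    have "emeasure (density ?\<mu> (indicator (- {0}))) A = emeasure ?\<mu> (A \<inter> - {0})"
      by (subst emeasure_density) (auto simp: indicator_inter_arith[symmetric] Int_commute nn_integral_indicator intro!: nn_integral_cong)
    also have "\<dots> = emeasure ?D (A - {0})"
      by (subst emeasure_marchenko_pastur) (auto simp: Diff_eq)
    also have "\<dots> = emeasure ?D A"
      using D0 by (intro emeasure_Diff_null_set) (auto simp: null_sets_def)
    finally show "emeasure (density ?\<mu> (indicator (- {0}))) A = emeasure ?D A" .
  qed simp
  have "(\<integral>\<^sup>+ t. f t \<partial>?\<mu>) = (\<integral>\<^sup>+ t. indicator (- {0}) t * f t + f 0 * indicator {0} t \<partial>?\<mu>)"
    by (intro nn_integral_cong) (auto simp: indicator_def)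
  also have "\<dots> = (\<integral>\<^sup>+ t. indicator (- {0}) t * f t \<partial>?\<mu>) + (\<integral>\<^sup>+ t. f 0 * indicator {0} t \<partial>?\<mu>)"
    by (intro nn_integral_add) auto
  also have "(\<integral>\<^sup>+ t. indicator (- {0}) t * f t \<partial>?\<mu>) = (\<integral>\<^sup>+ t. f t \<partial>?D)"
    unfolding eq[symmetric] by (subst nn_integral_density) auto
  also have "\<dots> = (\<integral>\<^sup>+ t. f t * ennreal (marchenko_pastur_density c t) \<partial>lborel)"
    by (subst nn_integral_density) (auto simp: mult.commute)
  also have "(\<integral>\<^sup>+ t. f 0 * indicator {0} t \<partial>?\<mu>) = f 0 * emeasure ?\<mu> {0}"
    by (rule nn_integral_cmult_indicator) simp
  also have "emeasure ?\<mu> {0} = ennreal (1 - c)"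
    by (subst emeasure_marchenko_pastur) (auto simp: D0)
  finally show ?thesis by (simp add: mult.commute)
qed

lemma marchenko_pastur_moments:
  assumes c: "0 < c"
  shows "integrable (marchenko_pastur c) (\<lambda>t. t ^ n)"
    and "(\<integral>t. t ^ n \<partial>marchenko_pastur c) = mp_moment c n"
proof -
  let ?\<mu> = "marchenko_pastur c"
  have "(\<integral>\<^sup>+ t. ennreal (\<bar>t\<bar> ^ n) \<partial>?\<mu>) = ennreal (if n = 0 then min 1 c else mp_moment c n) +
      ennreal (1 - c) * ennreal (\<bar>0\<bar> ^ n)"
    by (subst nn_integral_marchenko_pastur) (auto simp: mp_density_nn_integral[OF c])
  \<comment> \<open>For \<open>n = 0\<close> the atom supplies the mass that is missing if
    \<open>c < 1\<close>; for \<open>c > 1\<close> its weight is truncated to 0. For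
    \<open>n > 0\<close> the power vanishes at the atom.\<close>
  also have "\<dots> = ennreal (mp_moment c n)"
  proof (cases n)
    case 0
    show ?thesis
    proof (cases "c \<le> 1")
      case True
      hence "ennreal (min 1 c) + ennreal (1 - c) = ennreal (c + (1 - c))" using c by
          (simp add: ennreal_plus[symmetric] del: ennreal_plus)
      thus ?thesis using 0 by (simp add: mp_moment_def)
    qed (use 0 in \<open>simp add: mp_moment_def ennreal_neg\<close>)
  qed simp
  finally have nn: "(\<integral>\<^sup>+ t. ennreal (\<bar>t\<bar> ^ n) \<partial>?\<mu>) = ennreal (mp_moment c n)" .
  have m: "(\<lambda>t. t ^ n) \<in> borel_measurable ?\<mu>" by measurable
  show int: "integrable ?\<mu> (\<lambda>t. t ^ n)"
    using nn m by (intro integrableI_bounded) (auto simp: power_abs)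
  have dm[measurable]: "marchenko_pastur_density c \<in> borel_measurable borel"
    unfolding marchenko_pastur_density_def[abs_def] Let_def by measurable
  have "marchenko_pastur_density c t = 0" if "t < 0" for t
    using that order_trans[OF zero_le_power2[of "1 - sqrt c"], of t] by
        (auto simp: marchenko_pastur_density_def Let_def)
  hence "{..<0} \<in> null_sets (density lborel (\<lambda>t. ennreal (marchenko_pastur_density c t)))"
    by (subst null_sets_density_iff) auto
  hence "emeasure ?\<mu> {..<0} = 0"
    by (subst emeasure_marchenko_pastur) auto
  hence ae: "AE t in ?\<mu>. 0 \<le> t"
    by (intro AE_I[of _ _ "{..<0}"]) auto
  have "(\<integral>t. t ^ n \<partial>?\<mu>) = (\<integral>t. \<bar>t\<bar> ^ n \<partial>?\<mu>)"
    using ae m by (intro integral_cong_AE) auto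
  also have "\<dots> = enn2real (\<integral>\<^sup>+ t. ennreal (\<bar>t\<bar> ^ n) \<partial>?\<mu>)"
    by (intro integral_eq_nn_integral) auto
  also have "\<dots> = mp_moment c n" using mp_moment_nonneg[OF c] by (simp add: nn)
  finally show "(\<integral>t. t ^ n \<partial>?\<mu>) = mp_moment c n" .
qed

subsection \<open>Freeness and mixed cumulants\<close>

text \<open>
  The value of \<open>N\<close> at \<open>U (W\<^sub>1 - M W\<^sub>1) \<cdots> (W\<^sub>r - M W\<^sub>r) V\<close>, expanded into words.
\<close>

primrec centered :: "('x list \<Rightarrow> complex) \<Rightarrow>
    ('x list \<Rightarrow> complex) \<Rightarrow> 'x list \<Rightarrow> 'x list list \<Rightarrow> 'x list \<Rightarrow> complex" where
  "centered M N U [] V = N (U @ V)"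
| "centered M N U (W # Ws) V = centered M N (U @ W) Ws V - M W * centered M N U Ws V"

lemma centered_Cons: "centered M N (x # U) Ws V = centered M (\<lambda>Z. N (x # Z)) U Ws V"
  by (induction Ws arbitrary: U) simp_all

lemma centered_zero: "centered M (\<lambda>_. 0) U Ws V = 0"
  by (induction Ws arbitrary: U) simp_all

lemma centered_linear:
  "centered M (\<lambda>Z. a * N Z + N' Z) U Ws V = a * centered M N U Ws V + centered M N' U Ws V"
  by (induction Ws arbitrary: U) (simp_all add: algebra_simps)

lemma sum_splits_append:
  fixes A :: "'x list \<Rightarrow> complex"
  shows "(\<Sum>m<length (U @ V). A (take m (U @ V)) * F ((U @ V) ! m) (drop (Suc m) (U @ V))) =
     (\<Sum>m<length U. A (take m U) * F (U ! m) (drop (Suc m) U @ V)) +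
     (\<Sum>m<length V. A (U @ take m V) * F (V ! m) (drop (Suc m) V))"
proof -
  have "(\<Sum>m<length (U @ V). A (take m (U @ V)) * F ((U @ V) ! m) (drop (Suc m) (U @ V))) =
    (\<Sum>m<length U. A (take m (U @ V)) * F ((U @ V) ! m) (drop (Suc m) (U @ V))) +
    (\<Sum>m<length V. A (take (length U + m) (U @ V)) * F ((U @ V) ! (length U + m))
        (drop (Suc (length U + m)) (U @ V)))"
    by (simp add: sum.nat_group[symmetric] lessThan_atLeast0 sum.atLeastLessThan_concat[symmetric,
        of 0 "length U" "length U + length V"]
        sum.shift_bounds_nat_ivl[of _ 0 "length U" "length V", simplified add.commute,
            simplified] add.commute)
  thus ?thesis by (simp add: nth_append Suc_diff_le cong: sum.cong_simp)
qed

text \<open>A Leibniz rule: the marked letter lies in \<open>U\<close>, in one of the factors, or in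
  \<open>V\<close>. A factor containing the mark loses its centring, since the scalar subtracted
  from it offers no letter to mark; the factors before and after it remain centred.\<close>

lemma centered_sum_splits:
  assumes D: "\<And>Z. D Z = (\<Sum>m<length Z. M (take m Z) * N (Z ! m) (drop (Suc m) Z))"
  shows "centered M D U Ws V =
    (\<Sum>m<length U. M (take m U) * centered M (N (U ! m)) (drop (Suc m) U) Ws V) +
    (\<Sum>i<length Ws. \<Sum>m<length (Ws ! i). centered M M U (take i Ws) (take m (Ws ! i)) *
        centered M (N (Ws ! i ! m)) (drop (Suc m) (Ws ! i)) (drop (Suc i) Ws) V) +
    (\<Sum>m<length V. centered M M U Ws (take m V) * N (V ! m) (drop (Suc m) V))"
proof (induction Ws arbitrary: U)
  case Nil
  show ?case unfolding centered.simps D by (subst sum_splits_append) simp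
next
  case (Cons W Ws)
  have 1: "(\<Sum>m<length (U @ W). M (take m (U @ W)) * centered M (N ((U @ W) ! m))
      (drop (Suc m) (U @ W)) Ws V) =
     (\<Sum>m<length U. M (take m U) * centered M (N (U ! m)) (drop (Suc m) U @ W) Ws V) +
     (\<Sum>m<length W. M (U @ take m W) * centered M (N (W ! m)) (drop (Suc m) W) Ws V)"
    by (rule sum_splits_append[of M U W "\<lambda>x Z. centered M (N x) Z Ws V"])
  show ?case
    unfolding centered.simps(2) Cons.IH 1 sum.lessThan_Suc_shift length_Cons
    by (simp add: sum_subtractf sum_distrib_left algebra_simps del: sum.lessThan_Suc)
qed

section \<open>Coloured letters: alternating centred products and mixed cumulants\<close>

definition monochrome :: "('x \<Rightarrow> 'i) \<Rightarrow> 'x list \<Rightarrow> bool" where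
  "monochrome clr xs \<longleftrightarrow> (\<forall>x\<in>set xs. \<forall>y\<in>set xs. clr x = clr y)"

text \<open>The colours are listed separately because words may be empty, in which case the word
  itself does not determine its colour. Empty words occur at the two ends in the induction
  below.\<close>

definition alternating_blocks :: "('x \<Rightarrow> 'i) \<Rightarrow> 'i list \<Rightarrow> 'x list list \<Rightarrow> bool" where
  "alternating_blocks clr cs Ws \<longleftrightarrow> distinct_adj cs \<and> list_all2 (\<lambda>c W. \<forall>x\<in>set W. clr x = c) cs Ws"

context
  fixes \<kappa> :: "'x list \<Rightarrow> complex" and clr :: "'x \<Rightarrow> 'i"
  assumes mixed: "\<And>xs. \<not> monochrome clr xs \<Longrightarrow> \<kappa> xs = 0"
begin

lemma noncrossing_sum_from_mixed:
  "ys \<noteq> [] \<Longrightarrow> \<not> monochrome clr ys \<Longrightarrow> noncrossing_sum_from \<kappa> ys xs = 0"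
proof (rule noncrossing_sum_from_prefix_zero)
  fix zs assume "\<not> monochrome clr ys"
  hence "\<not> monochrome clr (ys @ zs)" unfolding monochrome_def set_append by blast
  thus "\<kappa> (ys @ zs) = 0" by (rule mixed)
qed

text \<open>No block with nonzero cumulant connects \<open>U\<close> with \<open>V\<close>, since
  they have no colour in common. The second equation is the companion statement that the induction
  along the first block needs.\<close>

lemma noncrossing_sum_append:
  assumes "\<forall>x\<in>set U. clr x = c" "\<forall>x\<in>set V. clr x \<noteq> c"
  shows "noncrossing_sum \<kappa> (U @ V) = noncrossing_sum \<kappa> U * noncrossing_sum \<kappa> V"
    and "ys \<noteq> [] \<Longrightarrow> \<forall>x\<in>set ys. clr x = c \<Longrightarrow>
      noncrossing_sum_from \<kappa> ys (U @ V) = noncrossing_sum_from \<kappa> ys U * noncrossing_sum \<kappa> V"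
proof -
  have "noncrossing_sum \<kappa> (U @ V) = noncrossing_sum \<kappa> U * noncrossing_sum \<kappa> V \<and>
    (\<forall>ys. ys \<noteq> [] \<and> (\<forall>x\<in>set ys. clr x = c) \<longrightarrow>
      noncrossing_sum_from \<kappa> ys (U @ V) = noncrossing_sum_from \<kappa> ys U * noncrossing_sum \<kappa> V)"
    using assms(1)
  proof (induction U rule: length_induct)
    case (1 U)
    have nc: "noncrossing_sum \<kappa> (U @ V) = noncrossing_sum \<kappa> U * noncrossing_sum \<kappa> V"
    proof (cases U)
      case (Cons x U')
      hence "noncrossing_sum_from \<kappa> [x] (U' @ V) = noncrossing_sum_from \<kappa> [x] U' * noncrossing_sum \<kappa> V"
        using 1 by simp
      thus ?thesis by (simp add: Cons noncrossing_sum_Cons)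
    qed simp
    moreover have "noncrossing_sum_from \<kappa> ys (U @ V) = noncrossing_sum_from \<kappa> ys U *
        noncrossing_sum \<kappa> V"
      if ys: "ys \<noteq> []" "\<forall>x\<in>set ys. clr x = c" for ys
    proof -
      have V0: "noncrossing_sum_from \<kappa> (ys @ [V ! m]) Z = 0" if "m < length V" for m Z
      proof (rule noncrossing_sum_from_mixed)
        have "clr (V ! m) \<noteq> c" using assms(2) that by simp
        moreover obtain y where "y \<in> set ys" using ys(1) by fastforce
        ultimately show "\<not> monochrome clr (ys @ [V ! m])" using ys(2) by (auto simp: monochrome_def)
      qed simp
      have U1: "noncrossing_sum_from \<kappa> (ys @ [U ! m]) (drop (Suc m) U @ V) =
          noncrossing_sum_from \<kappa> (ys @ [U ! m]) (drop (Suc m) U) *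
              noncrossing_sum \<kappa> V" if "m < length U" for m
      proof -
        have "\<forall>x\<in>set (drop (Suc m) U). clr x = c" using 1(2) in_set_dropD by fastforce
        moreover have "length (drop (Suc m) U) < length U" using that by simp
        ultimately show ?thesis using 1 ys that by auto
      qed
      show ?thesis
        unfolding noncrossing_sum_from_rec[OF ys(1), of \<kappa>
            "U @ V"] noncrossing_sum_from_rec[OF ys(1), of \<kappa> U]
          sum_splits_append[of "noncrossing_sum \<kappa>" U V "\<lambda>x Z. noncrossing_sum_from \<kappa> (ys @ [x]) Z"]
        by (simp add: V0 U1 nc algebra_simps sum_distrib_left sum_distrib_right)
    qed
    ultimately show ?case by blast
  qed
  thus "noncrossing_sum \<kappa> (U @ V) = noncrossing_sum \<kappa> U * noncrossing_sum \<kappa> V"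
    and "ys \<noteq> [] \<Longrightarrow> \<forall>x\<in>set ys. clr x = c \<Longrightarrow>
      noncrossing_sum_from \<kappa> ys (U @ V) = noncrossing_sum_from \<kappa> ys U * noncrossing_sum \<kappa> V"
    by auto
qed

abbreviation "\<mu> \<equiv> noncrossing_sum \<kappa>"

text \<open>
  Expand along the block of the first letter of \<open>U\<close>. If that block has an element beyond \<open>U\<close>, then
  the part enclosed by it has the same shape with a shorter word and at least one centred
  factor, because the colours of neighbours differ.
\<close>

lemma centered_noncrossing_sum_aux:
  assumes "Ws \<noteq> []" "alternating_blocks clr (c # cs @ [c']) (U # Ws @ [V])"
    "length U + length (concat Ws) + length V \<le> n"
  shows "centered \<mu> \<mu> U Ws V = 0 \<and>
    (\<forall>ys. ys \<noteq> [] \<and> (\<forall>x\<in>set ys. clr x = c) \<longrightarrow> centered \<mu> (noncrossing_sum_from \<kappa> ys) U Ws V = 0)"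
  using assms
proof (induction n arbitrary: U Ws V c cs c' rule: less_induct)
  case (less n)
  note IH = less.IH
  have A: "centered \<mu> \<mu> U Ws V = 0"
    if "Ws \<noteq> []" "alternating_blocks clr (c # cs @ [c']) (U # Ws @ [V])"
      "length U + length (concat Ws) + length V \<le> n" for U Ws V c cs c'
    using that
  proof (induction Ws arbitrary: U cs c)
    case (Cons W Ws)
    obtain d cs' where cs: "cs = d # cs'"
      using Cons.prems(2) by (cases cs) (auto
          simp: alternating_blocks_def list_all2_Cons2 list_all2_append2)
    have alt: "c \<noteq> d" "distinct_adj (d # cs' @ [c'])"
        "list_all2 (\<lambda>c W. \<forall>x\<in>set W. clr x = c) (cs' @ [c']) (Ws @ [V])"
      "\<forall>x\<in>set U. clr x = c" "\<forall>x\<in>set W. clr x = d"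
      using Cons.prems(2) by (auto simp: cs alternating_blocks_def)
    show ?case
    proof (cases U)
      case U: (Cons x U')
      have m: "length U' + length (concat (W # Ws)) + length V < n" using Cons.prems(3) U by simp
      have "centered \<mu> (noncrossing_sum_from \<kappa> [x]) U' (W # Ws) V = 0"
        using IH[OF m, of "W # Ws" c cs c' U' V] Cons.prems(2) U by (simp add: alternating_blocks_def)
      thus ?thesis unfolding U centered_Cons noncrossing_sum_Cons .
    next
      case U: Nil
      show ?thesis
      proof (cases "Ws = []")
        case True
        hence "cs' = []" "d \<noteq> c'" "\<forall>x\<in>set V. clr x = c'"
          using alt(2,3) by (auto simp: list_all2_append2 list_all2_Cons2 distinct_adj_Cons)
        thus ?thesis using True U alt(5) noncrossing_sum_append(1)[of W d V] by auto
      next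
        case False
        have 1: "alternating_blocks clr (d # cs' @ [c']) (W # Ws @ [V])"
          "alternating_blocks clr (d # cs' @ [c']) ([] # Ws @ [V])"
          using alt by (auto simp: alternating_blocks_def)
        have "centered \<mu> \<mu> W Ws V = 0" "centered \<mu> \<mu> [] Ws V = 0"
          using Cons.IH[OF False 1(1)] Cons.IH[OF False 1(2)] Cons.prems(3) by simp_all
        thus ?thesis using U by simp
      qed
    qed
  qed simp
  have B: "centered \<mu> (noncrossing_sum_from \<kappa> ys) U Ws V = 0"
    if ys: "ys \<noteq> []" "\<forall>x\<in>set ys. clr x = c" for ys
  proof -
    define N where "N x = noncrossing_sum_from \<kappa> (ys @ [x])" for x
    define D where "D Z = (\<Sum>m<length Z. \<mu> (take m Z) * N (Z ! m) (drop (Suc m) Z))" for Z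
    have alt: "distinct_adj (c # cs @ [c'])" "\<forall>x\<in>set U. clr x = c" "\<forall>x\<in>set V. clr x = c'"
      "length cs = length Ws" "list_all2 (\<lambda>c W. \<forall>x\<in>set W. clr x = c) cs Ws"
      using less.prems(2) by (auto simp: alternating_blocks_def list_all2_append dest: list_all2_lengthD
        simp: list_all2_append1 list_all2_append2)
    have N0: "N x = (\<lambda>_. 0)" if "clr x \<noteq> c" for x
    proof -
      obtain y where "y \<in> set ys" using ys(1) by fastforce
      hence "\<not> monochrome clr (ys @ [x])" using ys(2) that by (auto simp: monochrome_def)
      thus ?thesis using noncrossing_sum_from_mixed[of "ys @ [x]"] by (auto simp: N_def)
    qed
    have 1: "centered \<mu> (N (U ! m)) (drop (Suc m) U) Ws V = 0" if m: "m < length U" for m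
    proof -
      have len: "length (drop (Suc m) U) + length (concat Ws) + length V < n"
        using m less.prems(3) by simp
      have "alternating_blocks clr (c # cs @ [c']) (drop (Suc m) U # Ws @ [V])"
        using less.prems(2) by (auto simp: alternating_blocks_def dest: in_set_dropD)
      thus ?thesis using IH[OF len less.prems(1)] ys alt(2) m by (auto simp: N_def)
    qed
    have 2: "centered \<mu> \<mu> U (take i Ws) (take m (Ws ! i)) *
        centered \<mu> (N (Ws ! i ! m)) (drop (Suc m) (Ws ! i)) (drop (Suc i) Ws) V = 0"
      if i: "i < length Ws" and m: "m < length (Ws ! i)" for i m
    proof (cases "cs ! i = c")
      case False
      have "clr (Ws ! i ! m) = cs ! i" using alt(5) i m by (auto simp: list_all2_conv_all_nth)
      thus ?thesis using N0[of "Ws ! i ! m"] False by (simp add: centered_zero)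
    next
      case True
      have "i \<noteq> 0"
      proof
        assume "i = 0"
        hence "cs = c # tl cs" using True alt(4) i by (cases cs) auto
        thus False using alt(1) by (metis append_Cons distinct_adj_Cons_Cons)
      qed
      have cs: "c # cs @ [c'] = (c # take i cs @ [cs ! i]) @ (drop (Suc i) cs @ [c'])"
        using id_take_nth_drop[of i cs] i alt(4) by simp
      have "distinct_adj (c # take i cs @ [cs ! i])"
        using alt(1) unfolding cs by (rule distinct_adj_appendD1)
      moreover have "list_all2 (\<lambda>c W. \<forall>x\<in>set W. clr x = c) (take i cs) (take i Ws)"
        using alt(5) by (rule list_all2_takeI)
      moreover have "\<forall>x\<in>set (take m (Ws ! i)). clr x = cs ! i"
        using alt(5) i alt(4) by (auto simp: list_all2_conv_all_nth dest: in_set_takeD)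
      ultimately have blocks: "alternating_blocks clr (c # take i cs @ [cs ! i])
          (U # take i Ws @ [take m (Ws ! i)])"
        using alt(2) by (auto simp: alternating_blocks_def list_all2_appendI)
      have "length (concat Ws) = length (concat (take i Ws)) + length (Ws ! i) + length
          (concat (drop (Suc i) Ws))"
        by (subst id_take_nth_drop[OF i]) simp
      hence len: "length U + length (concat (take i Ws)) + length (take m (Ws ! i)) < n"
        using less.prems(3) m by simp
      have "take i Ws \<noteq> []" using \<open>i \<noteq> 0\<close> i by auto
      thus ?thesis using IH[OF len _ blocks] by simp
    qed
    have 3: "centered \<mu> \<mu> U Ws (take m V) * N (V ! m) (drop (Suc m) V) = 0" if m: "m < length V" for m
    proof (cases "c' = c")
      case False
      thus ?thesis using N0[of "V ! m"] alt(3) m by simp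
    next
      case True
      have len: "length U + length (concat Ws) + length (take m V) < n"
        using m less.prems(3) by simp
      have "alternating_blocks clr (c # cs @ [c']) (U # Ws @ [take m V])"
        using less.prems(2) alt(4) by (auto
            simp: alternating_blocks_def list_all2_append dest: in_set_takeD)
      thus ?thesis using IH[OF len less.prems(1)] by simp
    qed
    have "centered \<mu> D U Ws V = 0"
      unfolding centered_sum_splits[of D \<mu> N, OF D_def]
      using 2 3 by (simp add: 1 sum.neutral del: mult_eq_0_iff)
    moreover have "noncrossing_sum_from \<kappa> ys = (\<lambda>Z. \<kappa> ys * \<mu> Z + D Z)"
      unfolding D_def N_def using noncrossing_sum_from_rec[OF ys(1)] by blast
    ultimately show ?thesis using A[OF less.prems] by (simp add: centered_linear)
  qed
  show ?case using A[OF less.prems] B by blast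
qed

end

text \<open>The auxiliary lemma asks for words at both ends whose colours differ from those of their
  neighbours. Empty words with the additional colour \<open>None\<close> serve this purpose.\<close>

theorem centered_noncrossing_sum:
  assumes mixed: "\<And>xs. \<not> monochrome clr xs \<Longrightarrow> \<kappa> xs = 0"
    and Ws: "Ws \<noteq> []" "alternating_blocks clr cs Ws"
  shows "centered (noncrossing_sum \<kappa>) (noncrossing_sum \<kappa>) [] Ws [] = 0"
proof -
  let ?clr = "\<lambda>x. Some (clr x)"
  have "monochrome ?clr = monochrome clr" by (auto simp: monochrome_def fun_eq_iff)
  hence mixed': "\<not> monochrome ?clr xs \<Longrightarrow> \<kappa> xs = 0" for xs using mixed by simp
  have *: "distinct_adj cs" "list_all2 (\<lambda>c W. \<forall>x\<in>set W. clr x = c) cs Ws"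
    using Ws by (auto simp: alternating_blocks_def)
  have "cs \<noteq> []" using *(2) Ws(1) by auto
  hence "distinct_adj (None # map Some cs @ [None])"
    using *(1) by (auto simp: distinct_adj_Cons distinct_adj_append_iff distinct_adj_map_iff hd_append hd_map last_map)
  hence "alternating_blocks ?clr (None # map Some cs @ [None]) ([] # Ws @ [[]])"
    using *(2) by (auto simp: alternating_blocks_def list_all2_map1 intro!: list_all2_appendI)
  from centered_noncrossing_sum_aux[OF mixed' Ws(1) this order_refl] show ?thesis by simp
qed

lemma alternating_blocks_exist:
  "\<exists>cs Ws. alternating_blocks clr cs Ws \<and> concat Ws = Z \<and> [] \<notin> set Ws"
proof (induction Z)
  case Nil
  show ?case by (intro exI[of _ "[]"]) (auto simp: alternating_blocks_def)
next
  case (Cons z Z)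
  then obtain cs Ws where IH: "distinct_adj cs" "list_all2 (\<lambda>c W. \<forall>x\<in>set W. clr x = c) cs Ws"
    "concat Ws = Z" "[] \<notin> set Ws" by (auto simp: alternating_blocks_def)
  show ?case
  proof (cases "cs \<noteq> [] \<and> hd cs = clr z")
    case True
    then obtain cs' W Ws' where "cs = clr z # cs'" "Ws = W # Ws'"
      using IH(2) by (cases cs; cases Ws) auto
    thus ?thesis using IH
      by (intro exI[of _ cs] exI[of _ "(z # W) # Ws'"]) (auto simp: alternating_blocks_def)
  next
    case False
    thus ?thesis using IH
      by (intro exI[of _ "clr z # cs"] exI[of _ "[z] # Ws"])
          (auto simp: alternating_blocks_def distinct_adj_Cons)
  qed
qed

lemma centered_eq_below:
  assumes "\<And>Z. length Z < n \<Longrightarrow> M Z = M' Z" "length (U @ concat Ws) < n"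
  shows "centered M M U Ws [] = centered M' M' U Ws []"
  using assms(2) by (induction Ws arbitrary: U) (auto simp: assms(1))

text \<open>Apart from the full word, each term of the expansion replaces at least one nonempty
  factor by its moment. It therefore involves only moments on which the two functionals
  agree.\<close>

lemma centered_diff:
  assumes "\<And>Z. length Z < n \<Longrightarrow> M Z = M' Z" "length (U @ concat Ws) \<le> n"
    and "[] \<notin> set Ws" "\<And>W. W \<in> set Ws \<Longrightarrow> M W = M' W"
  shows "centered M M U Ws [] - centered M' M' U Ws [] = M (U @ concat Ws) - M' (U @ concat Ws)"
  using assms(2,3,4)
proof (induction Ws arbitrary: U)
  case (Cons W Ws)
  have "length (U @ concat Ws) < n" using Cons.prems(1,2) by (cases W) auto
  hence "centered M M U Ws [] = centered M' M' U Ws []"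
    using centered_eq_below[of n M M' U Ws] assms(1) by blast
  moreover have "centered M M (U @ W) Ws [] - centered M' M' (U @ W) Ws [] = M
      ((U @ W) @ concat Ws) - M' ((U @ W) @ concat Ws)"
    using Cons.prems by (intro Cons.IH) auto
  ultimately show ?case using Cons.prems(3)[of W] by simp
qed simp

text \<open>Cut \<open>Z\<close> into maximal monochrome blocks: the vanishing of their centred
  product expresses the moment of \<open>Z\<close> by moments of single blocks and of shorter
  words.\<close>

lemma centered_determines_moments:
  assumes M: "\<And>cs Ws. Ws \<noteq> [] \<Longrightarrow> alternating_blocks clr cs Ws \<Longrightarrow> centered M M [] Ws [] = 0"
    and M': "\<And>cs Ws. Ws \<noteq> [] \<Longrightarrow> alternating_blocks clr cs Ws \<Longrightarrow> centered M' M' [] Ws [] = 0"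
    and eq: "\<And>W. monochrome clr W \<Longrightarrow> M W = M' W"
  shows "M Z = M' Z"
proof (induction Z rule: length_induct)
  case (1 Z)
  obtain cs Ws where Ws: "alternating_blocks clr cs Ws" "concat Ws = Z" "[] \<notin> set Ws"
    using alternating_blocks_exist by blast
  have mono: "M W = M' W" if "W \<in> set Ws" for W
  proof -
    have "monochrome clr W"
      using Ws(1) that by (fastforce simp: alternating_blocks_def list_all2_conv_all_nth in_set_conv_nth monochrome_def)
    thus ?thesis by (rule eq)
  qed
  show ?case
  proof (cases "Ws = []")
    case True
    thus ?thesis using Ws(2) eq[of "[]"] by (simp add: monochrome_def)
  next
    case False
    have "M Z - M' Z = centered M M [] Ws [] - centered M' M' [] Ws []"
      using centered_diff[of "length Z" M M' "[]" Ws] 1 Ws(2,3) mono by simp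
    thus ?thesis using M[OF False Ws(1)] M'[OF False Ws(1)] by simp
  qed
qed

text \<open>The functional with the mixed cumulants deleted has vanishing alternating centred
  products by \<open>centered_noncrossing_sum\<close>, and it has the given moments on monochrome
  words. Uniqueness identifies it with \<open>M\<close>.\<close>

theorem mixed_cumulants_vanish:
  assumes M0: "M [] = 1"
    and M: "\<And>cs Ws. Ws \<noteq> [] \<Longrightarrow> alternating_blocks clr cs Ws \<Longrightarrow> centered M M [] Ws [] = 0"
  shows "M Z = noncrossing_sum (\<lambda>xs. if monochrome clr xs then free_cumulant M xs else 0) Z"
proof (rule centered_determines_moments[OF M])
  let ?k = "\<lambda>xs. if monochrome clr xs then free_cumulant M xs else 0"
  show "centered (noncrossing_sum ?k) (noncrossing_sum ?k) [] Ws [] = 0"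
    if "Ws \<noteq> []" "alternating_blocks clr cs Ws" for cs Ws
    by (rule centered_noncrossing_sum[OF _ that]) simp
  fix W :: "'a list" assume W: "monochrome clr W"
  have "M W = noncrossing_sum (free_cumulant M) W" by (rule moment_eq_noncrossing_sum[of M, OF M0])
  also have "\<dots> = noncrossing_sum ?k W"
    using W by (intro noncrossing_sum_cong) (auto simp: monochrome_def)
  finally show "M W = noncrossing_sum ?k W" .
qed

text \<open>If every block contributes the same constant, the prescribed part \<open>ys\<close>
  counts like a single letter, so both sums obey \<open>mp_moment_rec\<close>.\<close>

lemma noncrossing_sum_const:
  assumes "0 < c"
  shows "noncrossing_sum (\<lambda>_. complex_of_real c) xs = of_real (mp_moment c (length xs))"
    and "ys \<noteq> [] \<Longrightarrow> noncrossing_sum_from (\<lambda>_. complex_of_real c) ys xs = of_real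
        (mp_moment c (Suc (length xs)))"
proof -
  let ?k = "\<lambda>_::'a list. complex_of_real c"
  have "noncrossing_sum ?k xs = of_real (mp_moment c (length xs)) \<and>
    (\<forall>ys. ys \<noteq> [] \<longrightarrow> noncrossing_sum_from ?k ys xs = of_real (mp_moment c (Suc (length xs))))"
  proof (induction xs rule: length_induct)
    case (1 xs)
    have nc: "noncrossing_sum ?k xs = of_real (mp_moment c (length xs))"
    proof (cases xs)
      case Nil thus ?thesis by (simp add: mp_moment_def)
    next
      case (Cons x xs') thus ?thesis using 1 by (simp add: noncrossing_sum_Cons)
    qed
    moreover have "noncrossing_sum_from ?k ys xs = of_real (mp_moment c (Suc (length xs)))" if
        "ys \<noteq> []" for ys
    proof -
      have "noncrossing_sum_from ?k ys xs = complex_of_real c * of_real (mp_moment c (length xs)) +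
        (\<Sum>m<length xs. of_real (mp_moment c m) * of_real (mp_moment c (length xs - m)))"
        unfolding noncrossing_sum_from_rec[OF that, of ?k xs] nc
      proof (intro arg_cong2[of _ _ _ _ "(+)"] sum.cong refl arg_cong2[of _ _ _ _ "(*)"])
        fix m assume "m \<in> {..<length xs}"
        hence m: "m < length xs" by simp
        show "noncrossing_sum ?k (take m xs) = of_real (mp_moment c m)"
          using 1[rule_format, of "take m xs"] m by simp
        show "noncrossing_sum_from ?k (ys @ [xs ! m]) (drop (Suc m) xs) = of_real
            (mp_moment c (length xs - m))"
          using 1[rule_format, of "drop (Suc m) xs"] m by (simp add: Suc_diff_Suc)
      qed
      also have "\<dots> = of_real (mp_moment c (Suc (length xs)))"
        unfolding mp_moment_rec[OF assms] by simp
      finally show ?thesis .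
    qed
    ultimately show ?case by blast
  qed
  thus "noncrossing_sum ?k xs = of_real (mp_moment c (length xs))"
    "ys \<noteq> [] \<Longrightarrow> noncrossing_sum_from ?k ys xs = of_real (mp_moment c (Suc (length xs)))" by auto
qed

text \<open>Cumulants of matrices can thus be computed on words of indices.\<close>

lemma free_cumulant_map: "free_cumulant M (map h xs) = free_cumulant (\<lambda>ys. M (map h ys)) xs"
proof (induction xs rule: length_induct)
  case (1 xs)
  show ?case
    unfolding free_cumulant.simps[of M "map h xs"] free_cumulant.simps[of "\<lambda>ys. M (map h ys)"
        xs] length_map
    by (intro arg_cong2[of _ _ _ _ "(-)"] sum.cong prod.cong refl)
       (use 1 in \<open>auto simp: nths_map intro: nths_proper_block_less\<close>)
qed

subsection \<open>Matrices over a star-algebra\<close>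

lemma scaleC_zero_left [simp]: "scaleC 0 (x :: 'a :: complex_star_algebra) = 0"
  using scaleC_add_left[of 0 0 x] by simp

lemma scaleC_zero_right [simp]: "scaleC z (0 :: 'a :: complex_star_algebra) = 0"
  using scaleC_add_right[of z 0 0] by simp

lemma star_zero [simp]: "star (0 :: 'a :: complex_star_algebra) = 0"
  using star_add[of 0 0] by simp

lemma star_one [simp]: "star (1 :: 'a :: complex_star_algebra) = 1"
  by (metis mult_1_left mult_1_right star_mult star_star)

lemma star_sum: "star (\<Sum>i\<in>A. f i) = (\<Sum>i\<in>A. star (f i :: 'a :: complex_star_algebra))"
  by (induction A rule: infinite_finite_induct) (simp_all add: star_add)

lemma scaleC_sum: "scaleC z (\<Sum>i\<in>A. f i) = (\<Sum>i\<in>A. scaleC z (f i :: 'a :: complex_star_algebra))"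
  by (induction A rule: infinite_finite_induct) (simp_all add: scaleC_add_right)

lemma mult_mat_entry:
  assumes "A \<in> carrier_mat d d" "B \<in> carrier_mat d d" "i < d" "j < d"
  shows "(A * B) $$ (i, j) = (\<Sum>k<d. A $$ (i, k) * B $$ (k, j))"
  using assms by (simp add: scalar_prod_def lessThan_atLeast0)

lemma mat_scaleC_carrier [simp]: "A \<in> carrier_mat m n \<Longrightarrow> mat_scaleC z A \<in> carrier_mat m n"
  by (simp add: mat_scaleC_def)

lemma mat_star_carrier [simp]: "A \<in> carrier_mat m n \<Longrightarrow> mat_star A \<in> carrier_mat n m"
  by (simp add: mat_star_def)

lemma mat_scaleC_entry: "A \<in> carrier_mat m n \<Longrightarrow> i < m \<Longrightarrow> j < n \<Longrightarrow> mat_scaleC z A $$ (i, j) = scaleC z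
    (A $$ (i, j))"
  by (simp add: mat_scaleC_def)

lemma mat_star_entry: "A \<in> carrier_mat m n \<Longrightarrow> i < n \<Longrightarrow> j < m \<Longrightarrow> mat_star A $$ (i, j) = star (A $$ (j, i))"
  by (simp add: mat_star_def)

lemma mat_star_mult:
  assumes "A \<in> carrier_mat d d" "B \<in> carrier_mat d d"
  shows "mat_star (A * B) = mat_star B * mat_star A"
proof (rule eq_matI)
  fix i j assume "i < dim_row (mat_star B * mat_star A)" "j < dim_col (mat_star B * mat_star A)"
  hence ij: "i < d" "j < d" using assms mat_star_carrier[OF assms(1)] mat_star_carrier[OF assms(2)] by auto
  have "mat_star (A * B) $$ (i, j) = star ((A * B) $$ (j, i))"
    using assms ij by (intro mat_star_entry[of _ d d]) auto
  also have "\<dots> = (\<Sum>k<d. star (B $$ (k, i)) * star (A $$ (j, k)))"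
    using assms ij by (simp only: mult_mat_entry[of A d B] star_sum star_mult)
  also have "\<dots> = (mat_star B * mat_star A) $$ (i, j)"
    using assms ij by (subst mult_mat_entry[of _ d])
        (auto intro!: sum.cong simp: mat_star_entry[of _ d d])
  finally show "mat_star (A * B) $$ (i, j) = (mat_star B * mat_star A) $$ (i, j)" .
qed (use assms in \<open>auto simp: mat_star_def\<close>)

lemma mat_star_add:
  "A \<in> carrier_mat d d \<Longrightarrow> B \<in> carrier_mat d d \<Longrightarrow> mat_star (A + B) = mat_star A + mat_star B"
  by (intro eq_matI) (auto simp: mat_star_def star_add)

lemma mat_star_scaleC: "mat_star (mat_scaleC z A) = mat_scaleC (cnj z) (mat_star A)"
  by (intro eq_matI) (auto simp: mat_star_def mat_scaleC_def star_scaleC)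

lemma mat_star_one: "mat_star (1\<^sub>m d) = 1\<^sub>m d"
  by (intro eq_matI) (auto simp: mat_star_def)

lemma mat_scaleC_mult_left:
  assumes "A \<in> carrier_mat d d" "B \<in> carrier_mat d d"
  shows "mat_scaleC z A * B = mat_scaleC z (A * B)"
proof (rule eq_matI)
  fix i j assume "i < dim_row (mat_scaleC z (A * B))" "j < dim_col (mat_scaleC z (A * B))"
  hence ij: "i < d" "j < d" using assms by (auto simp: mat_scaleC_def)
  show "(mat_scaleC z A * B) $$ (i, j) = mat_scaleC z (A * B) $$ (i, j)"
    using assms ij
    by (subst mult_mat_entry[of _ d]) (auto
        simp: mat_scaleC_entry[of _ d d] mult_mat_entry[of _ d] scaleC_sum mult_scaleC_left simp del: index_mult_mat)
qed (use assms in \<open>auto simp: mat_scaleC_def\<close>)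

lemma mat_scaleC_mult_right:
  assumes "A \<in> carrier_mat d d" "B \<in> carrier_mat d d"
  shows "A * mat_scaleC z B = mat_scaleC z (A * B)"
proof (rule eq_matI)
  fix i j assume "i < dim_row (mat_scaleC z (A * B))" "j < dim_col (mat_scaleC z (A * B))"
  hence ij: "i < d" "j < d" using assms by (auto simp: mat_scaleC_def)
  show "(A * mat_scaleC z B) $$ (i, j) = mat_scaleC z (A * B) $$ (i, j)"
    using assms ij
    by (subst mult_mat_entry[of _ d]) (auto
        simp: mat_scaleC_entry[of _ d d] mult_mat_entry[of _ d] scaleC_sum mult_scaleC_right simp del: index_mult_mat)
qed (use assms in \<open>auto simp: mat_scaleC_def\<close>)

definition mat_prod :: "nat \<Rightarrow> 'a::complex_star_algebra mat list \<Rightarrow> 'a mat" where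
  "mat_prod d As = foldr (*) As (1\<^sub>m d)"

lemma mat_prod_Nil [simp]: "mat_prod d [] = 1\<^sub>m d"
  and mat_prod_Cons [simp]: "mat_prod d (A # As) = A * mat_prod d As"
  by (simp_all add: mat_prod_def)

lemma mat_prod_carrier [simp]: "set As \<subseteq> carrier_mat d d \<Longrightarrow> mat_prod d As \<in> carrier_mat d d"
  by (induction As) auto

lemma mat_prod_append:
  "set As \<subseteq> carrier_mat d d \<Longrightarrow> set Bs \<subseteq> carrier_mat d d \<Longrightarrow> mat_prod d (As @ Bs) = mat_prod d As *
      mat_prod d Bs"
  by (induction As) (auto simp: assoc_mult_mat[of _ d d _ d _ d] left_mult_one_mat[of _ d d])

lemma mat_moment_conv: "mat_moment d \<tau> As = mat_state d \<tau> (mat_prod d As)"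
  by (simp add: mat_moment_def mat_prod_def)

section \<open>The state on matrices and centred products of words\<close>

locale star_prob_matrices =
  fixes d :: nat and \<tau> :: "'a::complex_star_algebra \<Rightarrow> complex"
  assumes d: "1 \<le> d" and \<tau>: "star_probability_space \<tau>"
begin

lemma \<tau>_add: "\<tau> (x + y) = \<tau> x + \<tau> y" and \<tau>_scaleC: "\<tau> (scaleC z x) = z * \<tau> x" and \<tau>_one: "\<tau> 1 = 1"
  using \<tau> by (auto simp: star_probability_space_def)

lemma \<tau>_zero [simp]: "\<tau> 0 = 0"
  using \<tau>_add[of 0 0] by simp

abbreviation "\<phi> \<equiv> mat_state d \<tau>"

lemma \<phi>_add: "A \<in> carrier_mat d d \<Longrightarrow> B \<in> carrier_mat d d \<Longrightarrow> \<phi> (A + B) = \<phi> A + \<phi> B"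
  by (simp add: mat_state_def \<tau>_add sum.distrib add_divide_distrib)

lemma \<phi>_scaleC: "A \<in> carrier_mat d d \<Longrightarrow> \<phi> (mat_scaleC z A) = z * \<phi> A"
  by (simp add: mat_state_def mat_scaleC_entry[of _ d d] \<tau>_scaleC sum_distrib_left)

lemma \<phi>_one: "\<phi> (1\<^sub>m d) = 1"
  using d by (simp add: mat_state_def \<tau>_one)

lemma mat_moment_Nil [simp]: "mat_moment d \<tau> [] = 1"
  by (simp add: mat_moment_conv \<phi>_one)

lemma mat_moment_single: "A \<in> carrier_mat d d \<Longrightarrow> mat_moment d \<tau> [A] = \<phi> A"
  by (simp add: mat_moment_conv)

lemma \<phi>_single_entry:
  assumes "A = Matrix.mat d d (\<lambda>(x, y). if x = a \<and> y = b then z else 0)" "a < d" "b < d"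
  shows "\<phi> A = (if a = b then 1 / of_nat d * \<tau> z else 0)"
proof -
  have "(\<Sum>i<d. \<tau> (A $$ (i, i))) = (\<Sum>i<d. if i = a then (if a = b then \<tau> z else 0) else 0)"
    using assms by (intro sum.cong) auto
  thus ?thesis using assms(2) by (simp add: mat_state_def)
qed

text \<open>The matrix that realizes one factor of \<open>centered\<close>.\<close>

definition centre :: "('x \<Rightarrow> 'a mat) \<Rightarrow> 'x list \<Rightarrow> 'a mat" where
  "centre e W = mat_prod d (map e W) + mat_scaleC (- mat_moment d \<tau> (map e W)) (1\<^sub>m d)"

context
  fixes e :: "'x \<Rightarrow> 'a mat"
  assumes e: "\<And>x. e x \<in> carrier_mat d d"
begin

lemma word_carrier [simp]: "mat_prod d (map e W) \<in> carrier_mat d d"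
  using e by (intro mat_prod_carrier) auto

lemma centre_carrier [simp]: "centre e W \<in> carrier_mat d d"
  by (simp add: centre_def)

lemma centres_carrier [simp]: "mat_prod d (map (centre e) Ws) \<in> carrier_mat d d"
  by (intro mat_prod_carrier) auto

lemma moment_centre: "mat_moment d \<tau> [centre e W] = 0"
  by (simp add: mat_moment_single centre_def \<phi>_add \<phi>_scaleC \<phi>_one mat_moment_conv[of d \<tau> "map e W"])

lemma centered_eq_moment:
  fixes M :: "'x list \<Rightarrow> complex"
  defines "M \<equiv> \<lambda>W. mat_moment d \<tau> (map e W)"
  shows "centered M M U Ws [] = \<phi> (mat_prod d (map e U) * mat_prod d (map (centre e) Ws))"
proof (induction Ws arbitrary: U)
  case Nil
  show ?case by (simp add: M_def mat_moment_conv right_mult_one_mat[of _ d d])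
next
  case (Cons W Ws)
  let ?U = "mat_prod d (map e U)" and ?W = "mat_prod d (map e W)" and ?R =
      "mat_prod d (map (centre e) Ws)"
  have "?U * (centre e W * ?R) = ?U * (?W * ?R) + ?U * (mat_scaleC (- M W) (1\<^sub>m d) * ?R)"
  proof -
    have "centre e W * ?R = ?W * ?R + mat_scaleC (- M W) (1\<^sub>m d) * ?R"
      unfolding centre_def[of e W] M_def by (rule add_mult_distrib_mat[of _ d d _ _ d]) auto
    thus ?thesis
      by (auto intro!: mult_add_distrib_mat[of _ d d _ d] mult_carrier_mat[of _ d d _ d])
  qed
  also have "?U * (?W * ?R) = ?U * ?W * ?R" by (rule assoc_mult_mat[of _ d d _ d _ d, symmetric]) auto
  also have "?U * ?W = mat_prod d (map e (U @ W))"
    using e by (simp add: mat_prod_append image_subset_iff)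
  also have "mat_scaleC (- M W) (1\<^sub>m d) * ?R = mat_scaleC (- M W) ?R"
    by (subst mat_scaleC_mult_left[of _ d]) (auto simp: left_mult_one_mat[of _ d d])
  also have "?U * mat_scaleC (- M W) ?R = mat_scaleC (- M W) (?U * ?R)"
    by (rule mat_scaleC_mult_right[of _ d]) auto
  finally have eq: "?U * (centre e W * ?R) = mat_prod d (map e (U @ W)) * ?R + mat_scaleC (- M W)
      (?U * ?R)" .
  have c1: "mat_prod d (map e (U @ W)) * ?R \<in> carrier_mat d d" and c2: "?U * ?R \<in> carrier_mat d d"
    by (intro mult_carrier_mat[of _ d d] word_carrier centres_carrier)+
  have "\<phi> (?U * (centre e W * ?R)) = \<phi> (mat_prod d (map e (U @ W)) * ?R) - M W * \<phi> (?U * ?R)"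
    unfolding eq \<phi>_add[OF c1 mat_scaleC_carrier[OF c2]] \<phi>_scaleC[OF c2] by simp
  thus ?case by (simp add: Cons.IH)
qed

end

end


lemma mat_prod_in_generated_star_algebra:
  "set As \<subseteq> generated_star_algebra d S \<Longrightarrow> mat_prod d As \<in> generated_star_algebra d S"
  by (induction As) (auto intro: generated_star_algebra.intros)

lemma scaleC_of_prod: "scaleC a 1 * scaleC b 1 = scaleC (a * b) (1 :: 'a :: complex_star_algebra)"
  by (simp add: mult_scaleC_left scaleC_scaleC)

lemma scaleC_sum_left: "scaleC (\<Sum>i\<in>A. f i) (x :: 'a :: complex_star_algebra) = (\<Sum>i\<in>A. scaleC (f i) x)"
  by (induction A rule: infinite_finite_induct) (simp_all add: scaleC_add_left)

lemma scalar_matrices_mult: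
  assumes "A \<in> scalar_matrices d" "B \<in> scalar_matrices d"
  shows "A * B \<in> (scalar_matrices d :: 'a::complex_star_algebra mat set)"
proof -
  let ?h = "map_mat (\<lambda>z. scaleC z (1 :: 'a))"
  obtain A' B' where AB: "A = ?h A'" "B = ?h B'" "A' \<in> carrier_mat d d" "B' \<in> carrier_mat d d"
    using assms by (auto simp: scalar_matrices_def)
  have "A * B = ?h (A' * B')"
  proof (rule eq_matI)
    fix i j assume "i < dim_row (?h (A' * B'))" "j < dim_col (?h (A' * B'))"
    hence ij: "i < d" "j < d" using AB by auto
    have "(A * B) $$ (i, j) = (\<Sum>k<d. scaleC (A' $$ (i, k) * B' $$ (k, j)) 1)"
      using AB ij by (subst mult_mat_entry[of _ d]) (auto intro!: sum.cong simp: scaleC_of_prod)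
    also have "\<dots> = scaleC ((A' * B') $$ (i, j)) 1"
      using AB ij by (simp only: mult_mat_entry[of A' d B'] scaleC_sum_left)
    also have "\<dots> = ?h (A' * B') $$ (i, j)" using AB ij by simp
    finally show "(A * B) $$ (i, j) = ?h (A' * B') $$ (i, j)" .
  qed (use AB in auto)
  moreover have "A' * B' \<in> carrier_mat d d" using AB by auto
  ultimately show ?thesis by (auto simp: scalar_matrices_def)
qed

lemma scalar_matrices_add:
  assumes "A \<in> scalar_matrices d" "B \<in> scalar_matrices d"
  shows "A + B \<in> (scalar_matrices d :: 'a::complex_star_algebra mat set)"
proof -
  let ?h = "map_mat (\<lambda>z. scaleC z (1 :: 'a))"
  obtain A' B' where AB: "A = ?h A'" "B = ?h B'" "A' \<in> carrier_mat d d" "B' \<in> carrier_mat d d"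
    using assms by (auto simp: scalar_matrices_def)
  have "A + B = ?h (A' + B')" using AB by (intro eq_matI) (auto simp: scaleC_add_left)
  moreover have "A' + B' \<in> carrier_mat d d" using AB by auto
  ultimately show ?thesis by (auto simp: scalar_matrices_def)
qed

lemma scalar_matrices_one: "1\<^sub>m d \<in> (scalar_matrices d :: 'a::complex_star_algebra mat set)"
proof -
  have "1\<^sub>m d = map_mat (\<lambda>z. scaleC z (1 :: 'a)) (1\<^sub>m d)" by (intro eq_matI) (auto simp: scaleC_one)
  thus ?thesis unfolding scalar_matrices_def by (intro image_eqI) auto
qed

lemma scalar_matrices_scaleC:
  assumes "A \<in> scalar_matrices d"
  shows "mat_scaleC z A \<in> (scalar_matrices d :: 'a::complex_star_algebra mat set)"
proof -
  let ?h = "map_mat (\<lambda>z. scaleC z (1 :: 'a))"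
  obtain A' where A: "A = ?h A'" "A' \<in> carrier_mat d d" using assms by (auto simp: scalar_matrices_def)
  have "mat_scaleC z A = ?h (map_mat ((*) z) A')"
    using A by (intro eq_matI) (auto simp: mat_scaleC_def scaleC_scaleC)
  thus ?thesis using A by (auto simp: scalar_matrices_def)
qed

lemma scalar_matrices_unit: "mat_unit d i j \<in> (scalar_matrices d :: 'a::complex_star_algebra mat set)"
proof -
  have "mat_unit d i j = map_mat (\<lambda>z. scaleC z (1 :: 'a))
      (Matrix.mat d d (\<lambda>(a, b). if a = i \<and> b = j then 1 else 0))"
    unfolding mat_unit_def by (intro eq_matI) (auto simp: scaleC_one)
  thus ?thesis unfolding scalar_matrices_def by (intro image_eqI) auto
qed

lemma mat_prod_in_scalar_matrices:
  "set As \<subseteq> scalar_matrices d \<Longrightarrow> mat_prod d As \<in> scalar_matrices d"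
  by (induction As) (auto intro: scalar_matrices_one scalar_matrices_mult)

lemma mat_unit_carrier [simp]: "mat_unit d i j \<in> carrier_mat d d"
  by (simp add: mat_unit_def)

subsection \<open>The moments of the entries\<close>

text \<open>
  For \<open>ps = [(i\<^sub>1, j\<^sub>1), \<dots>, (i\<^sub>n, j\<^sub>n)]\<close>, this is the word \<open>E a i\<^sub>1 X E j\<^sub>1 i\<^sub>2 X \<dots> X E j\<^sub>n b\<close>:
  between the matrix units, \<open>X\<close> contributes exactly the entries \<open>(i\<^sub>k, j\<^sub>k)\<close>, and the piece
  between two occurrences of \<open>X\<close> is again of this form.
\<close>

primrec gap :: "nat \<Rightarrow> nat \<Rightarrow> (nat \<times> nat) list \<Rightarrow> letter list" where
  "gap a b [] = [E a b]"
| "gap a b (p # ps) = E a (fst p) # X # gap (snd p) b ps"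

lemma length_gap [simp]: "length (gap a b ps) = Suc (2 * length ps)"
  by (induction ps arbitrary: a) auto

lemma gap_nth_even: "k \<le> length ps \<Longrightarrow> gap a b ps ! (2 * k) \<noteq> X"
proof (induction ps arbitrary: a k)
  case (Cons p ps) thus ?case by (cases k) auto
qed simp

lemma gap_nth_odd:
  assumes "k < length ps"
  shows "gap a b ps ! Suc (2 * k) = X"
    and "take (Suc (2 * k)) (gap a b ps) = gap a (fst (ps ! k)) (take k ps)"
    and "drop (Suc (Suc (2 * k))) (gap a b ps) = gap (snd (ps ! k)) b (drop (Suc k) ps)"
proof -
  have "gap a b ps ! Suc (2 * k) = X \<and> take (Suc (2 * k)) (gap a b ps) = gap a (fst (ps ! k))
      (take k ps) \<and>
    drop (Suc (Suc (2 * k))) (gap a b ps) = gap (snd (ps ! k)) b (drop (Suc k) ps)"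
    using assms
  proof (induction ps arbitrary: a k)
    case (Cons p ps)
    show ?case
    proof (cases k)
      case 0 thus ?thesis by (cases ps) auto
    next
      case (Suc l) thus ?thesis using Cons.IH[of l "snd p"] Cons.prems by simp
    qed
  qed simp
  thus "gap a b ps ! Suc (2 * k) = X" "take (Suc (2 * k)) (gap a b ps) = gap a (fst (ps ! k))
      (take k ps)"
    "drop (Suc (Suc (2 * k))) (gap a b ps) = gap (snd (ps ! k)) b (drop (Suc k) ps)" by auto
qed

lemma sum_odd_only:
  fixes h :: "nat \<Rightarrow> complex"
  assumes "\<And>k. k \<le> n \<Longrightarrow> h (2 * k) = 0"
  shows "(\<Sum>m<Suc (2 * n). h m) = (\<Sum>k<n. h (Suc (2 * k)))"
  using assms
proof (induction n)
  case (Suc n)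
  have "h (2 * Suc n) = 0" using Suc.prems by blast
  thus ?case using Suc by simp
qed simp

section \<open>Freeness from the scalar matrices, expressed by words in \<open>X\<close> and the
  matrix units\<close>

locale free_marchenko_pastur = star_prob_matrices +
  fixes c :: real and u :: "nat \<Rightarrow> nat \<Rightarrow> 'a" and w :: "'a mat"
  assumes c: "0 < c"
    and w: "w = mat_scaleC (1 / of_nat d) (Matrix.mat d d (\<lambda>(i, j). u i j))"
    and law: "\<And>n. mat_moment d \<tau> (replicate n w) = of_real (mp_moment c n)"
    and free: "free_family (mat_moment d \<tau>) UNIV
        (\<lambda>b. if b then generated_star_algebra d {w} else scalar_matrices d)"
begin

abbreviation "evl \<equiv> eval_letter w (mat_unit d)"

definition letter_moment :: "letter list \<Rightarrow> complex" where
  "letter_moment ls = mat_moment d \<tau> (map evl ls)"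

lemma w_carrier [simp]: "w \<in> carrier_mat d d"
  by (simp add: w)

lemma evl_carrier [simp]: "evl l \<in> carrier_mat d d"
  by (cases l) auto

lemma centre_in_algebra:
  assumes "\<forall>l\<in>set W. (l = X) = b"
  shows "centre evl W \<in> (if b then generated_star_algebra d {w} else scalar_matrices d)"
proof (cases b)
  case True
  hence "evl l = w" if "l \<in> set W" for l using assms that by auto
  hence "set (map evl W) \<subseteq> generated_star_algebra d {w}"
    by (auto intro: generated_star_algebra.base)
  hence "centre evl W \<in> generated_star_algebra d {w}"
    unfolding centre_def by (intro generated_star_algebra.add generated_star_algebra.scale
      generated_star_algebra.one mat_prod_in_generated_star_algebra)
  thus ?thesis using True by simp
next
  case False
  have "evl l \<in> scalar_matrices d" if "l \<in> set W" for l
    using assms False that by (cases l) (auto simp: scalar_matrices_unit)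
  hence "set (map evl W) \<subseteq> scalar_matrices d" by auto
  hence "centre evl W \<in> scalar_matrices d"
    unfolding centre_def by (intro scalar_matrices_add scalar_matrices_scaleC scalar_matrices_one mat_prod_in_scalar_matrices)
  thus ?thesis using False by simp
qed

text \<open>The colour of a letter tells which of the two free algebras contains its value, so an
  alternating product of centred words is one to which freeness applies.\<close>

lemma letter_moment_centered:
  assumes "Ws \<noteq> []" "alternating_blocks (\<lambda>l. l = X) cs Ws"
  shows "centered letter_moment letter_moment [] Ws [] = 0"
proof -
  let ?xs = "zip cs (map (centre evl) Ws)"
  have cs: "distinct_adj cs" "list_all2 (\<lambda>c W. \<forall>l\<in>set W. (l = X) = c) cs Ws"
    using assms(2) by (auto simp: alternating_blocks_def)
  have len: "length cs = length Ws" using cs(2) by (rule list_all2_lengthD)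
  have "mat_moment d \<tau> (map snd ?xs) = 0"
  proof (rule free[unfolded free_family_def, rule_format], intro conjI)
    show "?xs \<noteq> []" "distinct_adj (map fst ?xs)" using assms(1) cs len by auto
    show "\<forall>(i, x)\<in>set ?xs. i \<in> UNIV \<and> x \<in>
        (if i then generated_star_algebra d {w} else scalar_matrices d) \<and> mat_moment d \<tau> [x] = 0"
    proof (clarify, intro conjI UNIV_I)
      fix i x assume "(i, x) \<in> set ?xs"
      then obtain W where W: "x = centre evl W" "(i, W) \<in> set (zip cs Ws)"
        by (auto simp: zip_map2)
      hence "\<forall>l\<in>set W. (l = X) = i" using cs(2) by (auto simp: list_all2_iff)
      thus "x \<in> (if i then generated_star_algebra d {w} else scalar_matrices d)"
        unfolding W(1) by (rule centre_in_algebra)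
      show "mat_moment d \<tau> [x] = 0" unfolding W(1) by (rule moment_centre) simp
    qed
  qed
  thus ?thesis
    using centered_eq_moment[of evl "[]" Ws] len
    by (simp add: letter_moment_def[abs_def] mat_moment_conv left_mult_one_mat[of _ d d])
qed

definition letter_cumulant :: "letter list \<Rightarrow> complex" where
  "letter_cumulant ls = (if monochrome (\<lambda>l. l = X) ls then free_cumulant letter_moment ls else 0)"

lemma letter_moment_eq: "letter_moment ls = noncrossing_sum letter_cumulant ls"
  unfolding letter_cumulant_def[abs_def]
  by (rule mixed_cumulants_vanish[OF _ letter_moment_centered]) (simp_all add: letter_moment_def)

lemma letter_cumulant_X: "0 < r \<Longrightarrow> letter_cumulant (replicate r X) = of_real c"
proof -
  assume r: "0 < r"
  have "free_cumulant letter_moment (replicate r X) = of_real c"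
  proof (rule free_cumulant_eqI[where L = "{X}" and f = "\<lambda>_. of_real c"])
    fix xs assume "set xs \<subseteq> {X}"
    hence "xs = replicate (length xs) X" by (metis replicate_length_same singletonD subsetD)
    hence "letter_moment xs = of_real (mp_moment c (length xs))"
      unfolding letter_moment_def by (metis eval_letter.simps(1) law length_replicate map_replicate)
    thus "letter_moment xs = noncrossing_sum (\<lambda>_. of_real c) xs"
      by (simp add: noncrossing_sum_const(1)[OF c])
  qed (use r in auto)
  thus ?thesis using r by (simp add: letter_cumulant_def monochrome_def)
qed

definition entry_moment :: "(nat \<times> nat) list \<Rightarrow> complex" where
  "entry_moment ps = \<tau> (foldr (\<lambda>(i, j) a. u i j * a) ps 1)"

definition entry_cumulant :: "(nat \<times> nat) list \<Rightarrow> complex" where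
  "entry_cumulant ps = (if successively (\<lambda>p q. snd p = fst q) ps \<and> snd (last ps) = fst (hd ps)
     then of_real (c * d) else 0)"

lemma evl_gap:
  assumes "a < d" "b < d" "\<forall>(i, j)\<in>set ps. i < d \<and> j < d"
  shows "mat_prod d (map evl (gap a b ps)) = Matrix.mat d d (\<lambda>(x, y). if x = a \<and> y = b
    then scaleC ((1 / of_nat d) ^ length ps) (foldr (\<lambda>(i, j) a. u i j * a) ps 1) else 0)"
  using assms(1,3)
proof (induction ps arbitrary: a)
  case Nil
  thus ?case
    by (simp add: mat_unit_def right_mult_one_mat[of _ d d]) (auto intro!: eq_matI simp: scaleC_one)
next
  case (Cons p ps)
  obtain i j where p: "p = (i, j)" by (cases p)
  have ij: "i < d" "j < d" using Cons.prems p by auto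
  let ?z = "scaleC ((1 / of_nat d) ^ length ps) (foldr (\<lambda>(i, j) a. u i j * a) ps 1)"
  let ?G = "Matrix.mat d d (\<lambda>(x, y). if x = j \<and> y = b then ?z else 0)"
  have G: "mat_prod d (map evl (gap j b ps)) = ?G" using Cons ij by simp
  have wG: "(w * ?G) $$ (x, y) = (if y = b then w $$ (x, j) * ?z else 0)" if "x < d" "y < d" for x y
  proof -
    have "(w * ?G) $$ (x, y) = (\<Sum>k<d. w $$ (x, k) * ?G $$ (k, y))"
      using that by (intro mult_mat_entry) auto
    also have "\<dots> = (\<Sum>k<d. if k = j then (if y = b then w $$ (x, j) * ?z else 0) else 0)"
      using that by (intro sum.cong) auto
    finally have "(w * ?G) $$ (x, y) = (\<Sum>k<d. if k = j then
        (if y = b then w $$ (x, j) * ?z else 0) else 0)" .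
    thus ?thesis using ij by simp
  qed
  have "(mat_unit d a i * (w * ?G)) $$ (x, y) = (if x = a \<and> y = b then w $$ (i, j) * ?z else 0)"
    if "x < d" "y < d" for x y
  proof -
    have "(mat_unit d a i * (w * ?G)) $$ (x, y) = (\<Sum>k<d. mat_unit d a i $$ (x, k) * (w * ?G) $$ (k, y))"
      using that by (intro mult_mat_entry mult_carrier_mat[of _ d d _ d]) auto
    also have "\<dots> = (\<Sum>k<d. if k = i then (if x = a \<and> y = b then w $$ (i, j) * ?z else 0) else 0)"
    proof (intro sum.cong refl)
      fix k assume "k \<in> {..<d}"
      hence k: "k < d" by simp
      show "mat_unit d a i $$ (x, k) * (w * ?G) $$ (k, y) =
          (if k = i then (if x = a \<and> y = b then w $$ (i, j) * ?z else 0) else 0)"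
        unfolding wG[OF k that(2)] using that k by (simp add: mat_unit_def)
    qed
    finally have "(mat_unit d a i * (w * ?G)) $$ (x, y) =
      (\<Sum>k<d. if k = i then (if x = a \<and> y = b then w $$ (i, j) * ?z else 0) else 0)" .
    thus ?thesis using ij by simp
  qed
  moreover have "w $$ (i, j) * ?z = scaleC ((1 / of_nat d) ^ length (p # ps))
      (foldr (\<lambda>(i, j) a. u i j * a) (p # ps) 1)"
    using ij by (simp add: w mat_scaleC_def p mult_scaleC_left mult_scaleC_right scaleC_scaleC mult.commute)
  moreover have "mat_prod d (map evl (gap a b (p # ps))) = mat_unit d a i * (w * ?G)" by (simp add: p G)
  moreover have "mat_unit d a i * (w * ?G) \<in> carrier_mat d d"
    by (intro mult_carrier_mat[of _ d d]) auto
  ultimately show ?case by (intro eq_matI) (auto simp del: index_mult_mat)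
qed

lemma letter_moment_gap:
  assumes "a < d" "b < d" "\<forall>(i, j)\<in>set ps. i < d \<and> j < d"
  shows "letter_moment (gap a b ps) = (if a = b then (1 / of_nat d) ^ Suc (length ps) *
      entry_moment ps else 0)"
  unfolding letter_moment_def mat_moment_conv entry_moment_def
  by (subst \<phi>_single_entry[OF evl_gap[OF assms] assms(1,2)]) (simp add: \<tau>_scaleC)

text \<open>The trace closes the cycle, so the leading \<open>X\<close> contributes the entry
  \<open>(b, j)\<close>. There is one factor \<open>1 / d\<close> for each \<open>X\<close> and one
  for the normalized trace.\<close>

lemma letter_moment_X_gap:
  assumes "j < d" "b < d" "\<forall>(i, j)\<in>set ps. i < d \<and> j < d"
  shows "letter_moment (X # gap j b ps) = (1 / of_nat d) ^ (length ps + 2) * entry_moment ((b, j) # ps)"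
proof -
  let ?z = "scaleC ((1 / of_nat d) ^ length ps) (foldr (\<lambda>(i, j) a. u i j * a) ps 1)"
  let ?G = "Matrix.mat d d (\<lambda>(x, y). if x = j \<and> y = b then ?z else 0)"
  have "(w * ?G) $$ (x, x) = (if x = b then w $$ (b, j) * ?z else 0)" if "x < d" for x
  proof -
    have "(w * ?G) $$ (x, x) = (\<Sum>k<d. w $$ (x, k) * ?G $$ (k, x))"
      using that by (intro mult_mat_entry) auto
    also have "\<dots> = (\<Sum>k<d. if k = j then (if x = b then w $$ (b, j) * ?z else 0) else 0)"
      using that by (intro sum.cong) auto
    finally have "(w * ?G) $$ (x, x) = (\<Sum>k<d. if k = j then
        (if x = b then w $$ (b, j) * ?z else 0) else 0)" .
    thus ?thesis using assms by simp
  qed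
  hence "\<phi> (w * ?G) = 1 / of_nat d * \<tau> (w $$ (b, j) * ?z)"
    using assms(2) by (simp add: mat_state_def if_distrib[of \<tau>] del: index_mult_mat cong: if_cong)
  also have "w $$ (b, j) * ?z = scaleC ((1 / of_nat d) ^ Suc (length ps))
      (foldr (\<lambda>(i, j) a. u i j * a) ((b, j) # ps) 1)"
    using assms by (simp add: w mat_scaleC_def mult_scaleC_left mult_scaleC_right scaleC_scaleC mult.commute)
  finally show ?thesis
    by (simp add: letter_moment_def mat_moment_conv evl_gap[OF assms] \<tau>_scaleC entry_moment_def)
qed

text \<open>
  A block of \<open>r\<close> letters \<open>X\<close> contributes \<open>c\<close>, and each of the \<open>r\<close> gaps contributes the normalized
  trace of a matrix unit, i.e. a factor \<open>1 / d\<close> and a Kronecker symbol; together with the factor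
  \<open>1 / d\<close> per letter in \<open>w\<close>, all powers of \<open>d\<close> but one cancel. This is why the entries have the
  cumulants \<open>c d\<close>.
\<close>

lemma noncrossing_sum_gap:
  assumes "\<forall>(i, j)\<in>set ps. i < d \<and> j < d"
  shows "entry_moment ps = noncrossing_sum entry_cumulant ps"
    and "\<And>ys. ys \<noteq> [] \<Longrightarrow> \<forall>(i, j)\<in>set ys. i < d \<and> j < d \<Longrightarrow> successively (\<lambda>p q. snd p = fst q) ys \<Longrightarrow>
      noncrossing_sum_from letter_cumulant (replicate (length ys) X)
          (gap (snd (last ys)) (fst (hd ys)) ps) =
      (1 / of_nat d) ^ (length ps + 2) * noncrossing_sum_from entry_cumulant ys ps"
proof -
  define D where "D = 1 / complex_of_nat d"
  have D0: "D \<noteq> 0" and Dd: "D * of_nat d = 1" using d by (simp_all add: D_def)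
  let ?ok = "\<lambda>ps. \<forall>(i, j)\<in>set ps. i < d \<and> j < d" and ?lk =
      "successively (\<lambda>p q :: nat \<times> nat. snd p = fst q)"
  have "entry_moment ps = noncrossing_sum entry_cumulant ps \<and>
    (\<forall>ys. ys \<noteq> [] \<and> ?ok ys \<and> ?lk ys \<longrightarrow>
      noncrossing_sum_from letter_cumulant (replicate (length ys) X)
          (gap (snd (last ys)) (fst (hd ys)) ps) =
      D ^ (length ps + 2) * noncrossing_sum_from entry_cumulant ys ps)"
    using assms
  proof (induction ps rule: length_induct)
    case (1 ps)
    have IH1: "entry_moment qs = noncrossing_sum entry_cumulant qs" if "length qs < length ps"
        "?ok qs" for qs
      using 1(1) that by blast
    have IH2: "noncrossing_sum_from letter_cumulant (replicate (length ys) X)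
        (gap (snd (last ys)) (fst (hd ys)) qs) =
      D ^ (length qs + 2) * noncrossing_sum_from entry_cumulant ys qs"
      if "length qs < length ps" "?ok qs" "ys \<noteq> []" "?ok ys" "?lk ys" for qs ys
      using 1(1) that by blast
    have em: "entry_moment ps = noncrossing_sum entry_cumulant ps"
    proof (cases ps)
      case Nil thus ?thesis by (simp add: entry_moment_def \<tau>_one)
    next
      case (Cons p qs)
      obtain b j where p: "p = (b, j)" by (cases p)
      have ok: "?ok qs" "b < d" "j < d" using 1(2) Cons p by auto
      have "D ^ (length qs + 2) * entry_moment ps = letter_moment (X # gap j b qs)"
        using letter_moment_X_gap[OF ok(3,2,1)] by (simp add: Cons p D_def)
      also have "\<dots> = D ^ (length qs + 2) * noncrossing_sum_from entry_cumulant [p] qs"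
        using IH2[of qs "[p]"] ok Cons by (simp add: letter_moment_eq noncrossing_sum_Cons p)
      finally show ?thesis using D0 by (simp add: Cons noncrossing_sum_Cons)
    qed
    have "noncrossing_sum_from letter_cumulant (replicate (length ys) X)
        (gap (snd (last ys)) (fst (hd ys)) ps) =
      D ^ (length ps + 2) * noncrossing_sum_from entry_cumulant ys ps"
      if ys: "ys \<noteq> []" "?ok ys" "?lk ys" for ys
    proof -
      define j b r n where "j = snd (last ys)" and "b = fst (hd ys)" and "r = length ys" and
          "n = length ps"
      have jb: "j < d" "b < d" using ys(1,2) last_in_set[of ys] hd_in_set[of ys] by
          (auto simp: j_def b_def case_prod_beta)
      have r: "r > 0" using ys by (simp add: r_def)
      let ?F = "\<lambda>m. noncrossing_sum letter_cumulant (take m (gap j b ps)) *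
        noncrossing_sum_from letter_cumulant (replicate r X @ [gap j b ps ! m])
            (drop (Suc m) (gap j b ps))"
      \<comment> \<open>The even positions of a gap word carry matrix units, which cannot join a
        block of letters \<open>X\<close>.\<close>
      have even: "?F (2 * k) = 0" if "k \<le> n" for k
      proof -
        have "noncrossing_sum_from letter_cumulant (replicate r X @ [gap j b ps ! (2 * k)]) Z = 0" for Z
        proof (rule noncrossing_sum_from_prefix_zero)
          fix zs
          have "\<not> monochrome (\<lambda>l. l = X) ((replicate r X @ [gap j b ps ! (2 * k)]) @ zs)"
            using gap_nth_even[of k ps j b] that r by (auto simp: monochrome_def n_def)
          thus "letter_cumulant ((replicate r X @ [gap j b ps ! (2 * k)]) @ zs) = 0"
            by (simp add: letter_cumulant_def)
        qed simp
        thus ?thesis by simp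
      qed
      \<comment> \<open>The word enclosed before the next \<open>X\<close> of the block is a gap
        from \<open>j\<close> to \<open>fst (ps ! k)\<close>. Its moment vanishes unless these
        indices agree, which is exactly the link condition of \<open>entry_cumulant\<close>.\<close>
      have odd: "?F (Suc (2 * k)) = D ^ (n + 2) * (noncrossing_sum entry_cumulant (take k ps) *
          noncrossing_sum_from entry_cumulant (ys @ [ps ! k]) (drop (Suc k) ps))" if k: "k < n" for k
      proof -
        have kl: "k < length ps" using k by (simp add: n_def)
        have okk: "fst (ps ! k) < d" "snd (ps ! k) < d" "?ok (take k ps)" "?ok (drop (Suc k) ps)"
          using 1(2) kl nth_mem[OF kl] by (auto simp: case_prod_beta dest: in_set_takeD in_set_dropD)
        have F: "?F (Suc (2 * k)) = letter_moment (gap j (fst (ps ! k)) (take k ps)) *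
          noncrossing_sum_from letter_cumulant (replicate (Suc r) X)
              (gap (snd (ps ! k)) b (drop (Suc k) ps))"
          using gap_nth_odd[OF kl, of j b] by (simp add: letter_moment_eq replicate_append_same)
        show ?thesis
        proof (cases "j = fst (ps ! k)")
          case True
          have lk: "?lk (ys @ [ps ! k])" using ys True by (simp add: successively_append_iff j_def)
          have "letter_moment (gap j (fst (ps ! k)) (take k ps)) = D ^ Suc k *
              noncrossing_sum entry_cumulant (take k ps)"
            using letter_moment_gap[OF jb(1) okk(1,3)] IH1[OF _ okk(3)] kl True by (simp add: D_def)
          moreover have "noncrossing_sum_from letter_cumulant (replicate (Suc r) X)
              (gap (snd (ps ! k)) b (drop (Suc k) ps))
            = D ^ (length (drop (Suc k) ps) + 2) * noncrossing_sum_from entry_cumulant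
                (ys @ [ps ! k]) (drop (Suc k) ps)"
            using IH2[OF _ okk(4) _ _ lk] kl ys okk(1,2) by (auto simp: r_def b_def case_prod_beta)
          moreover have "D ^ (n + 2) = D ^ Suc k * D ^ (length (drop (Suc k) ps) + 2)"
          proof -
            have e: "n + 2 = Suc k + (length (drop (Suc k) ps) + 2)" using k by (simp add: n_def)
            show ?thesis by (simp only: e power_add)
          qed
          ultimately show ?thesis unfolding F by (simp only: mult_ac)
        next
          case False
          have "noncrossing_sum_from entry_cumulant (ys @ [ps ! k]) Z = 0" for Z
            using False ys by (intro noncrossing_sum_from_prefix_zero)
                (auto simp: entry_cumulant_def successively_append_iff j_def)
          moreover have "letter_moment (gap j (fst (ps ! k)) (take k ps)) = 0"
            using letter_moment_gap[OF jb(1) okk(1,3)] False by simp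
          ultimately show ?thesis unfolding F by simp
        qed
      qed
      \<comment> \<open>If the block ends, the rest of the word closes it: its moment gives the
        Kronecker symbol for \<open>j = b\<close>, and the one surplus power of \<open>d\<close>
        turns \<open>c\<close> into \<open>c * d\<close>.\<close>
      have first: "letter_cumulant (replicate r X) * noncrossing_sum letter_cumulant (gap j b ps) =
         D ^ (n + 2) * (entry_cumulant ys * noncrossing_sum entry_cumulant ps)"
      proof -
        have "of_real c * D ^ Suc n = D ^ (n + 2) * of_real (c * d)"
          using d by (simp add: D_def field_simps)
        moreover have "entry_cumulant ys = (if j = b then of_real (c * d) else 0)"
          using ys(3) by (simp add: entry_cumulant_def j_def b_def)
        ultimately show ?thesis
          using letter_moment_gap[OF jb 1(2)] em letter_cumulant_X[OF r]
          by (simp add: letter_moment_eq[symmetric] D_def[symmetric] n_def mult_ac Dd)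
      qed
      have "noncrossing_sum_from letter_cumulant (replicate r X) (gap j b ps) =
         letter_cumulant (replicate r X) * noncrossing_sum letter_cumulant (gap j b ps) +
             (\<Sum>m<Suc (2 * n). ?F m)"
        using r by (subst noncrossing_sum_from_rec) (auto simp: n_def)
      also have "(\<Sum>m<Suc (2 * n). ?F m) = (\<Sum>k<n. ?F (Suc (2 * k)))"
        by (rule sum_odd_only) (rule even)
      also have "letter_cumulant (replicate r X) * noncrossing_sum letter_cumulant (gap j b ps) +
          (\<Sum>k<n. ?F (Suc (2 * k)))
        = D ^ (n + 2) * noncrossing_sum_from entry_cumulant ys ps"
        unfolding noncrossing_sum_from_rec[OF ys(1)] first using odd
        by (simp add: distrib_left sum_distrib_left n_def)
      finally show ?thesis by (simp add: j_def b_def r_def n_def)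
    qed
    thus ?case using em by blast
  qed
  thus "entry_moment ps = noncrossing_sum entry_cumulant ps"
    "\<And>ys. ys \<noteq> [] \<Longrightarrow> ?ok ys \<Longrightarrow> ?lk ys \<Longrightarrow>
      noncrossing_sum_from letter_cumulant (replicate (length ys) X)
          (gap (snd (last ys)) (fst (hd ys)) ps) =
      (1 / of_nat d) ^ (length ps + 2) * noncrossing_sum_from entry_cumulant ys ps"
    unfolding D_def by blast+
qed

end

subsection \<open>The diagonals of the transpose\<close>

lemma mod_add_eq_self_iff:
  fixes d s m :: nat
  assumes "s < d"
  shows "s = (s + m) mod d \<longleftrightarrow> d dvd m"
proof -
  have "s = (s + m) mod d \<longleftrightarrow> (s + m) mod d = s mod d" using assms by auto
  also have "\<dots> \<longleftrightarrow> d dvd m" using mod_eq_dvd_iff_nat[of s "s + m" d] by simp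
  finally show ?thesis .
qed

locale transposed_free_marchenko_pastur = free_marchenko_pastur +
  fixes Y :: "nat \<Rightarrow> 'a mat"
  assumes selfadjoint: "mat_star w = w"
    and Y: "Y = diagonal_part d (Matrix.mat d d (\<lambda>(i, j). u j i))"
begin

lemma Y_carrier [simp]: "Y k \<in> carrier_mat d d"
  by (simp add: Y diagonal_part_def)

lemma Y_entry: "i < d \<Longrightarrow> j < d \<Longrightarrow> Y k $$ (i, j) = (if j = (i + k) mod d then u j i else 0)"
  by (simp add: Y diagonal_part_def)

text \<open>
  The entry \<open>(s, t)\<close> of \<open>Y k\<^sub>1 \<cdots> Y k\<^sub>n\<close> is a single product of entries of \<open>u\<close>, with the indices visited
  by the walk with steps \<open>k\<^sub>1, \<dots>, k\<^sub>n\<close> from \<open>s\<close>.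
\<close>

primrec path :: "nat \<Rightarrow> nat list \<Rightarrow> (nat \<times> nat) list" where
  "path s [] = []"
| "path s (k # ks) = ((s + k) mod d, s) # path ((s + k) mod d) ks"

lemma length_path [simp]: "length (path s ks) = length ks"
  by (induction ks arbitrary: s) auto

lemma path_append: "s < d \<Longrightarrow> path s (ks @ ls) = path s ks @ path ((s + sum_list ks) mod d) ls"
  by (induction ks arbitrary: s) (auto simp: mod_add_left_eq add.assoc)

lemma path_bounds: "s < d \<Longrightarrow> \<forall>(i, j)\<in>set (path s ks). i < d \<and> j < d"
proof (induction ks arbitrary: s)
  case (Cons k ks)
  have "(s + k) mod d < d" using d by simp
  hence "\<forall>(i, j)\<in>set (path ((s + k) mod d) ks). i < d \<and> j < d" by (rule Cons.IH)
  thus ?case using Cons.prems \<open>(s + k) mod d < d\<close> by simp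
qed simp

lemma mat_prod_Y:
  assumes "s < d" "t < d"
  shows "mat_prod d (map Y ks) $$ (s, t) =
    (if t = (s + sum_list ks) mod d then foldr (\<lambda>(i, j) a. u i j * a) (path s ks) 1 else 0)"
  using assms(1)
proof (induction ks arbitrary: s)
  case Nil thus ?case using assms(2) by auto
next
  case (Cons k ks)
  let ?s = "(s + k) mod d"
  have s: "?s < d" using d by simp
  have "mat_prod d (map Y (k # ks)) $$ (s, t) = (\<Sum>x<d. Y k $$ (s, x) * mat_prod d (map Y ks) $$ (x, t))"
    unfolding list.map mat_prod_Cons using Cons.prems assms(2)
    by (intro mult_mat_entry mat_prod_carrier) auto
  also have "\<dots> = (\<Sum>x<d. if x = ?s then u ?s s * mat_prod d (map Y ks) $$ (?s, t) else 0)"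
    using Cons.prems by (intro sum.cong) (auto simp: Y_entry)
  also have "\<dots> = u ?s s * mat_prod d (map Y ks) $$ (?s, t)" using s by simp
  also have "\<dots> = (if t = (s + sum_list (k # ks)) mod d then foldr (\<lambda>(i, j) a. u i j * a)
      (path s (k # ks)) 1 else 0)"
    unfolding Cons.IH[OF s] by (simp add: mod_add_left_eq add.assoc)
  finally show ?case .
qed

text \<open>If neighbouring steps cancel modulo \<open>d\<close>, a block of odd length has total
  step \<open>hd ks\<close>. It is closed only if this step is 0 modulo \<open>d\<close>.\<close>

definition diagonal_cumulant :: "nat list \<Rightarrow> complex" where
  "diagonal_cumulant ks = (if successively (\<lambda>k l. d dvd k + l) ks \<and> (even (length ks) \<or> d dvd hd ks)
     then of_real (c * d) else 0)"

text \<open>Because of the transposition, a step from \<open>s\<close> to \<open>t\<close> carries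
  the entry \<open>u t s\<close>. Hence two consecutive entries are linked if the second step leads
  back to the starting point of the first.\<close>

lemma successively_path:
  "s < d \<Longrightarrow> successively (\<lambda>p q. snd p = fst q) (path s ks) \<longleftrightarrow> successively (\<lambda>k l. d dvd k + l) ks"
proof (induction ks arbitrary: s rule: induct_list012)
  case (3 k l ks)
  have "(s + k) mod d < d" using d by simp
  moreover have "s = ((s + k) mod d + l) mod d \<longleftrightarrow> d dvd k + l"
    using mod_add_eq_self_iff[OF 3(3), of "k + l"] by (simp add: mod_add_left_eq add.assoc)
  ultimately show ?case using 3(2)[of "(s + k) mod d"] by simp
qed simp_all

text \<open>A walk whose consecutive steps cancel oscillates between \<open>s\<close> and
  \<open>s + hd ks\<close>.\<close>

lemma last_path:
  assumes "s < d" "ks \<noteq> []" "successively (\<lambda>k l. d dvd k + l) ks"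
  shows "snd (last (path s ks)) = (if odd (length ks) then s else (s + hd ks) mod d)"
  using assms
proof (induction ks arbitrary: s rule: induct_list012)
  case (3 k l ks)
  let ?s = "(s + k) mod d"
  have "?s < d" using d by simp
  hence "snd (last (path ?s (l # ks))) = (if odd (length (l # ks)) then ?s else (?s + l) mod d)"
    using 3(2)[of ?s] 3(5) by simp
  moreover have "(?s + l) mod d = s"
    using mod_add_eq_self_iff[OF 3(3), of "k + l"] 3(5) by (simp add: mod_add_left_eq add.assoc)
  ultimately show ?case by simp
qed simp_all

lemma entry_cumulant_path:
  assumes "s < d" "ks \<noteq> []"
  shows "entry_cumulant (path s ks) = diagonal_cumulant ks"
proof -
  have "fst (hd (path s ks)) = (s + hd ks) mod d" using assms(2) by (cases ks) auto
  thus ?thesis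
    using last_path[OF assms] mod_add_eq_self_iff[OF assms(1), of "hd ks"]
    by (auto simp: entry_cumulant_def diagonal_cumulant_def successively_path[OF assms(1)])
qed

lemma diagonal_cumulant_sum:
  assumes "diagonal_cumulant ks \<noteq> 0"
  shows "d dvd sum_list ks"
proof -
  have *: "successively (\<lambda>k l. d dvd k + l) ks" "even (length ks) \<or> d dvd hd ks"
    using assms by (auto simp: diagonal_cumulant_def split: if_splits)
  thus ?thesis
  proof (induction ks rule: induct_list012)
    case (3 k l ks)
    have kl: "d dvd k + l" using 3 by simp
    have "d dvd sum_list ks"
    proof (rule 3(1))
      show "successively (\<lambda>k l. d dvd k + l) ks" using 3(3) by (auto simp: successively_Cons)
      \<comment> \<open>In the odd case, the step after a cancelling pair is again congruent to the
        first step of the pair.\<close>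
      show "even (length ks) \<or> d dvd hd ks"
      proof (cases "even (length ks)")
        case False
        hence "d dvd k" "ks \<noteq> []" using 3(4) by auto
        moreover from this have "d dvd l + hd ks" using 3(3) by (cases ks) auto
        ultimately show ?thesis using kl by (metis dvd_add_right_iff)
      qed simp
    qed
    thus ?case using kl by (simp add: add.assoc[symmetric])
  qed auto
qed

text \<open>In a summand that does not vanish, the steps of each block sum to a multiple of
  \<open>d\<close> by \<open>diagonal_cumulant_sum\<close>; so do the steps of the whole
  word.\<close>

lemma noncrossing_sum_diagonal_zero:
  shows "\<not> d dvd sum_list ks \<Longrightarrow> noncrossing_sum diagonal_cumulant ks = 0"
    and "ys \<noteq> [] \<Longrightarrow> \<not> d dvd sum_list (ys @ ks) \<Longrightarrow> noncrossing_sum_from diagonal_cumulant ys ks = 0"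
proof -
  have "(\<not> d dvd sum_list ks \<longrightarrow> noncrossing_sum diagonal_cumulant ks = 0) \<and>
    (\<forall>ys. ys \<noteq> [] \<and> \<not> d dvd sum_list (ys @ ks) \<longrightarrow> noncrossing_sum_from diagonal_cumulant ys ks = 0)"
  proof (induction ks rule: length_induct)
    case (1 ks)
    have A: "noncrossing_sum diagonal_cumulant ks = 0" if "\<not> d dvd sum_list ks"
    proof (cases ks)
      case (Cons k ks')
      have "noncrossing_sum_from diagonal_cumulant [k] ks' = 0" using 1 that Cons by simp
      thus ?thesis by (simp add: Cons noncrossing_sum_Cons)
    qed (use that in simp)
    have B: "noncrossing_sum_from diagonal_cumulant ys ks = 0" if ys: "ys \<noteq> []"
        "\<not> d dvd sum_list (ys @ ks)" for ys
    proof -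
      have "diagonal_cumulant ys * noncrossing_sum diagonal_cumulant ks = 0"
      proof (cases "d dvd sum_list ks")
        case True
        hence "\<not> d dvd sum_list ys" using ys(2) by (auto dest: dvd_add)
        hence "diagonal_cumulant ys = 0" using diagonal_cumulant_sum by blast
        thus ?thesis by simp
      qed (simp add: A)
      moreover have "noncrossing_sum diagonal_cumulant (take m ks) *
          noncrossing_sum_from diagonal_cumulant (ys @ [ks ! m]) (drop (Suc m) ks) =
              0" if m: "m < length ks" for m
      proof (cases "d dvd sum_list (take m ks)")
        case True
        have "sum_list (ys @ ks) = sum_list (take m ks) + sum_list ((ys @ [ks ! m]) @ drop (Suc m) ks)"
          by (subst id_take_nth_drop[OF m]) simp
        hence "\<not> d dvd sum_list ((ys @ [ks ! m]) @ drop (Suc m) ks)" using ys(2) True by (metis dvd_add)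
        hence "noncrossing_sum_from diagonal_cumulant (ys @ [ks ! m]) (drop (Suc m) ks) = 0"
        proof -
          have "length (drop (Suc m) ks) < length ks" using m by simp
          hence "\<forall>ys. ys \<noteq> [] \<and> \<not> d dvd sum_list (ys @ drop (Suc m) ks) \<longrightarrow>
              noncrossing_sum_from diagonal_cumulant ys (drop (Suc m) ks) = 0"
            using 1 by blast
          thus ?thesis using \<open>\<not> d dvd sum_list ((ys @ [ks ! m]) @ drop (Suc m) ks)\<close> by blast
        qed
        thus ?thesis by simp
      next
        case False
        thus ?thesis using 1[rule_format, of "take m ks"] m by simp
      qed
      ultimately show ?thesis unfolding noncrossing_sum_from_rec[OF ys(1)] by
          (simp add: sum.neutral del: mult_eq_0_iff)
    qed
    show ?case using A B by blast
  qed
  thus "\<not> d dvd sum_list ks \<Longrightarrow> noncrossing_sum diagonal_cumulant ks = 0"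
    "ys \<noteq> [] \<Longrightarrow> \<not> d dvd sum_list (ys @ ks) \<Longrightarrow> noncrossing_sum_from diagonal_cumulant ys ks = 0" by blast+
qed

text \<open>The positions in \<open>path\<close> depend on all preceding steps, also on those of
  other blocks. But an enclosed word contributes only if its steps sum to 0 modulo \<open>d\<close>,
  and then the next step of the block starts where the previous one ended, so the letters of the
  block form a walk by themselves.\<close>

lemma noncrossing_sum_path:
  assumes "s < d"
  shows "noncrossing_sum entry_cumulant (path s ks) = noncrossing_sum diagonal_cumulant ks"
proof -
  have "\<forall>s<d. noncrossing_sum entry_cumulant (path s ks) = noncrossing_sum diagonal_cumulant ks \<and>
    (\<forall>ys. ys \<noteq> [] \<longrightarrow> noncrossing_sum_from entry_cumulant (path s ys)
        (path ((s + sum_list ys) mod d) ks) =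
       noncrossing_sum_from diagonal_cumulant ys ks)"
  proof (induction ks rule: length_induct)
    case (1 ks)
    have A: "noncrossing_sum entry_cumulant (path s ks) = noncrossing_sum diagonal_cumulant ks"
        if s: "s < d" for s
    proof (cases ks)
      case (Cons k ks')
      have "noncrossing_sum_from entry_cumulant (path s [k]) (path ((s + sum_list [k]) mod d) ks') =
          noncrossing_sum_from diagonal_cumulant [k] ks'"
        using 1 s Cons by (metis length_Cons lessI list.distinct(1))
      thus ?thesis by (simp add: Cons noncrossing_sum_Cons)
    qed simp
    have B: "noncrossing_sum_from entry_cumulant (path s ys) (path ((s + sum_list ys) mod d) ks) =
       noncrossing_sum_from diagonal_cumulant ys ks" if s: "s < d" and ys: "ys \<noteq> []" for s ys
    proof -
      define e where "e = (s + sum_list ys) mod d"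
      have e: "e < d" using d by (simp add: e_def)
      have terms: "noncrossing_sum entry_cumulant (take m (path e ks)) *
          noncrossing_sum_from entry_cumulant (path s ys @ [path e ks ! m]) (drop (Suc m) (path e ks)) =
        noncrossing_sum diagonal_cumulant (take m ks) *
          noncrossing_sum_from diagonal_cumulant (ys @ [ks ! m])
              (drop (Suc m) ks)" if m: "m < length ks" for m
      proof -
        define e' where "e' = (e + sum_list (take m ks)) mod d"
        have split: "path e ks = path e (take m ks) @ ((e' + ks ! m) mod d, e') # path
            ((e' + ks ! m) mod d) (drop (Suc m) ks)"
          by (subst id_take_nth_drop[OF m], subst path_append[OF e]) (simp add: e'_def)
        have len: "length (path e (take m ks)) = m" using m by simp
        have take: "take m (path e ks) = path e (take m ks)"
          and nth: "path e ks ! m = ((e' + ks ! m) mod d, e')"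
          and drop: "drop (Suc m) (path e ks) = path ((e' + ks ! m) mod d) (drop (Suc m) ks)"
          unfolding split using len by (simp_all add: nth_append)
        have gap: "noncrossing_sum entry_cumulant (path e (take m ks)) =
            noncrossing_sum diagonal_cumulant (take m ks)"
          using 1 e m by simp
        show ?thesis
        proof (cases "d dvd sum_list (take m ks)")
          case True
          hence e': "e' = e" using mod_add_eq_self_iff[OF e, of "sum_list (take m ks)"]
              unfolding e'_def by metis
          have "path s ys @ [((e + ks ! m) mod d, e)] = path s (ys @ [ks ! m])"
            by (simp add: path_append[OF s] e_def)
          moreover have "(e + ks ! m) mod d = (s + sum_list (ys @ [ks ! m])) mod d"
            by (simp add: e_def mod_add_left_eq add.assoc)
          moreover have "noncrossing_sum_from entry_cumulant (path s (ys @ [ks ! m]))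
              (path ((s + sum_list (ys @ [ks ! m])) mod d) (drop (Suc m) ks)) =
            noncrossing_sum_from diagonal_cumulant (ys @ [ks ! m]) (drop (Suc m) ks)"
          proof -
            have "length (drop (Suc m) ks) < length ks" using m by simp
            thus ?thesis using 1[rule_format, OF _ s, of "drop (Suc m) ks"] by blast
          qed
          ultimately show ?thesis unfolding take nth drop e' gap by simp
        next
          case False
          thus ?thesis unfolding take gap using noncrossing_sum_diagonal_zero(1) by simp
        qed
      qed
      have "path s ys \<noteq> []" using ys by (cases ys) auto
      thus ?thesis
        unfolding e_def[symmetric] using terms
        by (simp add: noncrossing_sum_from_rec[OF ys] noncrossing_sum_from_rec[of "path s ys"] A[OF e]
            entry_cumulant_path[OF s ys])
    qed
    show ?case using A B by blast
  qed
  thus ?thesis using assms by blast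
qed

text \<open>The noncrossing sum no longer depends on the starting point \<open>s\<close>, so all
  diagonal entries have the same expectation and the normalized trace merely averages equal
  numbers.\<close>

theorem moment_Y: "mat_moment d \<tau> (map Y ks) = noncrossing_sum diagonal_cumulant ks"
proof -
  have "\<tau> (mat_prod d (map Y ks) $$ (s, s)) = noncrossing_sum diagonal_cumulant ks" if s: "s < d" for s
  proof (cases "d dvd sum_list ks")
    case True
    hence "s = (s + sum_list ks) mod d" using mod_add_eq_self_iff[OF s] by simp
    hence "\<tau> (mat_prod d (map Y ks) $$ (s, s)) = entry_moment (path s ks)"
      unfolding mat_prod_Y[OF s s] entry_moment_def by simp
    also have "\<dots> = noncrossing_sum diagonal_cumulant ks"
      using noncrossing_sum_gap(1)[OF path_bounds[OF s]] noncrossing_sum_path[OF s] by simp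
    finally show ?thesis .
  next
    case False
    hence "s \<noteq> (s + sum_list ks) mod d" using mod_add_eq_self_iff[OF s] by simp
    thus ?thesis unfolding mat_prod_Y[OF s s] using noncrossing_sum_diagonal_zero(1)[OF False] by simp
  qed
  thus ?thesis using d by (simp add: mat_moment_conv mat_state_def)
qed

lemma cumulant_Y:
  assumes "ks \<noteq> []"
  shows "free_cumulant (mat_moment d \<tau>) (map Y ks) = diagonal_cumulant ks"
  unfolding free_cumulant_map
  by (rule free_cumulant_eqI[where L = UNIV]) (use assms moment_Y in auto)

section \<open>Adjoints of the diagonals, and colours of their indices\<close>

lemma star_u:
  assumes "i < d" "j < d"
  shows "star (u i j) = u j i"
proof -
  have "scaleC (of_nat d) (mat_star w $$ (j, i)) = scaleC (of_nat d) (w $$ (j, i))" by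
      (simp add: selfadjoint)
  thus ?thesis
    using assms d by (simp add: mat_star_entry[OF w_carrier])
        (simp add: w mat_scaleC_def star_scaleC scaleC_scaleC scaleC_one)
qed

text \<open>Walking a step \<open>d - k\<close> undoes a step \<open>k\<close>, and
  \<open>star_u\<close> restores the order of the indices. For \<open>k = 0\<close> the index
  \<open>d\<close> appears, which denotes the same diagonal as 0.\<close>

lemma star_Y:
  assumes "k \<le> d"
  shows "mat_star (Y k) = Y (d - k)"
proof (rule eq_matI)
  fix i j assume "i < dim_row (Y (d - k))" "j < dim_col (Y (d - k))"
  hence ij: "i < d" "j < d" using Y_carrier[of "d - k"] by (auto simp del: Y_carrier)
  have shift: "(y + (d - l)) mod d = x" if "y = (x + l) mod d" "x < d" "l \<le> d" for x y l
  proof -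
    have "(y + (d - l)) mod d = (x + l + (d - l)) mod d" unfolding that(1) by
        (simp add: mod_add_left_eq)
    also have "x + l + (d - l) = x + d" using that(3) by simp
    finally show ?thesis using that(2) by simp
  qed
  have "i = (j + k) mod d \<longleftrightarrow> j = (i + (d - k)) mod d"
    using shift[of i j k] shift[of j i "d - k"] ij assms by auto
  thus "mat_star (Y k) $$ (i, j) = Y (d - k) $$ (i, j)"
    using ij by (simp add: mat_star_entry[OF Y_carrier] Y_entry star_u)
qed (use Y_carrier[of k] Y_carrier[of "d - k"] in \<open>auto simp: mat_star_def simp del: Y_carrier\<close>)

lemma Y_d: "Y d = Y 0"
  by (simp add: Y diagonal_part_def)

text \<open>The representative of the residues of \<open>k\<close> and \<open>-k\<close> that is at
  most \<open>d / 2\<close>. A diagonal and its adjoint generate the same star-algebra, so their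
  indices must share a colour.\<close>

definition colour :: "nat \<Rightarrow> nat" where
  "colour k = min (k mod d) ((d - k mod d) mod d)"

lemma colour_eq:
  assumes "d dvd k + l"
  shows "colour k = colour l"
proof -
  have "(k mod d + l mod d) mod d = 0" using assms by (simp add: mod_add_eq)
  moreover have kl: "k mod d < d" "l mod d < d" using d by simp_all
  ultimately have "k mod d + l mod d = 0 \<or> k mod d + l mod d = d"
  proof -
    from \<open>(k mod d + l mod d) mod d = 0\<close> obtain q where q: "k mod d + l mod d = d * q" by auto
    hence "d * q < d * 2" using kl by linarith
    hence "q = 0 \<or> q = 1" by auto
    thus ?thesis using q by auto
  qed
  thus ?thesis
  proof
    assume *: "k mod d + l mod d = d"
    hence "l mod d = d - k mod d" "k mod d = d - l mod d" using kl by linarith+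
    moreover from this have "(d - k mod d) mod d = l mod d" "(d - l mod d) mod d = k mod d"
        using kl by simp_all
    ultimately show ?thesis unfolding colour_def by (metis min.commute)
  qed (simp add: colour_def)
qed

text \<open>On the range \<open>2 * k \<le> d\<close> the colour is injective; this is the origin of
  the index ranges in claim (1).\<close>

lemma colour_half:
  assumes "2 * k \<le> d"
  shows "colour k = k" "colour (d - k) = k"
proof -
  have kd: "k < d" using assms d by linarith
  show "colour k = k" using assms kd by (cases "k = 0") (auto simp: colour_def)
  thus "colour (d - k) = k" using colour_eq[of "d - k" k] kd by simp
qed

lemma diagonal_cumulant_mixed:
  assumes "\<not> monochrome colour ks"
  shows "diagonal_cumulant ks = 0"
proof -
  have "monochrome colour ks" if "successively (\<lambda>k l. d dvd k + l) ks"
  proof -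
    have "\<forall>x\<in>set ks. colour x = colour (hd ks)"
      using that
    proof (induction ks rule: induct_list012)
      case (3 k l ks)
      thus ?case using colour_eq[of k l] by simp
    qed auto
    thus ?thesis by (simp add: monochrome_def)
  qed
  thus ?thesis using assms by (auto simp: diagonal_cumulant_def)
qed

text \<open>The letter \<open>d - k\<close> stands for the adjoint of \<open>Y k\<close>, so this
  linear span is closed under products and adjoints and contains the generated star-algebra.\<close>

inductive_set word_span :: "nat \<Rightarrow> 'a mat set" for k where
  word: "set ls \<subseteq> {k, d - k} \<Longrightarrow> mat_prod d (map Y ls) \<in> word_span k"
| add: "A \<in> word_span k \<Longrightarrow> B \<in> word_span k \<Longrightarrow> A + B \<in> word_span k"
| scale: "A \<in> word_span k \<Longrightarrow> mat_scaleC z A \<in> word_span k"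

text \<open>Freeness has to be checked for all elements of trace 0; this set reduces them by
  linearity to centred words, for which \<open>centered_noncrossing_sum\<close> is
  available.\<close>

inductive_set centred_span :: "nat \<Rightarrow> 'a mat set" for k where
  word: "set ls \<subseteq> {k, d - k} \<Longrightarrow> centre Y ls \<in> centred_span k"
| add: "A \<in> centred_span k \<Longrightarrow> B \<in> centred_span k \<Longrightarrow> A + B \<in> centred_span k"
| scale: "A \<in> centred_span k \<Longrightarrow> mat_scaleC z A \<in> centred_span k"

lemma Y_word_carrier [simp]: "mat_prod d (map Y ls) \<in> carrier_mat d d"
  by (rule word_carrier) simp

lemma Y_centre_carrier [simp]: "centre Y ls \<in> carrier_mat d d"
  by (rule centre_carrier) simp

lemma word_span_carrier: "A \<in> word_span k \<Longrightarrow> A \<in> carrier_mat d d"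
  by (induction rule: word_span.induct) auto

lemma centred_span_carrier: "A \<in> centred_span k \<Longrightarrow> A \<in> carrier_mat d d"
  by (induction rule: centred_span.induct) auto

lemma word_span_mult:
  assumes "A \<in> word_span k" "B \<in> word_span k"
  shows "A * B \<in> word_span k"
  using assms(1)
proof (induction rule: word_span.induct)
  case (word ls)
  show ?case using assms(2)
  proof (induction rule: word_span.induct)
    case (word ls')
    have "mat_prod d (map Y ls) * mat_prod d (map Y ls') = mat_prod d (map Y (ls @ ls'))"
      by (simp add: mat_prod_append image_subset_iff)
    thus ?case using word \<open>set ls \<subseteq> {k, d - k}\<close> word_span.word[of "ls @ ls'" k] by simp
  next
    case (add A B)
    thus ?case by (subst mult_add_distrib_mat[of _ d d])
        (auto intro: word_span.add dest: word_span_carrier)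
  next
    case (scale A z)
    thus ?case by (subst mat_scaleC_mult_right[of _ d])
        (auto intro: word_span.scale dest: word_span_carrier)
  qed
next
  case (add A A')
  thus ?case using word_span_carrier[OF assms(2)]
    by (subst add_mult_distrib_mat[of _ d d]) (auto intro: word_span.add dest: word_span_carrier)
next
  case (scale A z)
  thus ?case using word_span_carrier[OF assms(2)]
    by (subst mat_scaleC_mult_left[of _ d]) (auto intro: word_span.scale dest: word_span_carrier)
qed

lemma mat_star_word:
  assumes "\<forall>l\<in>set ls. l \<le> d"
  shows "mat_star (mat_prod d (map Y ls)) = mat_prod d (map Y (rev (map (\<lambda>l. d - l) ls)))"
  using assms
proof (induction ls)
  case (Cons l ls)
  thus ?case
    by (simp add: mat_star_mult[of _ d] star_Y mat_prod_append image_subset_iff right_mult_one_mat[of _ d d])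
qed (simp add: mat_star_one)

lemma word_span_star:
  assumes "A \<in> word_span k" "k \<le> d"
  shows "mat_star A \<in> word_span k"
  using assms(1)
proof (induction rule: word_span.induct)
  case (word ls)
  have "set (rev (map (\<lambda>l. d - l) ls)) \<subseteq> {k, d - k}" using word assms(2) by auto
  moreover have "\<forall>l\<in>set ls. l \<le> d" using word assms(2) by auto
  ultimately show ?case using word_span.word mat_star_word by metis
next
  case (add A B)
  thus ?case by (auto simp: mat_star_add[of _ d] word_span_carrier intro: word_span.add)
next
  case (scale A z)
  thus ?case by (auto simp: mat_star_scaleC intro: word_span.scale)
qed

lemma generated_star_algebra_subset_word_span:
  assumes "A \<in> generated_star_algebra d {Y k}" "k \<le> d"
  shows "A \<in> word_span k"
  using assms(1)
proof (induction rule: generated_star_algebra.induct)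
  case (base A)
  thus ?case using word_span.word[of "[k]" k] by (simp add: right_mult_one_mat[of _ d d])
next
  case one
  show ?case using word_span.word[of "[]" k] by simp
qed (use assms(2) in \<open>auto intro: word_span.add word_span.scale word_span_mult word_span_star\<close>)

text \<open>Subtracting the expectation is a linear operation, so it can be carried out word by
  word.\<close>

lemma word_span_centred:
  assumes "A \<in> word_span k"
  shows "A + mat_scaleC (- \<phi> A) (1\<^sub>m d) \<in> centred_span k"
  using assms
proof (induction rule: word_span.induct)
  case (word ls)
  thus ?case using centred_span.word[of ls k] by (simp add: centre_def mat_moment_conv)
next
  case (add A B)
  have c: "A \<in> carrier_mat d d" "B \<in> carrier_mat d d" using add word_span_carrier by auto
  have "A + B + mat_scaleC (- \<phi> (A + B)) (1\<^sub>m d) = (A + mat_scaleC (- \<phi> A) (1\<^sub>m d)) +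
      (B + mat_scaleC (- \<phi> B) (1\<^sub>m d))"
  proof -
    have "scaleC (- \<phi> A - \<phi> B) (1 :: 'a) = scaleC (- \<phi> A) 1 + scaleC (- \<phi> B) 1"
      by (simp add: scaleC_add_left[symmetric])
    thus ?thesis using c unfolding \<phi>_add[OF c] by (intro eq_matI)
        (auto simp: mat_scaleC_def algebra_simps)
  qed
  thus ?case using add centred_span.add by simp
next
  case (scale A z)
  have c: "A \<in> carrier_mat d d" using scale word_span_carrier by auto
  have "mat_scaleC z A + mat_scaleC (- \<phi> (mat_scaleC z A)) (1\<^sub>m d) = mat_scaleC z
      (A + mat_scaleC (- \<phi> A) (1\<^sub>m d))"
    using c unfolding \<phi>_scaleC[OF c] by (intro eq_matI)
        (auto simp: mat_scaleC_def scaleC_add_right scaleC_scaleC)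
  thus ?case using scale centred_span.scale by simp
qed

text \<open>The factors are replaced by centred words from left to right, by linearity in one factor
  at a time. The words already chosen accumulate in \<open>Ws\<close>, with their colours in
  \<open>cs\<close>.\<close>

lemma alternating_centred_moment:
  assumes "distinct_adj (cs @ map fst xs)" "cs @ map fst xs \<noteq> []"
    and "list_all2 (\<lambda>c W. \<forall>l\<in>set W. colour l = c) cs Ws"
    and "\<And>k x. (k, x) \<in> set xs \<Longrightarrow> x \<in> centred_span k \<and> 2 * k \<le> d"
  shows "\<phi> (mat_prod d (map (centre Y) Ws) * mat_prod d (map snd xs)) = 0"
  using assms
proof (induction xs arbitrary: cs Ws)
  case Nil
  have M: "(\<lambda>W. mat_moment d \<tau> (map Y W)) = noncrossing_sum diagonal_cumulant" using moment_Y by auto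
  have "Ws \<noteq> []" using Nil by auto
  moreover have "alternating_blocks colour cs Ws" using Nil by (simp add: alternating_blocks_def)
  ultimately have "centered (noncrossing_sum diagonal_cumulant)
      (noncrossing_sum diagonal_cumulant) [] Ws [] = 0"
    using centered_noncrossing_sum[of colour diagonal_cumulant] diagonal_cumulant_mixed by blast
  moreover have "mat_prod d (map (centre Y) Ws) \<in> carrier_mat d d" by (rule centres_carrier) simp
  ultimately show ?case
    using centered_eq_moment[of Y "[]" Ws] by
        (simp add: M left_mult_one_mat[of _ d d] right_mult_one_mat[of _ d d])
next
  case (Cons kx xs)
  obtain k x where kx: "kx = (k, x)" by (cases kx)
  let ?P = "mat_prod d (map (centre Y) Ws)" and ?R = "mat_prod d (map snd xs)"
  have P: "?P \<in> carrier_mat d d" by (rule centres_carrier) simp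
  have R: "?R \<in> carrier_mat d d"
    using Cons.prems(4) centred_span_carrier by (intro mat_prod_carrier) (auto, blast)
  have x: "x \<in> centred_span k" "2 * k \<le> d" using Cons.prems(4) kx by auto
  have "\<phi> (?P * (x * ?R)) = 0"
    using x(1)
  proof (induction rule: centred_span.induct)
    case (word ls)
    have "\<phi> (mat_prod d (map (centre Y) (Ws @ [ls])) * ?R) = 0"
    proof (rule Cons.IH[of "cs @ [k]"])
      show "distinct_adj ((cs @ [k]) @ map fst xs)" using Cons.prems(1) kx by simp
      show "list_all2 (\<lambda>c W. \<forall>l\<in>set W. colour l = c) (cs @ [k]) (Ws @ [ls])"
        using Cons.prems(3) word colour_half[OF x(2)] by (auto intro!: list_all2_appendI)
    qed (use Cons.prems(4) in auto)
    moreover have "mat_prod d (map (centre Y) (Ws @ [ls])) = ?P * centre Y ls"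
      by (simp add: mat_prod_append image_subset_iff right_mult_one_mat[of _ d d])
    ultimately show ?case using P R by (simp add: assoc_mult_mat[of _ d d _ d _ d])
  next
    case (add A B)
    have c: "A \<in> carrier_mat d d" "B \<in> carrier_mat d d" using add centred_span_carrier by auto
    have "?P * ((A + B) * ?R) = ?P * (A * ?R) + ?P * (B * ?R)"
      using c P R by (simp add: add_mult_distrib_mat[of _ d d _ _ d] mult_add_distrib_mat[of _ d d _ d] mult_carrier_mat[of _ d d _ d])
    moreover have "?P * (A * ?R) \<in> carrier_mat d d" "?P * (B * ?R) \<in> carrier_mat d d"
      using c P R by (auto intro!: mult_carrier_mat[of _ d d _ d])
    ultimately show ?case using add by (simp add: \<phi>_add)
  next
    case (scale A z)
    have c: "A \<in> carrier_mat d d" using scale centred_span_carrier by auto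
    have AR: "A * ?R \<in> carrier_mat d d" and PAR: "?P * (A * ?R) \<in> carrier_mat d d"
      using c P R by (auto intro!: mult_carrier_mat[of _ d d _ d])
    show ?case
      unfolding mat_scaleC_mult_left[OF c R] mat_scaleC_mult_right[OF P AR] \<phi>_scaleC[OF PAR]
          using scale by simp
  qed
  thus ?case by (simp add: kx)
qed

theorem free_diagonals:
  assumes "2 * m \<le> d"
  shows "free_family (mat_moment d \<tau>) {0..m} (\<lambda>k. generated_star_algebra d {Y k})"
  unfolding free_family_def
proof (intro allI impI, elim conjE)
  fix xs :: "(nat \<times> 'a mat) list"
  assume xs: "xs \<noteq> []" "distinct_adj (map fst xs)"
    "\<forall>(i, x)\<in>set xs. i \<in> {0..m} \<and> x \<in> generated_star_algebra d {Y i} \<and> mat_moment d \<tau> [x] = 0"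
  have "x \<in> centred_span k \<and> 2 * k \<le> d" if "(k, x) \<in> set xs" for k x
  proof -
    have k: "2 * k \<le> d" "x \<in> generated_star_algebra d {Y k}" "mat_moment d \<tau> [x] = 0"
      using xs(3) that assms by auto
    have x: "x \<in> word_span k" using generated_star_algebra_subset_word_span[OF k(2)] k(1) by simp
    hence c: "x \<in> carrier_mat d d" by (rule word_span_carrier)
    have "\<phi> x = 0" using k(3) mat_moment_single[OF c] by simp
    moreover have "x + mat_scaleC 0 (1\<^sub>m d) = x" using c by (intro eq_matI) (auto simp: mat_scaleC_def)
    ultimately have "x \<in> centred_span k" using word_span_centred[OF x] by simp
    thus ?thesis using k(1) by simp
  qed
  note cs = this
  have "mat_prod d (map snd xs) \<in> carrier_mat d d"
    using cs centred_span_carrier by (intro mat_prod_carrier) (auto, blast)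
  thus "mat_moment d \<tau> (map snd xs) = 0"
    using alternating_centred_moment[of "[]" xs "[]"] xs cs by
        (simp add: mat_moment_conv left_mult_one_mat[of _ d d])
qed

section \<open>Distributions and cumulants of the individual diagonals\<close>

theorem Y_0_law: "has_law (mat_moment d \<tau>) mat_star (Y 0) (marchenko_pastur (c * real d))"
  unfolding has_law_def
proof (intro conjI allI)
  have cd: "0 < c * real d" using c d by simp
  show "mat_star (Y 0) = Y 0" using star_Y[of 0] Y_d by simp
  fix n
  show "integrable (marchenko_pastur (c * real d)) (\<lambda>t. t ^ n)" by
      (rule marchenko_pastur_moments(1)[OF cd])
  have "mat_moment d \<tau> (replicate n (Y 0)) = noncrossing_sum diagonal_cumulant (replicate n 0)"
    using moment_Y[of "replicate n 0"] by simp
  \<comment> \<open>On words in the letter 0 both conditions of \<open>diagonal_cumulant\<close>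
    hold, so all cumulants are \<open>c * d\<close>, as for the Marchenko-Pastur law with this
    parameter.\<close>
  also have "\<dots> = noncrossing_sum (\<lambda>_. of_real (c * real d)) (replicate n (0 :: nat))"
  proof (rule noncrossing_sum_cong)
    fix zs :: "nat list" assume "set zs \<subseteq> set (replicate n 0)" "zs \<noteq> []"
    hence "zs = replicate (length zs) 0" "zs \<noteq> []" by
        (auto simp: subset_iff intro!: replicate_length_same[symmetric] split: if_splits)
    moreover have "successively (\<lambda>k l. d dvd k + l) (replicate r 0)" for r
      by (induction r rule: induct_nat_012) auto
    ultimately show "diagonal_cumulant zs = of_real (c * real d)"
      unfolding diagonal_cumulant_def by (metis dvd_0_right hd_replicate)
  qed
  also have "\<dots> = of_real (\<integral>t. t ^ n \<partial>marchenko_pastur (c * real d))"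
    by (simp only: noncrossing_sum_const(1)[OF cd] marchenko_pastur_moments(2)[OF cd] length_replicate)
  finally show "mat_moment d \<tau> (replicate n (Y 0)) = of_real
      (\<integral>t. t ^ n \<partial>marchenko_pastur (c * real d))" .
qed

lemma star_Y_map: "k \<le> d \<Longrightarrow> map (\<lambda>b. if b then Y k else mat_star (Y k)) bs = map Y
    (map (\<lambda>b. if b then k else d - k) bs)"
  by (simp add: star_Y)

text \<open>Neighbouring steps are \<open>k\<close> and \<open>d - k\<close>, which cancel. The
  middle diagonal is included, so this covers the cumulants in claims (3) and (4) alike.\<close>

theorem alternating_cumulant_Y:
  assumes "k \<le> d" "1 \<le> n"
  shows "free_cumulant (mat_moment d \<tau>) (concat (replicate n [Y k, mat_star (Y k)])) = of_real
      (c * real d)"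
proof -
  let ?ks = "concat (replicate n [k, d - k])"
  have "concat (replicate n [Y k, mat_star (Y k)]) = map Y ?ks"
    using assms(1) by (simp add: map_concat star_Y)
  moreover have succ: "successively (\<lambda>k l. d dvd k + l) (concat (replicate r [k, d - k])) \<and> even
      (length (concat (replicate r [k, d - k])))" for r
    using assms(1) by (induction r rule: induct_nat_012) auto
  moreover have "?ks \<noteq> []" using assms(2) by (cases n) auto
  moreover have "diagonal_cumulant ?ks = of_real (c * real d)"
    using succ[of n] unfolding diagonal_cumulant_def by presburger
  ultimately show ?thesis by (metis cumulant_Y)
qed

text \<open>Two equal neighbours would need \<open>d\<close> to divide \<open>2 * k\<close> or
  \<open>2 * (d - k)\<close>, which for \<open>0 < k < d\<close> happens only at
  \<open>2 * k = d\<close>. An alternating word of odd length would need \<open>d\<close> to divide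
  its first step.\<close>

theorem R_diagonal_Y:
  assumes "k < d" "0 < k" "2 * k \<noteq> d"
  shows "R_diagonal (mat_moment d \<tau>) mat_star (Y k)"
  unfolding R_diagonal_def
proof (intro allI impI, elim conjE)
  fix bs :: "bool list" assume bs: "bs \<noteq> []" "\<not> (even (length bs) \<and> distinct_adj bs)"
  let ?f = "\<lambda>b. if b then k else d - k"
  have same: "\<not> d dvd k + k" "\<not> d dvd (d - k) + (d - k)"
  proof -
    have no: "\<not> d dvd l + l" if "0 < l" "l < d" "2 * l \<noteq> d" for l
    proof
      assume "d dvd l + l"
      then obtain q where q: "2 * l = d * q" by (auto simp: dvd_def mult_2)
      have "d * q < d * 2" using q that(2) by linarith
      moreover have "q \<noteq> 0" using q that(1) by (cases q) auto
      ultimately have "q = 1" by auto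
      thus False using q that(3) by simp
    qed
    show "\<not> d dvd k + k" "\<not> d dvd (d - k) + (d - k)" using assms by (intro no; linarith)+
  qed
  have "diagonal_cumulant (map ?f bs) = 0"
  proof (cases "distinct_adj bs")
    case True
    hence "odd (length bs)" using bs by simp
    moreover have "\<not> d dvd hd (map ?f bs)"
      using assms bs(1) by (auto simp: hd_map dest: dvd_imp_le)
    ultimately show ?thesis by (simp add: diagonal_cumulant_def)
  next
    case False
    have "successively (\<lambda>k l. d dvd k + l) (map ?f bs) \<Longrightarrow> distinct_adj bs"
    proof (induction bs rule: induct_list012)
      case (3 x y bs)
      thus ?case using same by (auto split: if_splits)
    qed auto
    thus ?thesis using False by (auto simp: diagonal_cumulant_def)
  qed
  moreover have "free_cumulant (mat_moment d \<tau>) (map Y (map ?f bs)) = diagonal_cumulant (map ?f bs)"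
    using bs(1) by (intro cumulant_Y) simp
  ultimately show "free_cumulant (mat_moment d \<tau>) (map (\<lambda>b. if b then Y k else mat_star (Y k)) bs) = 0"
    using assms(1) by (simp add: star_Y_map)
qed

text \<open>An odd number of steps of length \<open>d / 2\<close> does not lead back to the starting
  point.\<close>

theorem even_Y_half:
  assumes "even d"
  shows "even_element (mat_moment d \<tau>) mat_star (Y (d div 2))"
  unfolding even_element_def
proof (intro conjI allI impI)
  have "d - d div 2 = d div 2" using assms by auto
  thus "mat_star (Y (d div 2)) = Y (d div 2)" using star_Y[of "d div 2"] by simp
  fix n :: nat assume n: "odd n"
  have "\<not> d dvd sum_list (replicate n (d div 2))"
  proof
    assume "d dvd sum_list (replicate n (d div 2))"
    hence "(d div 2) * 2 dvd (d div 2) * n" using assms by (simp add: sum_list_replicate mult.commute)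
    moreover have "d div 2 \<noteq> 0" using assms d by auto
    ultimately have "2 dvd n" by (metis dvd_times_left_cancel_iff)
    thus False using n by simp
  qed
  thus "mat_moment d \<tau> (replicate n (Y (d div 2))) = 0"
    using moment_Y[of "replicate n (d div 2)"] noncrossing_sum_diagonal_zero(1) by simp
qed

end

section \<open>The claims for the limit of the Wishart matrices\<close>

theorem theorem31:
  fixes d1 :: nat and d2 p :: "nat \<Rightarrow> nat" and c :: real
    and P :: "nat \<Rightarrow> 'w measure" and G :: "nat \<Rightarrow> nat \<Rightarrow> 'w \<Rightarrow> complex mat"
    and \<tau> :: "'a::complex_star_algebra \<Rightarrow> complex"
    and u :: "nat \<Rightarrow> nat \<Rightarrow> 'a" and w :: "'a mat" and Y :: "nat \<Rightarrow> 'a mat"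
    and M :: "'a mat list \<Rightarrow> complex"
  assumes "1 \<le> d1" and "0 < c"
    and "filterlim d2 at_top sequentially" and "filterlim p at_top sequentially"
    and "(\<lambda>n. real (p n) / real (d2 n)) \<longlonglongrightarrow> c * real d1"
    and "\<And>n. iid_gaussian_matrices (P n) d1 (d2 n) (p n) (G n)"
    and "star_probability_space \<tau>"
    and "M = mat_moment d1 \<tau>"
    and "w = mat_scaleC (1 / of_nat d1) (Matrix.mat d1 d1 (\<lambda>(i, j). u i j))"
    and "mat_star w = w"
    and "wishart_converges P d1 d2 G \<tau> w"
    and "has_law M mat_star w (marchenko_pastur c)"
    and "free_family M UNIV
           (\<lambda>b. if b then generated_star_algebra d1 {w} else scalar_matrices d1)"
    and "Y = diagonal_part d1 (Matrix.mat d1 d1 (\<lambda>(i, j). u j i))"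
  shows "(even d1 \<longrightarrow>
            free_family M {0..d1 div 2} (\<lambda>k. generated_star_algebra d1 {Y k})) \<and>
         (odd d1 \<longrightarrow>
            free_family M {0..(d1 - 1) div 2} (\<lambda>k. generated_star_algebra d1 {Y k})) \<and>
         has_law M mat_star (Y 0) (marchenko_pastur (c * real d1)) \<and>
         (\<forall>i\<in>{1..d1 - 1}. Y (d1 - i) = mat_star (Y i)) \<and>
         (\<forall>i\<in>{1..d1 - 1}. 2 * i \<noteq> d1 \<longrightarrow>
            R_diagonal M mat_star (Y i) \<and>
            (\<forall>n\<ge>1. free_cumulant M (concat (replicate n [Y i, mat_star (Y i)])) = of_real (c * real d1))) \<and>
         (even d1 \<longrightarrow>
            even_element M mat_star (Y (d1 div 2)) \<and>
            (\<forall>n\<ge>1. free_cumulant M (concat (replicate n [Y (d1 div 2), mat_star (Y (d1 div 2))]))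
                    = of_real (c * real d1)))"
proof -
  interpret star_prob_matrices d1 \<tau>
    using assms by unfold_locales
  have law: "mat_moment d1 \<tau> (replicate n w) = of_real (mp_moment c n)" for n
    using assms(12) by (simp add: has_law_def marchenko_pastur_moments(2)[OF assms(2)] assms(8))
  interpret transposed_free_marchenko_pastur d1 \<tau> c u w Y
    using assms law by unfold_locales simp_all
  show ?thesis
    unfolding assms(8)
  proof (intro conjI impI ballI allI)
    assume "even d1"
    thus "free_family (mat_moment d1 \<tau>) {0..d1 div 2} (\<lambda>k. generated_star_algebra d1 {Y k})"
      by (intro free_diagonals) simp
  next
    assume "odd d1"
    thus "free_family (mat_moment d1 \<tau>) {0..(d1 - 1) div 2} (\<lambda>k. generated_star_algebra d1 {Y k})"
      by (intro free_diagonals) simp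
  next
    show "has_law (mat_moment d1 \<tau>) mat_star (Y 0) (marchenko_pastur (c * real d1))"
      by (rule Y_0_law)
  next
    fix i assume "i \<in> {1..d1 - 1}"
    thus "Y (d1 - i) = mat_star (Y i)" by (subst star_Y) auto
  next
    fix i assume "i \<in> {1..d1 - 1}" "2 * i \<noteq> d1"
    thus "R_diagonal (mat_moment d1 \<tau>) mat_star (Y i)" by (intro R_diagonal_Y) auto
  next
    fix i n :: nat assume "i \<in> {1..d1 - 1}" "2 * i \<noteq> d1" "1 \<le> n"
    thus "free_cumulant (mat_moment d1 \<tau>) (concat (replicate n [Y i, mat_star (Y i)])) = of_real (c * real d1)"
      by (intro alternating_cumulant_Y) auto
  next
    assume "even d1"
    thus "even_element (mat_moment d1 \<tau>) mat_star (Y (d1 div 2))" by (rule even_Y_half)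
  next
    fix n :: nat assume "even d1" "1 \<le> n"
    thus "free_cumulant (mat_moment d1 \<tau>)
        (concat (replicate n [Y (d1 div 2), mat_star (Y (d1 div 2))])) = of_real (c * real d1)"
      by (intro alternating_cumulant_Y) auto
  qed
qed


end
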